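(* Let $s\in\{1,-1\}$ and consider the reduced curved two-body problem in curvature $\kappa=s/\rho^2$ with masses $m_1,m_2>0$, $m_1+m_2=1$ (see context). For every $n\in\mathbf N$ and all sufficiently large $m\in\mathbf N$ (depending on $n$), there exist periodic orbits of the reduced curved two-body problem (for some value $c$ of the angular momentum level) for which, over one period, the bodies make $m$ revolutions about their osculating conics while the osculating conic precesses around the origin $n$ times.
   Context: Reduced curved two-body problem. Two point masses $m_1,m_2>0$, $m_1+m_2=1$, move on the sphere ($s=1$) or hyperbolic plane ($s=-1$) of curvature $\kappa=s/\rho^2$, attracted by the potential $-\frac{m_1m_2}{\rho}\cot\varphi$ (resp. $-\frac{m_1m_2}{\rho}\coth\varphi$), where $\rho\varphi$ is their distance. Write $M:=m_1m_2$, and $S=\sin$ if $s=1$, $S=\sinh$ if $s=-1$, with $S'$ its derivative. After fixing the angular momentum and reducing by the isometry group, the dynamics is the Hamiltonian flow, with respect to $\omega=dp_\varphi\wedge d\varphi+dp_\theta\wedge d\theta$, of $$F_{red}=\frac{p_\varphi^2}{2M\rho^2}-\frac{M}{\rho}\frac{S'(\varphi)}{S(\varphi)}+\frac{\nu_1^2}{2\rho^2}+\nu_2^2\,\frac{m_1S(m_2\varphi)^2+m_2S(m_1\varphi)^2}{2M\rho^2S(\varphi)^2}+\nu_3^2\,\frac{m_1S'(m_2\varphi)^2+m_2S'(m_1\varphi)^2}{2M\rho^2S(\varphi)^2}+\nu_2\nu_3\,\frac{m_2S'(m_1\varphi)S(m_1\varphi)-m_1S'(m_2\varphi)S(m_2\varphi)}{M\rho^2S(\varphi)^2},$$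 where $(\nu_1,\nu_2,\nu_3)=(\sqrt{c-sp_\theta^2}\,\sin\theta,\ \sqrt{c-sp_\theta^2}\,\cos\theta,\ p_\theta)$, $sp_\theta^2<c$, and the constant $c$ is the value of $\nu_1^2+\nu_2^2+s\nu_3^2$, i.e. the squared norm of the (nonzero) angular momentum vector (Minkowski norm when $s=-1$). Osculating conics. Let $Kep_\kappa=\frac{1}{2\rho^2M}\left(p_\varphi^2+\frac{p_\theta^2}{S(\varphi)^2}\right)-\frac M\rho\frac{S'(\varphi)}{S(\varphi)}$ (curved Kepler Hamiltonian). At each instant, the osculating conic of a motion of $F_{red}$ is the trajectory (a curved conic section with focus at the origin $\varphi=0$) in polar coordinates $(\varphi,\theta)$ that would be followed under $Kep_\kappa$ with the instantaneous position and momentum. When it is bounded and non-circular it is described by Delaunay coordinates $(L,\ell,G,g)$: $G=p_\theta$; $g$ is the argument of pericenter (value of $\theta$ where $\varphi$ is minimal along the Kepler orbit); $L>0$ is determined by $Kep_\kappa=-\frac{M^3}{2L^2}+\kappa\frac{L^2}{2M}$ (with $L^2<M^2\rho$ if $s=-1$); $\ell\in\mathbf R/2\pi\mathbf Z$ is $2\pi$ times the fraction of the Kepler period elapsed since pericenter. "The bodies make $m$ revolutions about their osculating conics" means that (a continuous lift of) $\ell$ increases by $2\pi m$ over the period; "the osculating conic precesses around the origin $n$ times" means that (a continuous lift of) $g$ changes by $2\pi n$ in absolute value over the period. *)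

theory Defs
  imports "HOL-Analysis.Analysis"
begin

text \<open>
  A state is \<open>(\<phi>, p\<^sub>\<phi>, \<theta>, p\<^sub>\<theta>)\<close>. The angle \<open>\<theta>\<close> is represented by a real number; two
  representatives of the same point of phase space are related by \<open>same_state\<close>.
  The parameter \<open>s\<close> is \<open>1\<close> (sphere) or \<open>-1\<close> (hyperbolic plane).
\<close>

type_synonym state = "real \<times> real \<times> real \<times> real"

fun phi :: "state \<Rightarrow> real" where "phi (\<phi>, p, \<theta>, G) = \<phi>"
fun theta :: "state \<Rightarrow> real" where "theta (\<phi>, p, \<theta>, G) = \<theta>"
fun p_theta :: "state \<Rightarrow> real" where "p_theta (\<phi>, p, \<theta>, G) = G"

fun same_state :: "state \<Rightarrow> state \<Rightarrow> bool" where
  "same_state (\<phi>, p, \<theta>, G) (\<phi>', p', \<theta>', G') \<longleftrightarrow>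
     \<phi> = \<phi>' \<and> p = p' \<and> G = G' \<and> (\<exists>k::int. \<theta> = \<theta>' + 2 * pi * of_int k)"

definition S :: "real \<Rightarrow> real \<Rightarrow> real" where
  "S s x = (if s = 1 then sin x else sinh x)"

definition S' :: "real \<Rightarrow> real \<Rightarrow> real" where
  "S' s x = (if s = 1 then cos x else cosh x)"

lemma S_has_derivative: "(S s has_real_derivative S' s x) (at x)"
  by (cases "s = 1") (auto simp: S_def [abs_def] S'_def intro!: derivative_eq_intros)

text \<open>
  The Hamiltonian vector field for \<open>dp\<^sub>\<phi> \<and> d\<phi> + dp\<^sub>\<theta> \<and> d\<theta>\<close>, with the usual sign
  convention \<open>q' = \<partial>H/\<partial>p\<close>, \<open>p' = - \<partial>H/\<partial>q\<close>.
\<close>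

fun hamiltonian_field :: "(state \<Rightarrow> real) \<Rightarrow> state \<Rightarrow> state" where
  "hamiltonian_field H (\<phi>, p, \<theta>, G) =
     (deriv (\<lambda>u. H (\<phi>, u, \<theta>, G)) p,
      - deriv (\<lambda>u. H (u, p, \<theta>, G)) \<phi>,
      deriv (\<lambda>u. H (\<phi>, p, \<theta>, u)) G,
      - deriv (\<lambda>u. H (\<phi>, p, u, G)) \<theta>)"

definition hamiltonian_motion :: "(state \<Rightarrow> real) \<Rightarrow> state set \<Rightarrow> (real \<Rightarrow> state) \<Rightarrow> bool" where
  "hamiltonian_motion H D x \<longleftrightarrow>
     (\<forall>t. x t \<in> D \<and> (x has_vector_derivative hamiltonian_field H (x t)) (at t))"

definition has_period :: "(real \<Rightarrow> state) \<Rightarrow> real \<Rightarrow> bool" where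
  "has_period x T \<longleftrightarrow> T > 0 \<and> (\<forall>t. same_state (x (t + T)) (x t))"

definition has_least_period :: "(real \<Rightarrow> state) \<Rightarrow> real \<Rightarrow> bool" where
  "has_least_period x T \<longleftrightarrow> has_period x T \<and> (\<forall>T'. has_period x T' \<longrightarrow> T \<le> T')"

definition polar_domain :: "real \<Rightarrow> state set" where
  "polar_domain s = {x. 0 < phi x \<and> (s = 1 \<longrightarrow> phi x < pi)}"

fun F_red :: "real \<Rightarrow> real \<Rightarrow> real \<Rightarrow> real \<Rightarrow> real \<Rightarrow> state \<Rightarrow> real" where
  "F_red s \<rho> m1 m2 c (\<phi>, p, \<theta>, G) =
    (let M = m1 * m2;
         \<nu>1 = sqrt (c - s * G\<^sup>2) * sin \<theta>;
         \<nu>2 = sqrt (c - s * G\<^sup>2) * cos \<theta>;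
         \<nu>3 = G
     in p\<^sup>2 / (2 * M * \<rho>\<^sup>2) - M / \<rho> * (S' s \<phi> / S s \<phi>) + \<nu>1\<^sup>2 / (2 * \<rho>\<^sup>2)
        + \<nu>2\<^sup>2 * ((m1 * (S s (m2 * \<phi>))\<^sup>2 + m2 * (S s (m1 * \<phi>))\<^sup>2) / (2 * M * \<rho>\<^sup>2 * (S s \<phi>)\<^sup>2))
        + \<nu>3\<^sup>2 * ((m1 * (S' s (m2 * \<phi>))\<^sup>2 + m2 * (S' s (m1 * \<phi>))\<^sup>2) / (2 * M * \<rho>\<^sup>2 * (S s \<phi>)\<^sup>2))
        + \<nu>2 * \<nu>3 * ((m2 * S' s (m1 * \<phi>) * S s (m1 * \<phi>) - m1 * S' s (m2 * \<phi>) * S s (m2 * \<phi>))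
                      / (M * \<rho>\<^sup>2 * (S s \<phi>)\<^sup>2)))"

definition reduced_motion ::
  "real \<Rightarrow> real \<Rightarrow> real \<Rightarrow> real \<Rightarrow> real \<Rightarrow> (real \<Rightarrow> state) \<Rightarrow> bool" where
  "reduced_motion s \<rho> m1 m2 c x \<longleftrightarrow>
     hamiltonian_motion (F_red s \<rho> m1 m2 c) {y \<in> polar_domain s. s * (p_theta y)\<^sup>2 < c} x"

fun Kep :: "real \<Rightarrow> real \<Rightarrow> real \<Rightarrow> state \<Rightarrow> real" where
  "Kep s \<rho> M (\<phi>, p, \<theta>, G) =
     1 / (2 * \<rho>\<^sup>2 * M) * (p\<^sup>2 + G\<^sup>2 / (S s \<phi>)\<^sup>2) - M / \<rho> * (S' s \<phi> / S s \<phi>)"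

definition kepler_motion :: "real \<Rightarrow> real \<Rightarrow> real \<Rightarrow> (real \<Rightarrow> state) \<Rightarrow> bool" where
  "kepler_motion s \<rho> M K \<longleftrightarrow> hamiltonian_motion (Kep s \<rho> M) (polar_domain s) K"

text \<open>
  \<open>delaunay s \<rho> M x L l G g\<close>: the Kepler motion through the state \<open>x\<close> is bounded and
  non-circular, and \<open>x\<close> has Delaunay coordinates \<open>(L, l, G, g)\<close>. The time of the Kepler motion
  \<open>K\<close> is normalised so that it passes the pericenter at time \<open>0\<close> and \<open>x\<close> at time \<open>\<tau>\<close>.
  Boundedness is implied by the existence of the Kepler period \<open>T\<close>. The reals \<open>l\<close> and
  \<open>g\<close> are arbitrary representatives of the angles modulo \<open>2\<pi>\<close>.
\<close>

definition delaunay ::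
  "real \<Rightarrow> real \<Rightarrow> real \<Rightarrow> state \<Rightarrow> real \<Rightarrow> real \<Rightarrow> real \<Rightarrow> real \<Rightarrow> bool" where
  "delaunay s \<rho> M x L l G g \<longleftrightarrow>
     (\<exists>K T \<tau>. kepler_motion s \<rho> M K \<and> has_least_period K T \<and>
        same_state (K \<tau>) x \<and>
        (\<exists>t. phi (K t) \<noteq> phi (K 0)) \<and> (\<forall>t. phi (K 0) \<le> phi (K t)) \<and>
        l = 2 * pi * (\<tau> / T) \<and> g = theta (K 0)) \<and>
     G = p_theta x \<and>
     L > 0 \<and> (s = -1 \<longrightarrow> L\<^sup>2 < M\<^sup>2 * \<rho>) \<and>
     Kep s \<rho> M x = - (M ^ 3 / (2 * L\<^sup>2)) + s / \<rho>\<^sup>2 * (L\<^sup>2 / (2 * M))"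

text \<open>Continuous lifts of the angles \<open>l\<close> and \<open>g\<close> along the motion \<open>x\<close> during \<open>[0, T]\<close>.\<close>

definition delaunay_lift ::
  "real \<Rightarrow> real \<Rightarrow> real \<Rightarrow> (real \<Rightarrow> state) \<Rightarrow> real \<Rightarrow> (real \<Rightarrow> real) \<Rightarrow> (real \<Rightarrow> real) \<Rightarrow> bool" where
  "delaunay_lift s \<rho> M x T l g \<longleftrightarrow>
     continuous_on {0..T} l \<and> continuous_on {0..T} g \<and>
     (\<forall>t\<in>{0..T}. \<exists>L G. delaunay s \<rho> M (x t) L (l t) G (g t))"

end

theory Submission
  imports Defs
begin

text \<open>
  When the bodies are close, \<open>F_red\<close> is the Kepler Hamiltonian plus
  \<open>(c - 2 s G\<^sup>2) / (2 \<rho>\<^sup>2)\<close>, \<open>G = p\<^sub>\<theta>\<close>, plus smaller terms. The explicit term only makes the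
  osculating conic precess, at the rate \<open>- 2 s G / \<rho>\<^sup>2\<close>. If \<open>G\<close> has the size of a small \<open>\<delta>\<close> and
  \<open>c = 5 \<delta>\<^sup>2\<close>, then the precession per revolution has order \<open>\<delta>\<^sup>4\<close>, while the relative changes of
  the eccentricity \<open>e\<close> and of \<open>G\<close> have order \<open>\<delta>\<^sup>6\<close>. Hence over \<open>m\<close> revolutions with \<open>m\<close> of order
  \<open>n / \<delta>\<^sup>4\<close> the conic keeps its shape and precesses by an angle of order \<open>n\<close>.

  The flow is reversed by \<open>(\<phi>, p\<^sub>\<phi>, \<theta>, p\<^sub>\<theta>) \<mapsto> (\<phi>, - p\<^sub>\<phi>, - \<theta>, p\<^sub>\<theta>)\<close>, so an orbit that starts at
  pericenter with \<open>\<theta> = 0\<close> is periodic as soon as \<open>\<theta> \<in> \<pi> \<int>\<close> at a later apsis. The true anomaly \<open>f\<close>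
  serves as independent variable, so that the apsis is the fixed end point \<open>f = \<pi> m\<close> and the only
  remaining condition, that the argument \<open>g\<close> of the pericenter has moved by \<open>- s \<pi> n\<close>, is met by
  varying the initial value of \<open>G\<close> (intermediate value theorem).
\<close>

section \<open>Ordinary differential equations\<close>

text \<open>The orders of magnitude arise as follows. The orbit has size \<phi> of order
  \<open>\<delta> ^ 2\<close> and the Kepler angular velocity is of order
  \<open>1 / \<delta> ^ 3\<close>, so a precession rate of order \<delta> amounts to
  \<open>\<delta> ^ 4\<close> per revolution. The other perturbation terms are smaller because the
  lowest-order terms in \<phi> of their coefficients cancel, partly by \<open>m1 + m2 = 1\<close>.
  With \<open>c = 5 * \<delta>\<^sup>2\<close> the quantity \<open>c - s * G\<^sup>2\<close> stays
  above \<open>\<delta>\<^sup>2\<close> for \<open>G \<le> 2 * \<delta>\<close> and both signs of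
  \<open>s\<close>, so its square root is smooth. The obstacle is that the equations of the elements
  are singular at \<open>e = 0\<close> and that the estimates hold only in a box of values
  \<open>(e, G)\<close>. The field is therefore clamped to this box, which gives global solutions;
  the drift bounds of the clamped field then show that a solution with \<open>e = 1 / 2\<close> at
  the start never leaves the box. The precession angle is not expanded: crude bounds by two
  multiples of \<open>G ^ 4\<close> suffice, since the initial \<open>G\<close> varies by a factor
  large enough to absorb their ratio.\<close>

lemma continuous_has_antiderivative:
  fixes h :: "real \<Rightarrow> 'a::euclidean_space"
  assumes "continuous_on UNIV h"
  shows "\<exists>H. H 0 = 0 \<and> (\<forall>t. (H has_vector_derivative h t) (at t))"
proof -
  have "\<exists>F. \<forall>x::real. -\<infinity> < ereal x \<longrightarrow> ereal x < \<infinity> \<longrightarrow> (F has_vector_derivative h x) (at x)"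
    by (rule einterval_antiderivative) (use assms in \<open>auto simp: continuous_on_eq_continuous_at\<close>)
  then obtain F where F: "\<And>x. (F has_vector_derivative h x) (at x)" by auto
  have "((\<lambda>t. F t - F 0) has_vector_derivative h t) (at t)" for t
    using has_vector_derivative_diff[OF F[of t] has_vector_derivative_const[of "F 0" "at t"]] by simp
  then show ?thesis by (intro exI[of _ "\<lambda>t. F t - F 0"]) auto
qed

text \<open>Integration against the weight \<open>exp (k * \<bar>t\<bar>)\<close> gains the factor
  \<open>1 / k\<close>; with \<open>k = 2 * L\<close> this gain becomes the contraction constant of
  the Picard operator. Negative times follow by reflecting \<open>H\<close>.\<close>

lemma antiderivative_exp_bound:
  fixes h :: "real \<Rightarrow> 'a::real_normed_vector"
  assumes H: "H 0 = 0" "\<And>t. (H has_vector_derivative h t) (at t)"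
    and k: "k > 0" and bnd: "\<And>t. norm (h t) \<le> c * exp (k * \<bar>t\<bar>)"
  shows "norm (H t) \<le> c / k * exp (k * \<bar>t\<bar>)"
proof -
  have c: "c \<ge> 0" using order_trans[OF norm_ge_zero bnd[of 0]] by simp
  have forward: "norm (H t) \<le> c / k * exp (k * t)"
    if t: "t \<ge> 0" and H: "H 0 = 0" "\<And>t. (H has_vector_derivative h t) (at t)"
      and bnd: "\<And>t. norm (h t) \<le> c * exp (k * \<bar>t\<bar>)" for H h :: "real \<Rightarrow> 'a" and t
  proof (cases "t = 0")
    case True then show ?thesis using c k H(1) by simp
  next
    case False
    have k0: "k \<noteq> 0" using k by simp
    have "norm (H t - H 0) \<le> c / k * exp (k * t) - c / k * exp (k * 0)"
    proof (rule differentiable_bound_general[where f' = h and \<phi>' = "\<lambda>x. c * exp (k * x)"])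
      show "continuous_on {0..t} H"
        using H(2) by (meson continuous_at_imp_continuous_on has_vector_derivative_continuous)
      show "((\<lambda>b. c / k * exp (k * b)) has_vector_derivative c * exp (k * x)) (at x)" for x
        using k by (auto intro!: derivative_eq_intros simp: has_real_derivative_iff_has_vector_derivative[symmetric])
      show "norm (h x) \<le> c * exp (k * x)" if "0 < x" for x using bnd[of x] that by simp
    qed (use t False H(2) k0 in \<open>auto intro!: continuous_intros\<close>)
    moreover have "c / k * exp (k * 0) \<ge> 0" using c k by simp
    ultimately show ?thesis using H(1) by simp
  qed
  show ?thesis
  proof (cases "t \<ge> 0")
    case True then show ?thesis using forward[OF True H bnd] by simp
  next
    case False
    have "((\<lambda>t. H (- t)) has_vector_derivative - h (- t)) (at t)" for t
      using vector_diff_chain_at[of uminus "-1" t H "h (- t)"] H(2)[of "- t"]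
      by (auto simp: o_def has_vector_derivative_minus intro!: derivative_eq_intros)
    with forward[of "- t" "\<lambda>t. H (- t)" "\<lambda>t. - h (- t)"] show ?thesis
      using False H(1) bnd[of "- t" for t] by simp
  qed
qed

text \<open>
  The fixed point is sought in the form \<open>x t = exp (2 L \<bar>t\<bar>) u t\<close> with \<open>u\<close> bounded: this weight
  makes the Picard operator a contraction on the whole line.
\<close>

lemma picard_lindelof:
  fixes V :: "real \<Rightarrow> 'a::euclidean_space \<Rightarrow> 'a"
  assumes cont: "continuous_on UNIV (\<lambda>(t, x). V t x)"
    and L: "L > 0" "\<And>t x y. norm (V t x - V t y) \<le> L * norm (x - y)"
    and B: "\<And>t x. norm (V t x) \<le> B"
  shows "\<exists>x. x 0 = x0 \<and> (\<forall>t. (x has_vector_derivative V t (x t)) (at t))"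
proof -
  define W where "W t = exp (2 * L * \<bar>t\<bar>)" for t :: real
  have W: "W t > 0" "1 \<le> W t" "inverse (W t) \<le> 1" for t
    using L by (auto simp: W_def inverse_le_1_iff)
  have contW: "continuous_on UNIV W" unfolding W_def by (intro continuous_intros)
  have contV: "continuous_on UNIV (\<lambda>t. V t (x t))" if "continuous_on UNIV x" for x
    using continuous_on_compose2[OF cont continuous_on_Pair[OF continuous_on_id that]] by simp
  have "\<exists>H. H 0 = 0 \<and> (\<forall>t. (H has_vector_derivative V t (W t *\<^sub>R apply_bcontfun u t)) (at t))" for u
    by (intro continuous_has_antiderivative contV continuous_intros contW) auto
  then obtain H where H0: "\<And>u. H u 0 = 0" and
    H: "\<And>u t. (H u has_vector_derivative V t (W t *\<^sub>R apply_bcontfun u t)) (at t)"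
    by metis
  have contH: "continuous_on UNIV (H u)" for u
    using H by (meson continuous_at_imp_continuous_on has_vector_derivative_continuous)
  define B' where "B' = max B 0"
  have Hb: "norm (H u t) \<le> B' / (2 * L) * W t" for u t
    unfolding W_def
  proof (rule antiderivative_exp_bound[OF H0 H])
    fix t
    have "norm (V t (W t *\<^sub>R apply_bcontfun u t)) \<le> B' * 1"
      using order_trans[OF B max.cobounded1] by (simp add: B'_def)
    also have "\<dots> \<le> B' * exp (2 * L * \<bar>t\<bar>)"
      using W(2)[of t] by (intro mult_left_mono) (auto simp: B'_def W_def)
    finally show "norm (V t (W t *\<^sub>R apply_bcontfun u t)) \<le> B' * exp (2 * L * \<bar>t\<bar>)" .
  qed (use L in auto)
  \<comment> \<open>The Picard operator conjugated by the weight. It maps bounded functions to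
    bounded functions because \<open>H u\<close> grows no faster than \<open>W\<close>.\<close>
  define P where "P u = Bcontfun (\<lambda>t. inverse (W t) *\<^sub>R (x0 + H u t))" for u
  have P: "apply_bcontfun (P u) t = inverse (W t) *\<^sub>R (x0 + H u t)" for u t
  proof -
    have "(\<lambda>t. inverse (W t) *\<^sub>R (x0 + H u t)) \<in> bcontfun"
    proof (rule bcontfun_normI)
      show "continuous_on UNIV (\<lambda>t. inverse (W t) *\<^sub>R (x0 + H u t))"
        using W(1) by (intro continuous_intros contW contH) (auto simp: less_imp_neq[symmetric] dest: less_imp_neq)
      fix t
      have "norm (inverse (W t) *\<^sub>R (x0 + H u t)) \<le> inverse (W t) * (norm x0 + norm (H u t))"
        using W(1)[of t] by (auto intro!: mult_left_mono norm_triangle_ineq)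
      also have "\<dots> \<le> inverse (W t) * norm x0 + inverse (W t) * (B' / (2 * L) * W t)"
        using mult_left_mono[OF Hb[of u t], of "inverse (W t)"] W(1)[of t] by (simp add: distrib_left)
      also have "\<dots> \<le> 1 * norm x0 + B' / (2 * L)"
        using W[of t] by (intro add_mono mult_right_mono) (auto simp: field_simps)
      finally show "norm (inverse (W t) *\<^sub>R (x0 + H u t)) \<le> 1 * norm x0 + B' / (2 * L)" .
    qed
    then show ?thesis unfolding P_def by (simp add: Bcontfun_inverse)
  qed
  have "dist (P u) (P v) \<le> 1 / 2 * dist u v" for u v
  proof (rule dist_bound)
    fix t
    \<comment> \<open>The Lipschitz constant \<open>L\<close> against the growth rate
      \<open>2 * L\<close> leaves the ratio 1/2.\<close>
    have "norm (H u t - H v t) \<le> L * dist u v / (2 * L) * exp (2 * L * \<bar>t\<bar>)"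
    proof (rule antiderivative_exp_bound[where H = "\<lambda>t. H u t - H v t"
          and h = "\<lambda>t. V t (W t *\<^sub>R apply_bcontfun u t) - V t (W t *\<^sub>R apply_bcontfun v t)"])
      fix t
      have "norm (V t (W t *\<^sub>R apply_bcontfun u t) - V t (W t *\<^sub>R apply_bcontfun v t))
        \<le> L * norm (W t *\<^sub>R (apply_bcontfun u t - apply_bcontfun v t))"
        using L(2) by (simp add: scaleR_diff_right)
      also have "\<dots> \<le> L * (W t * dist u v)"
        using W(1)[of t] L(1) dist_bounded[of u t v] by (simp add: dist_norm)
      finally show "norm (V t (W t *\<^sub>R apply_bcontfun u t) - V t (W t *\<^sub>R apply_bcontfun v t))
        \<le> L * dist u v * exp (2 * L * \<bar>t\<bar>)" by (simp add: W_def mult_ac)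
    qed (use L H0 in \<open>auto intro!: has_vector_derivative_diff H\<close>)
    then have "norm (H u t - H v t) \<le> 1 / 2 * dist u v * W t"
      using L by (simp add: W_def)
    then have "inverse (W t) * norm (H u t - H v t) \<le> inverse (W t) * (1 / 2 * dist u v * W t)"
      using W(1)[of t] by (intro mult_left_mono) auto
    also have "\<dots> = 1 / 2 * dist u v" using W(1)[of t] by simp
    finally have "inverse (W t) * norm (H u t - H v t) \<le> 1 / 2 * dist u v" .
    moreover have "dist (apply_bcontfun (P u) t) (apply_bcontfun (P v) t)
        = inverse (W t) * norm (H u t - H v t)"
    proof -
      have "apply_bcontfun (P u) t - apply_bcontfun (P v) t = inverse (W t) *\<^sub>R (H u t - H v t)"
        unfolding P by (simp add: algebra_simps)
      then show ?thesis using W(1)[of t] by (simp add: dist_norm)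
    qed
    ultimately show "dist (apply_bcontfun (P u) t) (apply_bcontfun (P v) t) \<le> 1 / 2 * dist u v"
      by simp
  qed
  then obtain u where u: "P u = u"
    using banach_fix_type[of "1/2" P] by auto
  define x where "x t = x0 + H u t" for t
  have "W t *\<^sub>R apply_bcontfun u t = x t" for t
    using P[of u t] W(1)[of t] unfolding u x_def by simp
  then have "(x has_vector_derivative V t (x t)) (at t)" for t
    unfolding x_def using has_vector_derivative_add[OF has_vector_derivative_const H[of u t], of x0] by simp
  then show ?thesis using H0 by (intro exI[of _ x]) (auto simp: x_def)
qed

text \<open>The squared distance times \<open>exp (- 2 * L * t)\<close> is nonincreasing. The square
  is used because the norm itself is not differentiable where the solutions meet.\<close>

lemma gronwall_forward:
  fixes x y :: "real \<Rightarrow> 'a::real_inner"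
  assumes x: "\<And>t. (x has_vector_derivative x' t) (at t)"
    and y: "\<And>t. (y has_vector_derivative y' t) (at t)"
    and L: "\<And>t. norm (x' t - y' t) \<le> L * norm (x t - y t)"
    and "t0 \<le> t"
  shows "norm (x t - y t) \<le> norm (x t0 - y t0) * exp (L * (t - t0))"
proof -
  define D where "D t = (x t - y t) \<bullet> (x t - y t) * exp (- 2 * L * t)" for t
  have z: "((\<lambda>t. x t - y t) has_vector_derivative x' t - y' t) (at t)" for t
    by (intro has_vector_derivative_diff x y)
  have zz: "((\<lambda>t. (x t - y t) \<bullet> (x t - y t)) has_real_derivative 2 * ((x t - y t) \<bullet> (x' t - y' t))) (at t)" for t
    unfolding has_real_derivative_iff_has_vector_derivative
    using bounded_bilinear.has_vector_derivative[OF bounded_bilinear_inner z[of t] z[of t]]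
    by (simp add: inner_commute)
  have D: "\<exists>d. (D has_real_derivative d) (at t) \<and> d \<le> 0" for t
  proof -
    have "(x t - y t) \<bullet> (x' t - y' t) \<le> norm (x t - y t) * norm (x' t - y' t)"
      by (rule norm_cauchy_schwarz)
    also have "\<dots> \<le> norm (x t - y t) * (L * norm (x t - y t))"
      using L by (intro mult_left_mono) auto
    also have "\<dots> = L * ((x t - y t) \<bullet> (x t - y t))"
      by (simp add: dot_square_norm power2_eq_square)
    finally have le: "(x t - y t) \<bullet> (x' t - y' t) - L * ((x t - y t) \<bullet> (x t - y t)) \<le> 0" by simp
    have "(D has_real_derivative 2 * ((x t - y t) \<bullet> (x' t - y' t) - L * ((x t - y t) \<bullet> (x t - y t))) * exp (- 2 * L * t)) (at t)"
      unfolding D_def by (rule derivative_eq_intros zz refl)+ (simp add: algebra_simps)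
    moreover have "2 * ((x t - y t) \<bullet> (x' t - y' t) - L * ((x t - y t) \<bullet> (x t - y t))) * exp (- 2 * L * t) \<le> 0"
      using le by (auto intro!: mult_nonpos_nonneg)
    ultimately show ?thesis by blast
  qed
  have le: "D t \<le> D t0" by (rule DERIV_nonpos_imp_nonincreasing[OF \<open>t0 \<le> t\<close> D])
  have "(norm (x t - y t))\<^sup>2 \<le> (norm (x t0 - y t0) * exp (L * (t - t0)))\<^sup>2"
  proof -
    have "D t * exp (2 * L * t) \<le> D t0 * exp (2 * L * t)" using le by (simp add: mult_right_mono)
    moreover have "D t * exp (2 * L * t) = (norm (x t - y t))\<^sup>2"
      by (simp add: D_def dot_square_norm mult.assoc flip: exp_add)
    moreover have "D t0 * exp (2 * L * t) = (norm (x t0 - y t0) * exp (L * (t - t0)))\<^sup>2"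
    proof -
      have "exp (- 2 * L * t0) * exp (2 * L * t) = exp (2 * (L * (t - t0)))"
        by (simp add: algebra_simps flip: exp_add)
      then show ?thesis by (simp add: D_def dot_square_norm mult.assoc power_mult_distrib exp_double)
    qed
    ultimately show ?thesis by simp
  qed
  then show ?thesis by (rule power2_le_imp_le) simp
qed

text \<open>Backward times follow by reversing time in both solutions. The bound serves for
  uniqueness and for continuity in the initial value.\<close>

lemma gronwall:
  fixes x y :: "real \<Rightarrow> 'a::real_inner"
  assumes x: "\<And>t. (x has_vector_derivative V t (x t)) (at t)"
    and y: "\<And>t. (y has_vector_derivative V t (y t)) (at t)"
    and L: "\<And>t x y. norm (V t x - V t y) \<le> L * norm (x - y)"
  shows "norm (x t - y t) \<le> norm (x t0 - y t0) * exp (L * \<bar>t - t0\<bar>)"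
proof (cases "t0 \<le> t")
  case True
  then show ?thesis using gronwall_forward[OF x y L True] by simp
next
  case False
  have r: "((\<lambda>t. z (- t)) has_vector_derivative - V (- t) (z (- t))) (at t)"
    if "\<And>t. (z has_vector_derivative V t (z t)) (at t)" for z t
    using vector_diff_chain_at[of uminus "-1" t z "V (- t) (z (- t))"] that[of "- t"]
    by (auto simp: o_def has_vector_derivative_minus intro!: derivative_eq_intros)
  have "norm (x (- (- t)) - y (- (- t))) \<le> norm (x (- (- t0)) - y (- (- t0))) * exp (L * (- t - - t0))"
    by (rule gronwall_forward[OF r[OF x] r[OF y]])
       (use L False in \<open>auto simp: norm_minus_commute\<close>)
  then show ?thesis using False by simp
qed

text \<open>A scalar autonomous equation \<open>\<Theta>' = h \<Theta>\<close>, solved by inverting the clock \<open>I = \<integral> 1 / h\<close>.\<close>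

lemma clock_inverse:
  fixes h I :: "real \<Rightarrow> real"
  assumes I0: "I 0 = 0" and dI: "\<And>u. (I has_real_derivative 1 / h u) (at u)"
    and pos: "\<And>u. h u > 0" and P: "P > 0" and per: "\<And>u. h (u + P) = h u"
  obtains \<Theta> where "\<And>u. \<Theta> (I u) = u" "\<And>t. I (\<Theta> t) = t"
    "\<And>t. (\<Theta> has_real_derivative h (\<Theta> t)) (at t)"
    "I P > 0" "\<And>u. I (u + P) = I u + I P" "strict_mono I"
proof -
  have mono: "strict_mono I"
  proof (rule strict_monoI)
    fix u v :: real assume "u < v"
    then show "I u < I v"
      by (rule DERIV_pos_imp_increasing) (use dI pos in \<open>auto intro!: exI[of _ "1 / h u" for u]\<close>)
  qed
  then have IP: "I P > 0" using I0 P by (metis strict_monoD)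
  have shift: "I (u + P) = I u + I P" for u
  proof -
    have "((\<lambda>u. I (u + P) - I u) has_real_derivative 0) (at u)" for u
      using DERIV_diff[OF DERIV_shift[THEN iffD1, OF dI[of "u + P"]] dI[of u]] per by simp
    then have "I (u + P) - I u = I (0 + P) - I 0" by (intro DERIV_isconst_all) auto
    then show ?thesis using I0 by simp
  qed
  \<comment> \<open>By periodicity \<open>I\<close> grows by the same positive amount on each
    interval of length \<open>P\<close>, so it is unbounded in both directions and hence
    onto.\<close>
  have mult: "I (real n * P) = real n * I P" for n
    using shift[of "real n * P" for n] I0 by (induction n) (auto simp: algebra_simps)
  have multn: "I (- (real n * P)) = - (real n * I P)" for n
  proof (induction n)
    case (Suc n)
    then show ?case using shift[of "- (real (Suc n) * P)"] by (simp add: algebra_simps)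
  qed (simp add: I0)
  have cont: "continuous_on A I" for A
    using dI by (meson DERIV_isCont continuous_at_imp_continuous_on)
  have surj: "\<exists>u. I u = t" for t
  proof -
    obtain n :: nat where n: "\<bar>t\<bar> < real n * I P" using reals_Archimedean3[OF IP] by blast
    then have "I (- (real n * P)) \<le> t" "t \<le> I (real n * P)" by (auto simp: mult multn)
    moreover have "- (real n * P) \<le> real n * P" using P by simp
    ultimately show ?thesis using IVT'[of I "- (real n * P)" t "real n * P"] cont by auto
  qed
  define \<Theta> where "\<Theta> t = (SOME u. I u = t)" for t
  have I\<Theta>: "I (\<Theta> t) = t" for t unfolding \<Theta>_def using surj[of t] by (rule someI_ex)
  have \<Theta>I: "\<Theta> (I u) = u" for u using I\<Theta>[of "I u"] mono by (simp add: strict_mono_eq)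
  have "isCont \<Theta> t" for t
    using isCont_inverse_function[where d = 1 and x = "\<Theta> t" and f = I and g = \<Theta>] \<Theta>I I\<Theta> DERIV_isCont[OF dI] by auto
  then have "(\<Theta> has_real_derivative h (\<Theta> t)) (at t)" for t
    using DERIV_inverse_function[where f = I and g = \<Theta> and x = t and D = "1 / h (\<Theta> t)"
        and a = "t - 1" and b = "t + 1"] dI[of "\<Theta> t"] I\<Theta> pos[of "\<Theta> t"]
    by simp
  then show ?thesis using that \<Theta>I I\<Theta> IP shift mono by blast
qed

section \<open>The curved Kepler problem\<close>

lemma S'_has_derivative:
  assumes "s \<in> {1, -1}"
  shows "(S' s has_real_derivative - s * S s x) (at x)"
  using assms by (auto simp: S_def S'_def [abs_def] intro!: derivative_eq_intros)

lemma S_0 [simp]: "S s 0 = 0" and S'_0 [simp]: "S' s 0 = 1"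
  by (auto simp: S_def S'_def)

lemma S'_square: "s \<in> {1, -1} \<Longrightarrow> (S' s x)\<^sup>2 = 1 - s * (S s x)\<^sup>2"
  by (auto simp: S_def S'_def cosh_square_eq cos_squared_eq)

lemma inverse_S_square_has_derivative:
  assumes "S s x \<noteq> 0"
  shows "((\<lambda>u. 1 / (S s u)\<^sup>2) has_real_derivative - 2 * (S' s x / S s x) * (1 / (S s x)\<^sup>2)) (at x)"
  using assms by (auto intro!: derivative_eq_intros S_has_derivative simp: power2_eq_square divide_simps)

lemma cot_has_derivative:
  assumes "s \<in> {1, -1}" "S s x \<noteq> 0"
  shows "((\<lambda>u. S' s u / S s u) has_real_derivative - (1 / (S s x)\<^sup>2)) (at x)"
proof -
  have "((\<lambda>u. S' s u / S s u) has_real_derivative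
      (- s * S s x * S s x - S' s x * S' s x) / (S s x * S s x)) (at x)"
    by (rule DERIV_divide S_has_derivative S'_has_derivative assms)+
  moreover have "- s * S s x * S s x - S' s x * S' s x = - 1"
    using S'_square[OF assms(1), of x] by (simp add: power2_eq_square)
  ultimately show ?thesis by (simp add: power2_eq_square)
qed

lemma S_pos: "0 < x \<Longrightarrow> (s = 1 \<longrightarrow> x < pi) \<Longrightarrow> S s x > 0"
  by (auto simp: S_def sin_gt_zero)

text \<open>Inverse of \<open>\<phi> \<mapsto> S' \<phi> / S \<phi>\<close>, used for arguments above \<open>1\<close> only.\<close>

definition acot :: "real \<Rightarrow> real \<Rightarrow> real" where
  "acot s w = (if s = 1 then arctan (1 / w) else artanh (1 / w))"

lemma acot_has_derivative:
  assumes "s \<in> {1, -1}" "w > 1"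
  shows "(acot s has_real_derivative - 1 / (w\<^sup>2 + s)) (at w)"
proof (cases "s = 1")
  case True
  have "((\<lambda>w. arctan (1 / w)) has_real_derivative - 1 / (w\<^sup>2 + s)) (at w)"
    using assms True
    by (auto intro!: derivative_eq_intros simp: divide_simps power2_eq_square)
  then show ?thesis using True by (simp add: acot_def [abs_def])
next
  case False
  have w2: "w\<^sup>2 > 1" using assms(2) by (simp add: one_less_power)
  have "((\<lambda>w. 1 / w) has_real_derivative - 1 / w\<^sup>2) (at w)"
    using assms(2) by (auto intro!: derivative_eq_intros simp: power2_eq_square)
  from DERIV_chain2[OF artanh_real_has_field_derivative this]
  have "((\<lambda>w. artanh (1 / w)) has_real_derivative 1 / (1 - (1 / w)\<^sup>2) * (- 1 / w\<^sup>2)) (at w)"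
    using assms(2) by simp
  moreover have "1 / (1 - (1 / w)\<^sup>2) * (- 1 / w\<^sup>2) = - 1 / (w\<^sup>2 + s)"
    using assms False w2 by (auto simp: field_simps)
  ultimately have "((\<lambda>w. artanh (1 / w)) has_real_derivative - 1 / (w\<^sup>2 + s)) (at w)" by simp
  then show ?thesis using False by (simp add: acot_def [abs_def])
qed

lemma acot_strict_antimono:
  assumes "s \<in> {1, -1}" "1 < v" "v < w"
  shows "acot s w < acot s v"
proof (rule DERIV_neg_imp_decreasing[OF assms(3)])
  fix x assume "v \<le> x" "x \<le> w"
  then have x: "x > 1" using assms by simp
  then have "x\<^sup>2 > 1" by (simp add: one_less_power)
  then show "\<exists>y. (acot s has_real_derivative y) (at x) \<and> y < 0"
    using acot_has_derivative[OF assms(1) x] assms(1) by (intro exI[of _ "- 1 / (x\<^sup>2 + s)"]) auto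
qed

lemma acot_antimono: "s \<in> {1, -1} \<Longrightarrow> 1 < v \<Longrightarrow> v \<le> w \<Longrightarrow> acot s w \<le> acot s v"
  using acot_strict_antimono[of s v w] by (cases "v = w") auto

lemma acot_range:
  assumes "s \<in> {1, -1}" "w > 1"
  shows "0 < acot s w" "s = 1 \<Longrightarrow> acot s w < pi"
proof -
  have "artanh (1 / w) > 0"
  proof -
    have "1 < (1 + 1 / w) / (1 - 1 / w)" using assms by (simp add: less_divide_eq)
    then show ?thesis by (simp add: artanh_def)
  qed
  moreover have "arctan (1 / w) > 0" using assms by (simp add: zero_less_arctan_iff)
  moreover have "arctan (1 / w) < pi" using arctan_ubound[of "1 / w"] pi_gt_zero by linarith
  ultimately show "0 < acot s w" "s = 1 \<Longrightarrow> acot s w < pi"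
    using assms by (auto simp: acot_def)
qed

lemma tanh_artanh_real:
  assumes "\<bar>x :: real\<bar> < 1"
  shows "tanh (artanh x) = x"
proof -
  have "(1 + x) / (1 - x) > 0" using assms by (auto simp: abs_less_iff)
  then have "exp (2 * artanh x) = (1 + x) / (1 - x)" by (simp add: artanh_def)
  moreover have "exp (- 2 * artanh x) = inverse (exp (2 * artanh x))" by (simp add: exp_minus)
  ultimately have e: "exp (- 2 * artanh x) = (1 - x) / (1 + x)" by simp
  have "1 - (1 - x) / (1 + x) = 2 * x / (1 + x)" "1 + (1 - x) / (1 + x) = 2 / (1 + x)"
    using assms by (auto simp: field_simps)
  then show ?thesis using assms unfolding tanh_real_altdef e by simp
qed

lemma S_acot:
  assumes s: "s \<in> {1, -1}" and w: "w > 1"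
  shows "S' s (acot s w) / S s (acot s w) = w" and "1 / (S s (acot s w))\<^sup>2 = w\<^sup>2 + s"
proof -
  have pos: "S s (acot s w) > 0" using S_pos acot_range[OF assms] by auto
  show *: "S' s (acot s w) / S s (acot s w) = w"
  proof (cases "s = 1")
    case True
    have "tan (arctan (1 / w)) = 1 / w" by (rule tan_arctan)
    then have "cot (arctan (1 / w)) = w" by (metis cot_altdef inverse_inverse_eq inverse_eq_divide)
    then show ?thesis using True by (simp add: S_def S'_def acot_def cot_def)
  next
    case False
    have "tanh (artanh (1 / w)) = 1 / w" using w by (intro tanh_artanh_real) auto
    then have "cosh (artanh (1 / w)) / sinh (artanh (1 / w)) = w"
      using w by (auto simp: tanh_def field_simps)
    then show ?thesis using False by (simp add: S_def S'_def acot_def)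
  qed
  have "(S' s (acot s w))\<^sup>2 = w\<^sup>2 * (S s (acot s w))\<^sup>2"
    using * pos by (auto simp: field_simps power2_eq_square)
  then have "1 = (w\<^sup>2 + s) * (S s (acot s w))\<^sup>2"
    using S'_square[OF s, of "acot s w"] by (simp add: algebra_simps)
  then show "1 / (S s (acot s w))\<^sup>2 = w\<^sup>2 + s" using pos by (simp add: field_simps)
qed

section \<open>Conics as Kepler orbits\<close>

locale kepler =
  fixes s \<rho> M :: real
  assumes s: "s \<in> {1, -1}" and \<rho>: "\<rho> > 0" and M: "M > 0"
begin

text \<open>
  In the variable \<open>w = S' \<phi> / S \<phi>\<close> the Kepler orbits are the flat conics
  \<open>w = M\<^sup>2 \<rho> / G\<^sup>2 (1 + e cos f)\<close>, \<open>f = \<theta> - g\<close>. Below, \<open>kw\<close>, \<open>kphi\<close> and \<open>kp\<close> are \<open>w\<close>, \<open>\<phi>\<close>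
  and \<open>p\<^sub>\<phi>\<close> in terms of the eccentricity \<open>e\<close>, of \<open>G\<close> and of the true anomaly \<open>f\<close>; \<open>knu\<close> is the
  angular velocity \<open>f'\<close>.
\<close>

definition kw :: "real \<Rightarrow> real \<Rightarrow> real \<Rightarrow> real" where
  "kw e G f = M\<^sup>2 * \<rho> / G\<^sup>2 * (1 + e * cos f)"

definition kphi :: "real \<Rightarrow> real \<Rightarrow> real \<Rightarrow> real" where
  "kphi e G f = acot s (kw e G f)"

definition kp :: "real \<Rightarrow> real \<Rightarrow> real \<Rightarrow> real" where
  "kp e G f = M\<^sup>2 * \<rho> / G * e * sin f"

definition knu :: "real \<Rightarrow> real \<Rightarrow> real \<Rightarrow> real" where
  "knu e G f = G * ((kw e G f)\<^sup>2 + s) / (M * \<rho>\<^sup>2)"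

text \<open>The last condition says that \<open>kw\<close> exceeds 1 at the apocenter
  \<open>f = pi\<close>. For \<open>s = -1\<close> this is boundedness, as
  \<open>w = coth \<phi>\<close> takes only values above 1; for \<open>s = 1\<close> it keeps the
  orbit where \<open>arctan (1 / w)\<close> inverts the cotangent.\<close>

definition conic :: "real \<Rightarrow> real \<Rightarrow> bool" where
  "conic e G \<longleftrightarrow> 0 < e \<and> e < 1 \<and> G > 0 \<and> G\<^sup>2 < M\<^sup>2 * \<rho> * (1 - e)"

text \<open>The Kepler time from pericenter to true anomaly \<open>f\<close>, that is, the integral
  of \<open>1 / knu\<close> from 0 to \<open>f\<close>. The rescaling to the unit interval covers
  negative \<open>f\<close> and reduces joint continuity in \<open>(e, G, f)\<close> to continuity
  of a parameter integral.\<close>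

definition clock :: "real \<Rightarrow> real \<Rightarrow> real \<Rightarrow> real" where
  "clock e G f = f * integral {0..1} (\<lambda>u. 1 / knu e G (f * u))"

lemma conicD:
  assumes "conic e G"
  shows "0 < e" "e < 1" "G > 0" "G\<^sup>2 < M\<^sup>2 * \<rho> * (1 - e)"
  using assms by (auto simp: conic_def)

lemma kw_gt_1:
  assumes "conic e G"
  shows "kw e G f > 1"
proof -
  note c = conicD[OF assms]
  have "e * (- cos f) \<le> e * 1" using c cos_ge_minus_one[of f] by (intro mult_left_mono) auto
  then have "M\<^sup>2 * \<rho> / G\<^sup>2 * (1 - e) \<le> kw e G f"
    unfolding kw_def using c \<rho> M by (intro mult_left_mono) auto
  moreover have "M\<^sup>2 * \<rho> / G\<^sup>2 * (1 - e) > 1" using c by (simp add: field_simps)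
  ultimately show ?thesis by simp
qed

lemma kw_square_gt: "conic e G \<Longrightarrow> (kw e G f)\<^sup>2 + s > 0"
  using one_less_power[OF kw_gt_1[of e G f], of 2] s by auto

lemma knu_pos: "conic e G \<Longrightarrow> knu e G f > 0"
  using kw_square_gt[of e G f] \<rho> M by (auto simp: knu_def conic_def)

lemma kphi_facts:
  assumes "conic e G"
  shows "0 < kphi e G f" "s = 1 \<Longrightarrow> kphi e G f < pi" "S s (kphi e G f) > 0"
    "S' s (kphi e G f) / S s (kphi e G f) = kw e G f"
    "1 / (S s (kphi e G f))\<^sup>2 = (kw e G f)\<^sup>2 + s"
  using acot_range[OF s kw_gt_1[OF assms]] S_acot[OF s kw_gt_1[OF assms]] S_pos
  unfolding kphi_def by auto

lemma kw_periodic [simp]: "kw e G (f + 2 * pi) = kw e G f"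
  and kp_periodic [simp]: "kp e G (f + 2 * pi) = kp e G f"
  and knu_periodic [simp]: "knu e G (f + 2 * pi) = knu e G f"
  and kphi_periodic [simp]: "kphi e G (f + 2 * pi) = kphi e G f"
  by (auto simp: kw_def kp_def knu_def kphi_def)

lemma Kep_has_derivatives:
  assumes "S s \<phi> \<noteq> 0"
  shows "((\<lambda>u. Kep s \<rho> M (\<phi>, u, \<theta>, G)) has_real_derivative p / (M * \<rho>\<^sup>2)) (at p)" (is ?p)
    and "((\<lambda>u. Kep s \<rho> M (u, p, \<theta>, G)) has_real_derivative
      - (1 / (S s \<phi>)\<^sup>2 * (G\<^sup>2 * (S' s \<phi> / S s \<phi>) / (M * \<rho>\<^sup>2) - M / \<rho>))) (at \<phi>)" (is ?phi)
    and "((\<lambda>u. Kep s \<rho> M (\<phi>, p, \<theta>, u)) has_real_derivative G / (M * \<rho>\<^sup>2) * (1 / (S s \<phi>)\<^sup>2)) (at G)"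
      (is ?G)
proof -
  show ?p
    using \<rho> M by (auto intro!: derivative_eq_intros simp: field_simps)
  show ?phi
  proof -
    have eq: "Kep s \<rho> M (u, p, \<theta>, G) =
        1 / (2 * \<rho>\<^sup>2 * M) * (p\<^sup>2 + G\<^sup>2 * (1 / (S s u)\<^sup>2)) - M / \<rho> * (S' s u / S s u)" for u
      by simp
    have "((\<lambda>u. 1 / (2 * \<rho>\<^sup>2 * M) * (p\<^sup>2 + G\<^sup>2 * (1 / (S s u)\<^sup>2)) - M / \<rho> * (S' s u / S s u))
      has_real_derivative
      1 / (2 * \<rho>\<^sup>2 * M) * (0 + G\<^sup>2 * (- 2 * (S' s \<phi> / S s \<phi>) * (1 / (S s \<phi>)\<^sup>2)))
        - M / \<rho> * - (1 / (S s \<phi>)\<^sup>2)) (at \<phi>)"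
      by (intro DERIV_diff DERIV_add DERIV_cmult DERIV_const cot_has_derivative s
          inverse_S_square_has_derivative assms)
    moreover have "1 / (2 * \<rho>\<^sup>2 * M) * (0 + G\<^sup>2 * (- 2 * x * y)) - M / \<rho> * - y =
        - (y * (G\<^sup>2 * x / (M * \<rho>\<^sup>2) - M / \<rho>))" for x y
      using \<rho> M by (simp add: field_simps)
    ultimately show ?thesis unfolding eq by metis
  qed
  show ?G
  proof -
    have "((\<lambda>u. 1 / (2 * \<rho>\<^sup>2 * M) * (p\<^sup>2 + u\<^sup>2 * (1 / (S s \<phi>)\<^sup>2)) - M / \<rho> * (S' s \<phi> / S s \<phi>))
      has_real_derivative
      1 / (2 * \<rho>\<^sup>2 * M) * (0 + real 2 * G ^ (2 - Suc 0) * (1 / (S s \<phi>)\<^sup>2)) - 0) (at G)"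
      by (intro DERIV_diff DERIV_add DERIV_cmult DERIV_const DERIV_cmult_right DERIV_pow)
    then show ?thesis using \<rho> M by (simp add: algebra_simps)
  qed
qed

lemma kepler_field:
  assumes "S s \<phi> \<noteq> 0"
  shows "hamiltonian_field (Kep s \<rho> M) (\<phi>, p, \<theta>, G) =
    (p / (M * \<rho>\<^sup>2), 1 / (S s \<phi>)\<^sup>2 * (G\<^sup>2 * (S' s \<phi> / S s \<phi>) / (M * \<rho>\<^sup>2) - M / \<rho>),
     G / (M * \<rho>\<^sup>2) * (1 / (S s \<phi>)\<^sup>2), 0)"
  using Kep_has_derivatives[OF assms, THEN DERIV_imp_deriv]
  by (simp del: Kep.simps add: Kep.simps[of s \<rho> M \<phi> p _ G])

lemma kphi_chain:
  assumes "conic e G" "(f has_real_derivative f') (at t)"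
  shows "((\<lambda>t. kphi e G (f t)) has_real_derivative
    M\<^sup>2 * \<rho> / G\<^sup>2 * e * sin (f t) * f' / ((kw e G (f t))\<^sup>2 + s)) (at t)"
proof -
  have "((\<lambda>t. kw e G (f t)) has_real_derivative - (M\<^sup>2 * \<rho> / G\<^sup>2 * e * sin (f t) * f')) (at t)"
    unfolding kw_def
    by (rule DERIV_cong, rule DERIV_cmult, (rule derivative_eq_intros assms(2) refl)+) simp
  from DERIV_chain2[OF acot_has_derivative[OF s kw_gt_1[OF assms(1)]] this]
  show ?thesis unfolding kphi_def by (rule DERIV_cong) simp
qed

text \<open>The radial force is proportional to the deviation \<open>e * cos f\<close> of
  \<open>w\<close> from its circular value. It is separate from the motion on a conic because the
  perturbed motion uses it with varying elements.\<close>

lemma kp_force: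
  assumes "conic e G"
  shows "M\<^sup>2 * \<rho> / G * (e * cos f) * knu e G f =
    ((kw e G f)\<^sup>2 + s) * (G\<^sup>2 * kw e G f / (M * \<rho>\<^sup>2) - M / \<rho>)"
proof -
  note cD = conicD[OF assms]
  have "G\<^sup>2 * kw e G f = M\<^sup>2 * \<rho> * (1 + e * cos f)" using cD by (simp add: kw_def)
  then have "G\<^sup>2 * kw e G f / (M * \<rho>\<^sup>2) - M / \<rho> = M * e * cos f / \<rho>"
    using \<rho> M by (simp add: field_simps power2_eq_square)
  then show ?thesis using cD \<rho> M by (simp add: knu_def power2_eq_square)
qed

lemma kepler_motion_conic:
  assumes c: "conic e G"
    and \<Theta>: "\<And>t. (\<Theta> has_real_derivative knu e G (\<Theta> t)) (at t)"
  shows "kepler_motion s \<rho> M (\<lambda>t. (kphi e G (\<Theta> t), kp e G (\<Theta> t), g + \<Theta> t, G))"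
  unfolding kepler_motion_def hamiltonian_motion_def
proof (intro allI conjI)
  fix t
  let ?f = "\<Theta> t"
  let ?w = "kw e G ?f"
  note cD = conicD[OF c]
  have wpos: "?w\<^sup>2 + s > 0" by (rule kw_square_gt[OF c])
  show "(kphi e G ?f, kp e G ?f, g + ?f, G) \<in> polar_domain s"
    using kphi_facts[OF c] by (auto simp: polar_domain_def)
  have "((\<lambda>t. kphi e G (\<Theta> t)) has_real_derivative kp e G ?f / (M * \<rho>\<^sup>2)) (at t)"
  proof -
    have "M\<^sup>2 * \<rho> / G\<^sup>2 * e * sin ?f * knu e G ?f / (?w\<^sup>2 + s) = kp e G ?f / (M * \<rho>\<^sup>2)"
      using wpos cD \<rho> M by (simp add: knu_def kp_def power2_eq_square)
    then show ?thesis using kphi_chain[OF c \<Theta>[of t]] by metis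
  qed
  moreover have "((\<lambda>t. kp e G (\<Theta> t)) has_real_derivative
      (?w\<^sup>2 + s) * (G\<^sup>2 * ?w / (M * \<rho>\<^sup>2) - M / \<rho>)) (at t)"
  proof -
    have "((\<lambda>t. kp e G (\<Theta> t)) has_real_derivative M\<^sup>2 * \<rho> / G * e * cos ?f * knu e G ?f) (at t)"
      unfolding kp_def
      by (rule DERIV_cong, rule DERIV_cmult, (rule derivative_eq_intros \<Theta> refl)+) simp
    moreover have "M\<^sup>2 * \<rho> / G * e * cos ?f * knu e G ?f = (?w\<^sup>2 + s) * (G\<^sup>2 * ?w / (M * \<rho>\<^sup>2) - M / \<rho>)"
      using kp_force[OF c, of ?f] by simp
    ultimately show ?thesis by simp
  qed
  moreover have "((\<lambda>t. g + \<Theta> t) has_real_derivative knu e G ?f) (at t)"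
    by (rule derivative_eq_intros \<Theta> refl)+ simp
  ultimately have "((\<lambda>t. (kphi e G (\<Theta> t), kp e G (\<Theta> t), g + \<Theta> t, G)) has_vector_derivative
      (kp e G ?f / (M * \<rho>\<^sup>2), (?w\<^sup>2 + s) * (G\<^sup>2 * ?w / (M * \<rho>\<^sup>2) - M / \<rho>), knu e G ?f, 0)) (at t)"
    unfolding has_real_derivative_iff_has_vector_derivative
    by (intro has_vector_derivative_Pair has_vector_derivative_const)
  moreover have "hamiltonian_field (Kep s \<rho> M) (kphi e G ?f, kp e G ?f, g + ?f, G) =
      (kp e G ?f / (M * \<rho>\<^sup>2), (?w\<^sup>2 + s) * (G\<^sup>2 * ?w / (M * \<rho>\<^sup>2) - M / \<rho>), knu e G ?f, 0)"
    using kphi_facts(3)[OF c, of ?f]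
    by (subst kepler_field) (auto simp: kphi_facts(4,5)[OF c] knu_def)
  ultimately show "((\<lambda>t. (kphi e G (\<Theta> t), kp e G (\<Theta> t), g + \<Theta> t, G)) has_vector_derivative
      hamiltonian_field (Kep s \<rho> M) (kphi e G ?f, kp e G ?f, g + ?f, G)) (at t)"
    by simp
qed

lemma continuous_on_inverse_knu:
  fixes e G f :: "'a::t2_space \<Rightarrow> real"
  assumes "continuous_on A e" "continuous_on A G" "continuous_on A f"
    and "\<And>x. x \<in> A \<Longrightarrow> conic (e x) (G x)"
  shows "continuous_on A (\<lambda>x. 1 / knu (e x) (G x) (f x))"
proof -
  have "(G x)\<^sup>2 \<noteq> 0" if "x \<in> A" for x using conicD(3)[OF assms(4)[OF that]] by simp
  then have "continuous_on A (\<lambda>x. kw (e x) (G x) (f x))"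
    unfolding kw_def
    by (intro continuous_on_mult continuous_on_divide continuous_on_add continuous_on_const
        continuous_on_cos continuous_on_power assms(1-3) ballI)
  then have "continuous_on A (\<lambda>x. knu (e x) (G x) (f x))"
    unfolding knu_def using \<rho> M by (intro continuous_intros assms ballI) auto
  moreover have "knu (e x) (G x) (f x) \<noteq> 0" if "x \<in> A" for x
    using knu_pos[OF assms(4)[OF that]] by (metis less_irrefl)
  ultimately show ?thesis by (intro continuous_intros ballI)
qed

lemma clock_0 [simp]: "clock e G 0 = 0"
  by (simp add: clock_def)

lemma clock_has_derivative:
  assumes c: "conic e G"
  shows "(clock e G has_real_derivative 1 / knu e G f) (at f)"
proof -
  have cont: "continuous_on UNIV (\<lambda>u. 1 / knu e G u)"
    by (rule continuous_on_inverse_knu) (use c in \<open>auto intro!: continuous_intros\<close>)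
  obtain H where H: "H 0 = 0" "\<And>t. (H has_real_derivative 1 / knu e G t) (at t)"
    using continuous_has_antiderivative[OF cont] by (auto simp: has_real_derivative_iff_has_vector_derivative)
  have "clock e G f = H f" for f
  proof -
    have "((\<lambda>u. f * (1 / knu e G (f * u))) has_integral H (f * 1) - H (f * 0)) {0..1}"
    proof (rule fundamental_theorem_of_calculus)
      fix u
      have "((\<lambda>u. H (f * u)) has_real_derivative 1 / knu e G (f * u) * f) (at u)"
        by (rule DERIV_chain2[OF H(2)]) (auto intro!: derivative_eq_intros)
      then show "((\<lambda>u. H (f * u)) has_vector_derivative f * (1 / knu e G (f * u))) (at u within {0..1})"
        by (auto simp: has_real_derivative_iff_has_vector_derivative mult.commute
            intro: has_vector_derivative_at_within)
    qed simp
    then have "integral {0..1} (\<lambda>u. f * (1 / knu e G (f * u))) = H f"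
      using H(1) by (simp add: integral_unique)
    then show ?thesis unfolding clock_def by (simp only: integral_mult_right)
  qed
  then have "clock e G = H" by auto
  then show ?thesis using H(2) by simp
qed

lemma continuous_on_clock:
  fixes e G f :: "'a::t2_space \<Rightarrow> real"
  assumes "continuous_on A e" "continuous_on A G" "continuous_on A f"
    and "\<And>x. x \<in> A \<Longrightarrow> conic (e x) (G x)"
  shows "continuous_on A (\<lambda>x. clock (e x) (G x) (f x))"
proof -
  have "continuous_on A (\<lambda>x. integral (cbox 0 1) (\<lambda>u. 1 / knu (e x) (G x) (f x * u)))"
  proof (rule integral_continuous_on_param)
    have "continuous_on (A \<times> cbox 0 1) (\<lambda>y. 1 / knu (e (fst y)) (G (fst y)) (f (fst y) * snd y))"
      by (rule continuous_on_inverse_knu)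
         (auto intro!: continuous_intros continuous_on_compose2[OF assms(1)]
           continuous_on_compose2[OF assms(2)] continuous_on_compose2[OF assms(3)] assms(4))
    then show "continuous_on (A \<times> cbox 0 1) (\<lambda>(x, u). 1 / knu (e x) (G x) (f x * u))"
      by (simp add: case_prod_unfold)
  qed
  then show ?thesis unfolding clock_def by (intro continuous_intros assms(3)) simp
qed

text \<open>Each full turn takes the same time whatever the phase. This later turns
  \<open>f = 2 * pi * m\<close> into exactly \<open>m\<close> Kepler periods, hence into the
  increase \<open>2 * pi * m\<close> of the mean anomaly.\<close>

lemma clock_add_period:
  assumes c: "conic e G"
  shows "clock e G (2 * pi) > 0" "clock e G (f + 2 * pi * real n) = clock e G f + real n * clock e G (2 * pi)"
proof -
  obtain \<Theta> where \<Theta>: "clock e G (2 * pi) > 0" "\<And>u. clock e G (u + 2 * pi) = clock e G u + clock e G (2 * pi)"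
    by (rule clock_inverse[OF clock_0 clock_has_derivative[OF c] knu_pos[OF c], of "2 * pi"]) auto
  show "clock e G (2 * pi) > 0" by fact
  show "clock e G (f + 2 * pi * real n) = clock e G f + real n * clock e G (2 * pi)"
  proof (induction n)
    case (Suc n)
    then show ?case using \<Theta>(2)[of "f + 2 * pi * real n"] by (simp add: algebra_simps)
  qed simp
qed

text \<open>The terms linear in \<open>cos f\<close> cancel between the kinetic and the potential
  energy.\<close>

lemma Kep_conic:
  assumes c: "conic e G"
  shows "Kep s \<rho> M (kphi e G f, kp e G f, \<theta>, G) =
    M / (2 * \<rho>) * (M\<^sup>2 * \<rho> / G\<^sup>2) * (e\<^sup>2 - 1) + s * G\<^sup>2 / (2 * \<rho>\<^sup>2 * M)"
proof -
  have G: "G \<noteq> 0" using conicD[OF c] by simp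
  define k where "k = M\<^sup>2 * \<rho> / G\<^sup>2"
  have k: "G * G * k = M * M * \<rho>" using G by (simp add: k_def power2_eq_square)
  have "(kp e G f)\<^sup>2 = M\<^sup>2 * \<rho> * k * (e\<^sup>2 * (sin f)\<^sup>2)"
    using G by (simp add: kp_def k_def power2_eq_square)
  moreover have "G\<^sup>2 * ((kw e G f)\<^sup>2 + s) = M\<^sup>2 * \<rho> * k * (1 + e * cos f)\<^sup>2 + s * G\<^sup>2"
  proof -
    have "G\<^sup>2 * ((kw e G f)\<^sup>2 + s) = (G * G * k) * k * (1 + e * cos f)\<^sup>2 + s * G\<^sup>2"
      unfolding kw_def k_def[symmetric] by (simp add: power2_eq_square algebra_simps)
    then show ?thesis unfolding k by (simp add: power2_eq_square)
  qed
  ultimately have sum: "(kp e G f)\<^sup>2 + G\<^sup>2 * ((kw e G f)\<^sup>2 + s) =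
      M\<^sup>2 * \<rho> * k * (e\<^sup>2 + 1 + 2 * e * cos f) + s * G\<^sup>2"
    unfolding sin_squared_eq by (simp add: power2_eq_square algebra_simps)
  have "Kep s \<rho> M (kphi e G f, kp e G f, \<theta>, G) =
    1 / (2 * \<rho>\<^sup>2 * M) * ((kp e G f)\<^sup>2 + G\<^sup>2 * (1 / (S s (kphi e G f))\<^sup>2)) - M / \<rho> * kw e G f"
    by (simp add: kphi_facts(4)[OF c, symmetric])
  also have "\<dots> = 1 / (2 * \<rho>\<^sup>2 * M) * ((kp e G f)\<^sup>2 + G\<^sup>2 * ((kw e G f)\<^sup>2 + s)) - M / \<rho> * kw e G f"
    by (simp only: kphi_facts(5)[OF c])
  also have "\<dots> = M / (2 * \<rho>) * k * (e\<^sup>2 - 1) + s * G\<^sup>2 / (2 * \<rho>\<^sup>2 * M)"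
    using \<rho> M unfolding sum unfolding kw_def k_def[symmetric] by (simp add: field_simps power2_eq_square)
  finally show ?thesis by (simp add: k_def)
qed

text \<open>For \<open>y = L\<^sup>2\<close> the relation is the quadratic equation
  \<open>s * y\<^sup>2 + 2 * b * y - a\<^sup>2 = 0\<close>. For \<open>s = -1\<close> its roots have
  product \<open>a\<^sup>2\<close>, and the assumption on \<open>h\<close> is \<open>b > a\<close>,
  so they are real and the smaller one lies below \<open>a = M\<^sup>2 * \<rho>\<close>.\<close>

lemma energy_L:
  assumes "s = -1 \<Longrightarrow> h < - M / \<rho>"
  shows "\<exists>L>0. (s = -1 \<longrightarrow> L\<^sup>2 < M\<^sup>2 * \<rho>) \<and> h = - (M ^ 3 / (2 * L\<^sup>2)) + s / \<rho>\<^sup>2 * (L\<^sup>2 / (2 * M))"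
proof -
  define a where "a = M\<^sup>2 * \<rho>"
  define b where "b = - M * \<rho>\<^sup>2 * h"
  have a: "a > 0" using M \<rho> by (simp add: a_def)
  have "\<exists>y>0. (s = -1 \<longrightarrow> y < a) \<and> s * y\<^sup>2 + 2 * b * y - a\<^sup>2 = 0"
  proof (cases "s = 1")
    case True
    have "sqrt (b\<^sup>2 + a\<^sup>2) > b" using a by (intro real_less_rsqrt) auto
    then show ?thesis using True
      by (intro exI[of _ "sqrt (b\<^sup>2 + a\<^sup>2) - b"]) (simp add: power2_diff algebra_simps power2_eq_square[of b])
  next
    case False
    then have s': "s = -1" using s by simp
    have "M * \<rho>\<^sup>2 * h < M * \<rho>\<^sup>2 * (- M / \<rho>)" using assms[OF s'] M \<rho> by (intro mult_strict_left_mono) auto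
    moreover have "M * \<rho>\<^sup>2 * (- M / \<rho>) = - a" using \<rho> by (simp add: a_def power2_eq_square)
    ultimately have b: "b > a" by (simp add: b_def)
    have ab: "b\<^sup>2 > a\<^sup>2" using a b by (intro power_strict_mono) auto
    have "sqrt (b\<^sup>2 - a\<^sup>2) < b" using a b by (intro real_less_lsqrt) auto
    moreover have "b - a < sqrt (b\<^sup>2 - a\<^sup>2)"
    proof (rule real_less_rsqrt)
      have "0 < 2 * a * (b - a)" using a b by simp
      then show "(b - a)\<^sup>2 < b\<^sup>2 - a\<^sup>2" by (simp add: power2_eq_square algebra_simps)
    qed
    ultimately show ?thesis using s' ab
      by (intro exI[of _ "b - sqrt (b\<^sup>2 - a\<^sup>2)"]) (simp add: power2_diff algebra_simps power2_eq_square[of b])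
  qed
  then obtain y where y: "y > 0" "s = -1 \<Longrightarrow> y < a" "s * y\<^sup>2 + 2 * b * y - a\<^sup>2 = 0" by blast
  have "h = - (M ^ 3 / (2 * y)) + s / \<rho>\<^sup>2 * (y / (2 * M))"
  proof -
    have "s * y\<^sup>2 = M ^ 4 * \<rho>\<^sup>2 + 2 * M * \<rho>\<^sup>2 * h * y"
      using y(3) by (simp add: a_def b_def algebra_simps power_mult_distrib)
    then show ?thesis using M \<rho> y(1) by (simp add: field_simps eval_nat_numeral)
  qed
  then show ?thesis using y(1,2) a_def by (intro exI[of _ "sqrt y"]) auto
qed

lemma delaunay_conic:
  assumes c: "conic e G"
  shows "\<exists>L. delaunay s \<rho> M (kphi e G f, kp e G f, g + f, G) L
    (2 * pi * (clock e G f / clock e G (2 * pi))) G g"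
proof -
  note cD = conicD[OF c]
  let ?x = "(kphi e G f, kp e G f, g + f, G)"
  let ?T = "clock e G (2 * pi)"
  obtain \<Theta> where \<Theta>: "\<And>u. \<Theta> (clock e G u) = u" "\<And>t. clock e G (\<Theta> t) = t"
    "\<And>t. (\<Theta> has_real_derivative knu e G (\<Theta> t)) (at t)"
    "?T > 0" "\<And>u. clock e G (u + 2 * pi) = clock e G u + ?T" "strict_mono (clock e G)"
    by (rule clock_inverse[OF clock_0 clock_has_derivative[OF c] knu_pos[OF c], of "2 * pi"]) auto
  define K where "K t = (kphi e G (\<Theta> t), kp e G (\<Theta> t), g + \<Theta> t, G)" for t
  have \<Theta>0: "\<Theta> 0 = 0" using \<Theta>(1)[of 0] by simp
  have \<Theta>T: "\<Theta> (t + ?T) = \<Theta> t + 2 * pi" for t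
    using \<Theta>(1)[of "\<Theta> t + 2 * pi"] \<Theta>(2,5) by simp
  have K: "kepler_motion s \<rho> M K"
    unfolding K_def by (rule kepler_motion_conic[OF c \<Theta>(3)])
  have period: "has_period K ?T"
    unfolding has_period_def K_def using \<Theta>(4) by (auto simp: \<Theta>T intro!: exI[of _ 1])
  \<comment> \<open>A period moves the angle by a multiple of \<open>2 * pi\<close>; the multiple is
    positive because \<open>\<Theta>\<close> increases, so at least one full turn is
    completed.\<close>
  have "?T \<le> T'" if T': "has_period K T'" for T'
  proof -
    from T' have "T' > 0" "same_state (K (0 + T')) (K 0)" unfolding has_period_def by blast+
    then obtain k :: int where k: "\<Theta> T' = 2 * pi * k" by (auto simp: K_def \<Theta>0)
    have "\<Theta> T' > 0"
      using \<open>T' > 0\<close> \<Theta>(2)[of T'] \<Theta>(6) by (metis clock_0 strict_mono_less)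
    then have "k \<ge> 1" unfolding k by (simp add: zero_less_mult_iff)
    then have "2 * pi * 1 \<le> \<Theta> T'" unfolding k by (intro mult_left_mono) auto
    then show ?thesis using \<Theta>(2)[of T'] \<Theta>(6) by (metis mult.right_neutral strict_mono_less_eq)
  qed
  then have least: "has_least_period K ?T" using period by (auto simp: has_least_period_def)
  have pos: "M\<^sup>2 * \<rho> / G\<^sup>2 > 0" using M \<rho> cD by simp
  have "phi (K (clock e G pi)) \<noteq> phi (K 0)"
  proof -
    have "kw e G pi < kw e G 0" unfolding kw_def using pos cD by (intro mult_strict_left_mono) auto
    from acot_strict_antimono[OF s kw_gt_1[OF c] this] show ?thesis
      by (simp add: K_def \<Theta> \<Theta>0 kphi_def)
  qed
  then have nc: "\<exists>t. phi (K t) \<noteq> phi (K 0)" by blast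
  have peri: "phi (K 0) \<le> phi (K t)" for t
  proof -
    have "kw e G (\<Theta> t) \<le> kw e G 0"
      unfolding kw_def using pos cD by (intro mult_left_mono add_left_mono) auto
    from acot_antimono[OF s kw_gt_1[OF c] this] show ?thesis by (simp add: K_def \<Theta>0 kphi_def)
  qed
  have "same_state (K (clock e G f)) ?x" by (auto simp: K_def \<Theta>)
  then have ex: "\<exists>K T \<tau>. kepler_motion s \<rho> M K \<and> has_least_period K T \<and> same_state (K \<tau>) ?x \<and>
      (\<exists>t. phi (K t) \<noteq> phi (K 0)) \<and> (\<forall>t. phi (K 0) \<le> phi (K t)) \<and>
      2 * pi * (clock e G f / ?T) = 2 * pi * (\<tau> / T) \<and> g = theta (K 0)"
    using K least nc peri
    by (intro exI[of _ K] exI[of _ ?T] exI[of _ "clock e G f"]) (auto simp: K_def \<Theta>0)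
  define k where "k = M\<^sup>2 * \<rho> / G\<^sup>2"
  have h: "Kep s \<rho> M ?x = M / (2 * \<rho>) * k * (e\<^sup>2 - 1) + s * G\<^sup>2 / (2 * \<rho>\<^sup>2 * M)"
    unfolding k_def by (rule Kep_conic[OF c])
  \<comment> \<open>In terms of \<open>k\<close> this energy bound reads
    \<open>(k * e)\<^sup>2 < (k - 1)\<^sup>2\<close>, which is the condition
    \<open>k * (1 - e) > 1\<close> contained in \<open>conic\<close>.\<close>
  have "Kep s \<rho> M ?x < - M / \<rho>" if s': "s = -1"
  proof -
    have k: "k > 0" "k * (1 - e) > 1" using pos cD by (auto simp: k_def field_simps)
    have Gk: "G\<^sup>2 / (2 * \<rho>\<^sup>2 * M) = M / (2 * \<rho>) * (1 / k)"
      unfolding k_def using cD \<rho> M by (simp add: field_simps power2_eq_square)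
    have "k * e > 0" using k cD by simp
    then have "k > 1" using k(2) by (simp add: algebra_simps)
    have "(k * e)\<^sup>2 < (k - 1)\<^sup>2"
      using k cD by (intro power_strict_mono) (auto simp: algebra_simps)
    then have "k * (e\<^sup>2 - 1) - 1 / k < - 2"
      using k by (simp add: field_simps power2_eq_square)
    then have "M / (2 * \<rho>) * (k * (e\<^sup>2 - 1) - 1 / k) < M / (2 * \<rho>) * (- 2)"
      using M \<rho> by (intro mult_strict_left_mono) auto
    moreover have "M / (2 * \<rho>) * k * (e\<^sup>2 - 1) + s * G\<^sup>2 / (2 * \<rho>\<^sup>2 * M) =
        M / (2 * \<rho>) * (k * (e\<^sup>2 - 1) - 1 / k)"
    proof -
      have "s * G\<^sup>2 / (2 * \<rho>\<^sup>2 * M) = - (M / (2 * \<rho>) * (1 / k))" using Gk s' by simp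
      moreover have "A * k * B + - (A * (1 / k)) = A * (k * B - 1 / k)" for A B
        by (simp add: right_diff_distrib)
      ultimately show ?thesis by presburger
    qed
    ultimately show ?thesis unfolding h by simp
  qed
  from energy_L[OF this] obtain L where "L > 0" "s = -1 \<longrightarrow> L\<^sup>2 < M\<^sup>2 * \<rho>"
    "Kep s \<rho> M ?x = - (M ^ 3 / (2 * L\<^sup>2)) + s / \<rho>\<^sup>2 * (L\<^sup>2 / (2 * M))" by blast
  then show ?thesis using ex unfolding delaunay_def by (intro exI[of _ L]) simp
qed

end

section \<open>The perturbation of the Kepler Hamiltonian\<close>

text \<open>The mean value theorem replaces integration. It loses the factor
  \<open>1 / (k + 1)\<close>, but only the order of vanishing at 0 matters.\<close>

lemma has_derivative_power_bound:
  fixes f f' :: "real \<Rightarrow> real"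
  assumes "f 0 = 0" and d: "\<And>x. 0 \<le> x \<Longrightarrow> x \<le> 1 \<Longrightarrow> (f has_real_derivative f' x) (at x)"
    and b: "\<And>x. 0 \<le> x \<Longrightarrow> x \<le> 1 \<Longrightarrow> \<bar>f' x\<bar> \<le> C * x ^ k" and x: "0 \<le> x" "x \<le> 1" and C: "C \<ge> 0"
  shows "\<bar>f x\<bar> \<le> C * x ^ Suc k"
proof (cases "x = 0")
  case True then show ?thesis using assms(1) by simp
next
  case False
  then obtain z where z: "0 < z" "z < x" "f x - f 0 = (x - 0) * f' z"
    using MVT2[of 0 x f f'] d x by auto
  have "\<bar>f' z\<bar> \<le> C * z ^ k" using b z x by simp
  also have "\<dots> \<le> C * x ^ k" using z C by (intro mult_left_mono power_mono) auto
  finally have "x * \<bar>f' z\<bar> \<le> x * (C * x ^ k)" using x by (intro mult_left_mono)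
  then show ?thesis using z x assms(1) by (simp add: abs_mult mult_ac)
qed

lemma S'_bounds:
  assumes "0 \<le> x" "x \<le> 1"
  shows "1 / 2 \<le> S' s x" "S' s x \<le> 2"
proof -
  have "\<bar>sin (x / 2)\<bar> \<le> 1 / 2" using abs_sin_x_le_abs_x[of "x / 2"] assms by simp
  then have "(sin (x / 2))\<^sup>2 \<le> (1 / 2)\<^sup>2" using power_mono[of "\<bar>sin (x / 2)\<bar>" "1 / 2" 2] by simp
  then have c: "cos x \<ge> 1 / 2" using cos_double_sin[of "x / 2"] by (simp add: power2_eq_square)
  have "exp x \<le> exp (1::real)" using assms by simp
  then have "exp x \<le> 3" using exp_le by linarith
  moreover have "exp (- x) \<le> 1" using assms by simp
  ultimately have "cosh x \<le> 2" by (simp add: cosh_def del: exp_le_one_iff)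
  moreover have "cos x \<le> 2" using cos_le_one[of x] by linarith
  moreover have "1 / 2 \<le> cosh x" using cosh_real_ge_1[of x] by linarith
  ultimately show "1 / 2 \<le> S' s x" "S' s x \<le> 2" using c by (auto simp: S'_def)
qed

lemma S_bounds:
  assumes "0 \<le> x" "x \<le> 1"
  shows "x / 2 \<le> S s x" "S s x \<le> 2 * x"
proof -
  have "x / 2 \<le> S s x \<and> S s x \<le> 2 * x"
  proof (cases "x = 0")
    case False
    then obtain z where z: "0 < z" "z < x" "S s x - S s 0 = (x - 0) * S' s z"
      using MVT2[of 0 x "S s" "S' s"] S_has_derivative assms by auto
    have "x * (1 / 2) \<le> x * S' s z" "x * S' s z \<le> x * 2"
      using S'_bounds[of z s] z assms by (auto intro!: mult_left_mono simp del: times_divide_eq_right mult_le_cancel_left)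
    then show ?thesis using z by simp
  qed simp
  then show "x / 2 \<le> S s x" "S s x \<le> 2 * x" by auto
qed

lemma acot_le:
  assumes "s \<in> {1, -1}" "w \<ge> 2"
  shows "acot s w \<le> 2 / w"
proof (cases "s = 1")
  case True
  obtain z where z: "0 < z" "z < 1 / w" "arctan (1 / w) - arctan 0 = (1 / w - 0) * inverse (1 + z\<^sup>2)"
    using MVT2[of 0 "1 / w" arctan "\<lambda>x. inverse (1 + x\<^sup>2)"] DERIV_arctan assms by auto
  have "inverse (1 + z\<^sup>2) \<le> 1" by (simp add: inverse_le_1_iff)
  then have "1 / w * inverse (1 + z\<^sup>2) \<le> 1 / w * 2" using assms by (intro mult_left_mono) auto
  then show ?thesis using z True by (simp add: acot_def)
next
  case False
  have "(1 + 1 / w) / (1 - 1 / w) = 1 + 2 / (w - 1)" using assms by (simp add: field_simps)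
  then have "artanh (1 / w) = ln (1 + 2 / (w - 1)) / 2" by (simp add: artanh_def)
  also have "\<dots> \<le> 2 / (w - 1) / 2"
    using assms by (intro divide_right_mono ln_add_one_self_le_self) auto
  also have "\<dots> \<le> 2 / w" using assms by (simp add: field_simps)
  finally show ?thesis using False by (simp add: acot_def)
qed

section \<open>Splitting of the reduced Hamiltonian\<close>

locale two_body = kepler +
  fixes m1 m2 :: real
  assumes m1: "m1 > 0" and m2: "m2 > 0" and m12: "m1 + m2 = 1" and M_eq: "M = m1 * m2"
begin

text \<open>
  With \<open>N\<^sup>2 = c - s G\<^sup>2\<close>, \<open>F_red\<close> is the sum of the Kepler Hamiltonian, of \<open>(c - 2 s G\<^sup>2) / (2 \<rho>\<^sup>2)\<close>
  and of \<open>pa \<phi> (N\<^sup>2 cos\<^sup>2 \<theta> - s G\<^sup>2) + pb \<phi> N G cos \<theta>\<close>, where \<open>pa\<close> and \<open>pb\<close> tend to \<open>0\<close>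
  as \<open>\<phi> \<rightarrow> 0\<close>.
\<close>

definition na :: "real \<Rightarrow> real" where
  "na \<phi> = m1 * (S s (m2 * \<phi>))\<^sup>2 + m2 * (S s (m1 * \<phi>))\<^sup>2 - M * (S s \<phi>)\<^sup>2"

definition na' :: "real \<Rightarrow> real" where
  "na' \<phi> = 2 * M * (S s (m2 * \<phi>) * S' s (m2 * \<phi>) + S s (m1 * \<phi>) * S' s (m1 * \<phi>) - S s \<phi> * S' s \<phi>)"

definition nb :: "real \<Rightarrow> real" where
  "nb \<phi> = m2 * S' s (m1 * \<phi>) * S s (m1 * \<phi>) - m1 * S' s (m2 * \<phi>) * S s (m2 * \<phi>)"

definition nb' :: "real \<Rightarrow> real" where
  "nb' \<phi> = 2 * M * s * ((S s (m2 * \<phi>))\<^sup>2 - (S s (m1 * \<phi>))\<^sup>2)"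

definition pa :: "real \<Rightarrow> real" where
  "pa \<phi> = na \<phi> * (1 / (S s \<phi>)\<^sup>2) / (2 * M * \<rho>\<^sup>2)"

definition pa' :: "real \<Rightarrow> real" where
  "pa' \<phi> = (na' \<phi> - 2 * na \<phi> * (S' s \<phi> / S s \<phi>)) * (1 / (S s \<phi>)\<^sup>2) / (2 * M * \<rho>\<^sup>2)"

definition pb :: "real \<Rightarrow> real" where
  "pb \<phi> = nb \<phi> * (1 / (S s \<phi>)\<^sup>2) / (M * \<rho>\<^sup>2)"

definition pb' :: "real \<Rightarrow> real" where
  "pb' \<phi> = (nb' \<phi> - 2 * nb \<phi> * (S' s \<phi> / S s \<phi>)) * (1 / (S s \<phi>)\<^sup>2) / (M * \<rho>\<^sup>2)"

definition NN :: "real \<Rightarrow> real \<Rightarrow> real" where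
  "NN c G = sqrt (c - s * G\<^sup>2)"

definition R :: "real \<Rightarrow> real \<Rightarrow> real \<Rightarrow> real \<Rightarrow> real" where
  "R c \<phi> \<theta> G = (c - 2 * s * G\<^sup>2) / (2 * \<rho>\<^sup>2) + pa \<phi> * ((c - s * G\<^sup>2) * (cos \<theta>)\<^sup>2 - s * G\<^sup>2)
     + NN c G * G * cos \<theta> * pb \<phi>"

text \<open>\<open>Psi\<close>, \<open>Xi\<close> and \<open>La\<close> are what \<open>R\<close>
  adds to the time derivatives of \<open>p\<^sub>\<phi>\<close>, \<open>p\<^sub>\<theta>\<close> and
  \<theta>. \<open>La1\<close> is \<open>La\<close> without the explicit precession rate, so that
  only small terms are left in it.\<close>

definition Psi :: "real \<Rightarrow> real \<Rightarrow> real \<Rightarrow> real \<Rightarrow> real" where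
  "Psi c \<phi> \<theta> G = - (pa' \<phi> * ((c - s * G\<^sup>2) * (cos \<theta>)\<^sup>2 - s * G\<^sup>2) + NN c G * G * cos \<theta> * pb' \<phi>)"

definition Xi :: "real \<Rightarrow> real \<Rightarrow> real \<Rightarrow> real \<Rightarrow> real" where
  "Xi c \<phi> \<theta> G = 2 * pa \<phi> * (c - s * G\<^sup>2) * cos \<theta> * sin \<theta> + NN c G * G * sin \<theta> * pb \<phi>"

definition La1 :: "real \<Rightarrow> real \<Rightarrow> real \<Rightarrow> real \<Rightarrow> real" where
  "La1 c \<phi> \<theta> G = pa \<phi> * (- 2 * s * G * (cos \<theta>)\<^sup>2 - 2 * s * G)
     + (NN c G - s * G\<^sup>2 * (1 / NN c G)) * cos \<theta> * pb \<phi>"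

definition La :: "real \<Rightarrow> real \<Rightarrow> real \<Rightarrow> real \<Rightarrow> real" where
  "La c \<phi> \<theta> G = - 2 * s * G / \<rho>\<^sup>2 + La1 c \<phi> \<theta> G"

lemma na_has_derivative: "(na has_real_derivative na' \<phi>) (at \<phi>)"
proof -
  have "(na has_real_derivative
    m1 * (2 * S s (m2 * \<phi>) * (S' s (m2 * \<phi>) * m2)) + m2 * (2 * S s (m1 * \<phi>) * (S' s (m1 * \<phi>) * m1))
     - M * (2 * S s \<phi> * S' s \<phi>)) (at \<phi>)"
    unfolding na_def [abs_def]
    by (auto intro!: derivative_eq_intros S_has_derivative DERIV_chain2[OF S_has_derivative])
  then show ?thesis by (rule DERIV_cong) (unfold na'_def, simp add: M_eq algebra_simps)
qed

lemma SS'_has_derivative: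
  "((\<lambda>u. S s (m * u) * S' s (m * u)) has_real_derivative m * (1 - 2 * s * (S s (m * \<phi>))\<^sup>2)) (at \<phi>)"
proof -
  have "((\<lambda>u. S s (m * u) * S' s (m * u)) has_real_derivative
     S' s (m * \<phi>) * m * S' s (m * \<phi>) + - s * S s (m * \<phi>) * m * S s (m * \<phi>)) (at \<phi>)"
    by (auto intro!: derivative_eq_intros DERIV_chain2[OF S_has_derivative]
        DERIV_chain2[OF S'_has_derivative[OF s]])
  moreover have "S' s (m * \<phi>) * m * S' s (m * \<phi>) + - s * S s (m * \<phi>) * m * S s (m * \<phi>)
      = m * ((S' s (m * \<phi>))\<^sup>2 - s * (S s (m * \<phi>))\<^sup>2)"
    by (simp add: algebra_simps power2_eq_square)
  then have "S' s (m * \<phi>) * m * S' s (m * \<phi>) + - s * S s (m * \<phi>) * m * S s (m * \<phi>)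
      = m * (1 - 2 * s * (S s (m * \<phi>))\<^sup>2)"
    unfolding S'_square[OF s] by simp
  ultimately show ?thesis by (rule DERIV_cong)
qed

text \<open>The two constant terms \<open>m1 * m2\<close> of the derivative cancel. Hence
  \<open>nb\<close> vanishes to third order at 0 and \<open>pb\<close> to first order.\<close>

lemma nb_has_derivative: "(nb has_real_derivative nb' \<phi>) (at \<phi>)"
proof -
  have eq: "nb = (\<lambda>u. m2 * (S s (m1 * u) * S' s (m1 * u)) - m1 * (S s (m2 * u) * S' s (m2 * u)))"
    by (auto simp: nb_def)
  have "(nb has_real_derivative
    m2 * (m1 * (1 - 2 * s * (S s (m1 * \<phi>))\<^sup>2)) - m1 * (m2 * (1 - 2 * s * (S s (m2 * \<phi>))\<^sup>2))) (at \<phi>)"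
    unfolding eq by (intro DERIV_diff DERIV_cmult SS'_has_derivative)
  then show ?thesis by (rule DERIV_cong) (unfold nb'_def, simp add: M_eq algebra_simps)
qed

text \<open>The constant term is a multiple of \<open>m1 + m2 - 1 = 0\<close>. Hence
  \<open>na\<close> vanishes to fourth order at 0 and \<open>pa\<close> tends to 0 there.\<close>

lemma na'_has_derivative:
  "(na' has_real_derivative
    4 * M * s * ((S s \<phi>)\<^sup>2 - m2 * (S s (m2 * \<phi>))\<^sup>2 - m1 * (S s (m1 * \<phi>))\<^sup>2)) (at \<phi>)"
proof -
  have eq: "na' = (\<lambda>u. 2 * M * (S s (m2 * u) * S' s (m2 * u) + S s (m1 * u) * S' s (m1 * u)
      - S s (1 * u) * S' s (1 * u)))"
    by (auto simp: na'_def)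
  have "(na' has_real_derivative
    2 * M * (m2 * (1 - 2 * s * (S s (m2 * \<phi>))\<^sup>2) + m1 * (1 - 2 * s * (S s (m1 * \<phi>))\<^sup>2)
      - 1 * (1 - 2 * s * (S s (1 * \<phi>))\<^sup>2))) (at \<phi>)"
    unfolding eq by (intro DERIV_diff DERIV_add DERIV_cmult SS'_has_derivative)
  moreover have "m2 * (1 - 2 * s * (S s (m2 * \<phi>))\<^sup>2) + m1 * (1 - 2 * s * (S s (m1 * \<phi>))\<^sup>2)
      - 1 * (1 - 2 * s * (S s (1 * \<phi>))\<^sup>2) = m1 + m2 - 1 + 2 * s * ((S s \<phi>)\<^sup>2 - m2 * (S s (m2 * \<phi>))\<^sup>2
      - m1 * (S s (m1 * \<phi>))\<^sup>2)"
    by (simp add: algebra_simps)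
  ultimately show ?thesis using m12 by (simp add: mult.assoc)
qed

lemma times_inverse_S_square_has_derivative:
  assumes "(n has_real_derivative n') (at \<phi>)" "S s \<phi> \<noteq> 0"
  shows "((\<lambda>u. n u * (1 / (S s u)\<^sup>2) / k) has_real_derivative
    (n' - 2 * n \<phi> * (S' s \<phi> / S s \<phi>)) * (1 / (S s \<phi>)\<^sup>2) / k) (at \<phi>)"
proof -
  have "((\<lambda>u. n u * (1 / (S s u)\<^sup>2) / k) has_real_derivative
    (n' * (1 / (S s \<phi>)\<^sup>2) + - 2 * (S' s \<phi> / S s \<phi>) * (1 / (S s \<phi>)\<^sup>2) * n \<phi>) / k) (at \<phi>)"
    by (intro DERIV_cdivide DERIV_mult assms inverse_S_square_has_derivative)
  then show ?thesis by (rule DERIV_cong) (simp add: algebra_simps)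
qed

lemma pa_has_derivative: "S s \<phi> \<noteq> 0 \<Longrightarrow> (pa has_real_derivative pa' \<phi>) (at \<phi>)"
  and pb_has_derivative: "S s \<phi> \<noteq> 0 \<Longrightarrow> (pb has_real_derivative pb' \<phi>) (at \<phi>)"
  unfolding pa_def [abs_def] pa'_def pb_def [abs_def] pb'_def
  by (intro times_inverse_S_square_has_derivative na_has_derivative nb_has_derivative; assumption)+

text \<open>Since \<open>(S' s x)\<^sup>2 = 1 - s * (S s x)\<^sup>2\<close> and
  \<open>m1 + m2 = 1\<close>, the coefficient of \<open>\<nu>3\<^sup>2\<close> is the centrifugal
  coefficient of Kepler minus \<open>s\<close> times that of \<open>\<nu>2\<^sup>2\<close>. The
  latter has the limit \<open>1 / (2 * \<rho>\<^sup>2)\<close> at collision; this part combines with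
  the \<open>\<nu>1\<^sup>2\<close> term into the explicit term of \<open>R\<close>.\<close>

lemma F_red_eq:
  assumes S: "S s \<phi> \<noteq> 0" and c: "c - s * G\<^sup>2 > 0"
  shows "F_red s \<rho> m1 m2 c (\<phi>, p, \<theta>, G) = Kep s \<rho> M (\<phi>, p, \<theta>, G) + R c \<phi> \<theta> G"
proof -
  let ?N = "NN c G" and ?Y = "1 / (S s \<phi>)\<^sup>2"
  let ?T = "m1 * (S s (m2 * \<phi>))\<^sup>2 + m2 * (S s (m1 * \<phi>))\<^sup>2"
  have M0: "M \<noteq> 0" "\<rho> \<noteq> 0" using M \<rho> by auto
  have N: "?N\<^sup>2 = c - s * G\<^sup>2" using c by (simp add: NN_def)
  have T: "?T / (2 * M * \<rho>\<^sup>2 * (S s \<phi>)\<^sup>2) = pa \<phi> + 1 / (2 * \<rho>\<^sup>2)"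
    using S M0 by (simp add: pa_def na_def field_simps)
  have T': "(m1 * (S' s (m2 * \<phi>))\<^sup>2 + m2 * (S' s (m1 * \<phi>))\<^sup>2) / (2 * M * \<rho>\<^sup>2 * (S s \<phi>)\<^sup>2)
     = ?Y / (2 * M * \<rho>\<^sup>2) - s * (pa \<phi> + 1 / (2 * \<rho>\<^sup>2))"
  proof -
    have "m1 * (S' s (m2 * \<phi>))\<^sup>2 + m2 * (S' s (m1 * \<phi>))\<^sup>2 = (m1 + m2) - s * ?T"
      unfolding S'_square[OF s] by (simp add: algebra_simps)
    then have "(m1 * (S' s (m2 * \<phi>))\<^sup>2 + m2 * (S' s (m1 * \<phi>))\<^sup>2) / (2 * M * \<rho>\<^sup>2 * (S s \<phi>)\<^sup>2)
      = 1 / (2 * M * \<rho>\<^sup>2 * (S s \<phi>)\<^sup>2) - s * (?T / (2 * M * \<rho>\<^sup>2 * (S s \<phi>)\<^sup>2))"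
      using m12 by (simp add: diff_divide_distrib)
    then show ?thesis unfolding T by (simp add: mult_ac)
  qed
  have B: "(m2 * S' s (m1 * \<phi>) * S s (m1 * \<phi>) - m1 * S' s (m2 * \<phi>) * S s (m2 * \<phi>)) / (M * \<rho>\<^sup>2 * (S s \<phi>)\<^sup>2) = pb \<phi>"
    by (simp add: pb_def nb_def mult_ac)
  have "F_red s \<rho> m1 m2 c (\<phi>, p, \<theta>, G) =
      p\<^sup>2 / (2 * M * \<rho>\<^sup>2) - M / \<rho> * (S' s \<phi> / S s \<phi>) + (?N * sin \<theta>)\<^sup>2 / (2 * \<rho>\<^sup>2)
      + (?N * cos \<theta>)\<^sup>2 * (pa \<phi> + 1 / (2 * \<rho>\<^sup>2))
      + G\<^sup>2 * (?Y / (2 * M * \<rho>\<^sup>2) - s * (pa \<phi> + 1 / (2 * \<rho>\<^sup>2))) + ?N * cos \<theta> * G * pb \<phi>"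
    by (simp only: F_red.simps Let_def M_eq[symmetric] T T' B NN_def)
  also have "(?N * sin \<theta>)\<^sup>2 / (2 * \<rho>\<^sup>2) = (c - s * G\<^sup>2) * (1 - (cos \<theta>)\<^sup>2) / (2 * \<rho>\<^sup>2)"
    by (simp add: power_mult_distrib N sin_squared_eq)
  also have "(?N * cos \<theta>)\<^sup>2 = (c - s * G\<^sup>2) * (cos \<theta>)\<^sup>2"
    by (simp add: power_mult_distrib N)
  finally have "F_red s \<rho> m1 m2 c (\<phi>, p, \<theta>, G) =
      p\<^sup>2 / (2 * M * \<rho>\<^sup>2) - M / \<rho> * (S' s \<phi> / S s \<phi>) + (c - s * G\<^sup>2) * (1 - (cos \<theta>)\<^sup>2) / (2 * \<rho>\<^sup>2)
      + (c - s * G\<^sup>2) * (cos \<theta>)\<^sup>2 * (pa \<phi> + 1 / (2 * \<rho>\<^sup>2))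
      + G\<^sup>2 * (?Y / (2 * M * \<rho>\<^sup>2) - s * (pa \<phi> + 1 / (2 * \<rho>\<^sup>2))) + ?N * cos \<theta> * G * pb \<phi>" .
  also have "\<dots> = (p\<^sup>2 / (2 * M * \<rho>\<^sup>2) + G\<^sup>2 * (?Y / (2 * M * \<rho>\<^sup>2))) - M / \<rho> * (S' s \<phi> / S s \<phi>)
      + R c \<phi> \<theta> G"
  proof -
    have "A - B + C * (1 - u) / (2 * \<rho>\<^sup>2) + C * u * (a + 1 / (2 * \<rho>\<^sup>2)) + g * (y - s * (a + 1 / (2 * \<rho>\<^sup>2))) + n
      = (A + g * y) - B + ((C - s * g) / (2 * \<rho>\<^sup>2) + a * (C * u - s * g) + n)" for A B C u a g y n
      by (simp add: algebra_simps add_divide_distrib diff_divide_distrib)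
    moreover have "R c \<phi> \<theta> G = (c - s * G\<^sup>2 - s * G\<^sup>2) / (2 * \<rho>\<^sup>2)
        + pa \<phi> * ((c - s * G\<^sup>2) * (cos \<theta>)\<^sup>2 - s * G\<^sup>2) + ?N * cos \<theta> * G * pb \<phi>"
      by (simp add: R_def mult_ac)
    ultimately show ?thesis by metis
  qed
  also have "p\<^sup>2 / (2 * M * \<rho>\<^sup>2) + G\<^sup>2 * (?Y / (2 * M * \<rho>\<^sup>2)) = 1 / (2 * \<rho>\<^sup>2 * M) * (p\<^sup>2 + G\<^sup>2 * ?Y)"
    by (simp add: add_divide_distrib mult_ac)
  also have "1 / (2 * \<rho>\<^sup>2 * M) * (p\<^sup>2 + G\<^sup>2 * ?Y) - M / \<rho> * (S' s \<phi> / S s \<phi>) = Kep s \<rho> M (\<phi>, p, \<theta>, G)"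
    by simp
  finally show ?thesis .
qed

lemma NN_has_derivative:
  assumes "c - s * G\<^sup>2 > 0"
  shows "(NN c has_real_derivative - s * G * (1 / NN c G)) (at G)"
  unfolding NN_def [abs_def] using assms
  by (auto intro!: derivative_eq_intros simp: field_simps)

lemma R_has_derivatives:
  assumes S: "S s \<phi> \<noteq> 0" and c: "c - s * G\<^sup>2 > 0"
  shows "((\<lambda>u. R c u \<theta> G) has_real_derivative - Psi c \<phi> \<theta> G) (at \<phi>)"
    and "((\<lambda>u. R c \<phi> u G) has_real_derivative - Xi c \<phi> \<theta> G) (at \<theta>)"
    and "((\<lambda>u. R c \<phi> \<theta> u) has_real_derivative La c \<phi> \<theta> G) (at G)"
proof -
  show "((\<lambda>u. R c u \<theta> G) has_real_derivative - Psi c \<phi> \<theta> G) (at \<phi>)"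
    unfolding R_def Psi_def
    by (rule derivative_eq_intros pa_has_derivative[OF S] pb_has_derivative[OF S] refl)+ simp
  show "((\<lambda>u. R c \<phi> u G) has_real_derivative - Xi c \<phi> \<theta> G) (at \<theta>)"
    unfolding R_def Xi_def
    by (auto intro!: derivative_eq_intros simp: algebra_simps power2_eq_square)
  have N: "NN c G \<noteq> 0" using c by (simp add: NN_def)
  have "((\<lambda>u. NN c u * u * cos \<theta> * pb \<phi>) has_real_derivative
      (- s * G * (1 / NN c G) * G + 1 * NN c G) * cos \<theta> * pb \<phi>) (at G)"
    by (intro DERIV_cmult_right DERIV_mult NN_has_derivative[OF c] DERIV_ident)
  note 1 = this
  have "((\<lambda>u. (c - 2 * s * u\<^sup>2) / (2 * \<rho>\<^sup>2) + pa \<phi> * ((c - s * u\<^sup>2) * (cos \<theta>)\<^sup>2 - s * u\<^sup>2))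
      has_real_derivative - 2 * s * G / \<rho>\<^sup>2 + pa \<phi> * (- 2 * s * G * (cos \<theta>)\<^sup>2 - 2 * s * G)) (at G)"
    using \<rho> by (auto intro!: derivative_eq_intros simp: field_simps)
  from DERIV_add[OF this 1] have "((\<lambda>u. R c \<phi> \<theta> u) has_real_derivative
      - 2 * s * G / \<rho>\<^sup>2 + pa \<phi> * (- 2 * s * G * (cos \<theta>)\<^sup>2 - 2 * s * G)
      + (- s * G * (1 / NN c G) * G + 1 * NN c G) * cos \<theta> * pb \<phi>) (at G)"
    unfolding R_def .
  then show "((\<lambda>u. R c \<phi> \<theta> u) has_real_derivative La c \<phi> \<theta> G) (at G)"
    by (rule DERIV_cong) (simp add: La_def La1_def algebra_simps power2_eq_square)
qed

lemma reduced_field: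
  assumes S: "S s \<phi> \<noteq> 0" and c: "c - s * G\<^sup>2 > 0"
  shows "hamiltonian_field (F_red s \<rho> m1 m2 c) (\<phi>, p, \<theta>, G) =
    (p / (M * \<rho>\<^sup>2),
     1 / (S s \<phi>)\<^sup>2 * (G\<^sup>2 * (S' s \<phi> / S s \<phi>) / (M * \<rho>\<^sup>2) - M / \<rho>) + Psi c \<phi> \<theta> G,
     G / (M * \<rho>\<^sup>2) * (1 / (S s \<phi>)\<^sup>2) + La c \<phi> \<theta> G,
     Xi c \<phi> \<theta> G)"
proof -
  note K = Kep_has_derivatives[OF S] and R = R_has_derivatives[OF S c]
  have 1: "((\<lambda>u. F_red s \<rho> m1 m2 c (\<phi>, u, \<theta>, G)) has_real_derivative p / (M * \<rho>\<^sup>2) + 0) (at p)"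
    unfolding F_red_eq[OF S c] by (intro DERIV_add K DERIV_const)
  \<comment> \<open>The splitting holds only where \<open>S\<close> does not vanish, and a
    derivative in \<phi> needs it on a neighbourhood; likewise below for
    \<open>c - s * u\<^sup>2 > 0\<close> and the derivative in \<open>G\<close>.\<close>
  have "open (S s -` (- {0}))"
    using S_has_derivative by (intro open_vimage) (auto intro!: continuous_at_imp_continuous_on DERIV_isCont)
  then have 2: "((\<lambda>u. F_red s \<rho> m1 m2 c (u, p, \<theta>, G)) has_real_derivative
      - (1 / (S s \<phi>)\<^sup>2 * (G\<^sup>2 * (S' s \<phi> / S s \<phi>) / (M * \<rho>\<^sup>2) - M / \<rho>)) + - Psi c \<phi> \<theta> G) (at \<phi>)"
    by (rule has_field_derivative_transform_within_open[OF DERIV_add[OF K(2) R(1)]])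
       (use S c F_red_eq in auto)
  have 3: "((\<lambda>u. F_red s \<rho> m1 m2 c (\<phi>, p, u, G)) has_real_derivative 0 + - Xi c \<phi> \<theta> G) (at \<theta>)"
    unfolding F_red_eq[OF S c] Kep.simps by (intro DERIV_add R DERIV_const)
  have "open ((\<lambda>u. c - s * u\<^sup>2) -` {0<..})"
    by (intro open_vimage continuous_intros)
  then have 4: "((\<lambda>u. F_red s \<rho> m1 m2 c (\<phi>, p, \<theta>, u)) has_real_derivative
      G / (M * \<rho>\<^sup>2) * (1 / (S s \<phi>)\<^sup>2) + La c \<phi> \<theta> G) (at G)"
    by (rule has_field_derivative_transform_within_open[OF DERIV_add[OF K(3) R(3)]])
       (use S c F_red_eq in auto)
  show ?thesis
    using 1[THEN DERIV_imp_deriv] 2[THEN DERIV_imp_deriv] 3[THEN DERIV_imp_deriv] 4[THEN DERIV_imp_deriv]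
    by (simp del: F_red.simps)
qed

text \<open>Starting from derivatives of order \<open>x\<^sup>2\<close>, one integration bounds
  \<open>nb\<close> by order 3 and two bound \<open>na\<close> by order 4. The factor
  \<open>1 / (S s x)\<^sup>2\<close> costs \<open>4 / x\<^sup>2\<close>, and differentiating it
  costs another \<open>4 / x\<close>. The largest constant that results is 288; 576 serves for all
  four.\<close>

lemma pa_pb_bounds:
  assumes x: "0 < x" "x \<le> 1"
  shows "\<bar>pa x\<bar> \<le> 576 / \<rho>\<^sup>2 * x" "\<bar>pb x\<bar> \<le> 576 / \<rho>\<^sup>2 * x" "\<bar>pa' x\<bar> \<le> 576 / \<rho>\<^sup>2" "\<bar>pb' x\<bar> \<le> 576 / \<rho>\<^sup>2"
proof -
  have m: "m1 \<le> 1" "m2 \<le> 1" using m1 m2 m12 by auto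
  have sq: "(S s (m * x))\<^sup>2 \<le> 4 * x\<^sup>2" if "0 < m" "m \<le> 1" "0 \<le> x" "x \<le> 1" for m x
  proof -
    have mx: "0 \<le> m * x" "m * x \<le> x" using that by (auto simp: mult_left_le_one_le)
    then have "0 \<le> S s (m * x)" "S s (m * x) \<le> 2 * x" using S_bounds[of "m * x" s] that by auto
    then have "(S s (m * x))\<^sup>2 \<le> (2 * x)\<^sup>2" by (intro power_mono) auto
    then show ?thesis by simp
  qed
  have nb': "\<bar>nb' x\<bar> \<le> 8 * M * x ^ 2" if "0 \<le> x" "x \<le> 1" for x
  proof -
    have "\<bar>(S s (m2 * x))\<^sup>2 - (S s (m1 * x))\<^sup>2\<bar> \<le> 4 * x\<^sup>2"
      using sq[of m1 x] sq[of m2 x] that m m1 m2 by (simp add: abs_le_iff) (smt (verit) zero_le_power2)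
    then have "2 * M * \<bar>(S s (m2 * x))\<^sup>2 - (S s (m1 * x))\<^sup>2\<bar> \<le> 2 * M * (4 * x\<^sup>2)"
      using M by (intro mult_left_mono) auto
    then show ?thesis unfolding nb'_def abs_mult using M s by auto
  qed
  have nb: "\<bar>nb x\<bar> \<le> 8 * M * x ^ Suc 2"
    by (rule has_derivative_power_bound[OF _ nb_has_derivative nb']) (use x M in \<open>auto simp: nb_def\<close>)
  have na'': "\<bar>4 * M * s * ((S s x)\<^sup>2 - m2 * (S s (m2 * x))\<^sup>2 - m1 * (S s (m1 * x))\<^sup>2)\<bar> \<le> 16 * M * x ^ 2"
    if "0 \<le> x" "x \<le> 1" for x
  proof -
    have "0 \<le> m2 * (S s (m2 * x))\<^sup>2" "0 \<le> m1 * (S s (m1 * x))\<^sup>2" using m1 m2 by auto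
    moreover have "m2 * (S s (m2 * x))\<^sup>2 \<le> m2 * (4 * x\<^sup>2)" "m1 * (S s (m1 * x))\<^sup>2 \<le> m1 * (4 * x\<^sup>2)"
      using sq[of m1 x] sq[of m2 x] that m m1 m2 by (auto intro!: mult_left_mono)
    moreover have "m1 * (4 * x\<^sup>2) + m2 * (4 * x\<^sup>2) = 4 * x\<^sup>2"
      using m12 by (simp flip: distrib_right)
    moreover have "(S s x)\<^sup>2 \<le> 4 * x\<^sup>2" using sq[of 1 x] that by simp
    ultimately have "\<bar>(S s x)\<^sup>2 - m2 * (S s (m2 * x))\<^sup>2 - m1 * (S s (m1 * x))\<^sup>2\<bar> \<le> 4 * x\<^sup>2"
      using zero_le_power2[of "S s x"] by (intro abs_leI) linarith+
    then have "4 * M * \<bar>(S s x)\<^sup>2 - m2 * (S s (m2 * x))\<^sup>2 - m1 * (S s (m1 * x))\<^sup>2\<bar> \<le> 4 * M * (4 * x\<^sup>2)"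
      using M by (intro mult_left_mono) auto
    then show ?thesis unfolding abs_mult using M s by auto
  qed
  have na': "\<bar>na' x\<bar> \<le> 16 * M * x ^ Suc 2" if "0 \<le> x" "x \<le> 1" for x
    by (rule has_derivative_power_bound[OF _ na'_has_derivative na'']) (use that M in \<open>auto simp: na'_def\<close>)
  have na: "\<bar>na x\<bar> \<le> 16 * M * x ^ Suc (Suc 2)"
    by (rule has_derivative_power_bound[OF _ na_has_derivative na']) (use x M in \<open>auto simp: na_def\<close>)
  have S: "x / 2 \<le> S s x" using S_bounds[of x s] x by simp
  then have "S s x > 0" using x by linarith
  have Y: "1 / (S s x)\<^sup>2 \<le> 4 / x\<^sup>2" "0 < 1 / (S s x)\<^sup>2"
  proof -
    have "(x / 2)\<^sup>2 \<le> (S s x)\<^sup>2" using S x by (intro power_mono) auto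
    then show "1 / (S s x)\<^sup>2 \<le> 4 / x\<^sup>2" using x \<open>S s x > 0\<close> by (simp add: field_simps)
    show "0 < 1 / (S s x)\<^sup>2" using \<open>S s x > 0\<close> by simp
  qed
  have w: "\<bar>S' s x / S s x\<bar> \<le> 4 / x"
  proof -
    have S': "0 \<le> S' s x" "S' s x \<le> 2" using S'_bounds[of x s] x by auto
    have "S' s x / S s x \<le> 2 / (x / 2)" using S S' x by (intro frac_le) auto
    then show ?thesis using S' \<open>S s x > 0\<close> by simp
  qed
  define Y where "Y = 1 / (S s x)\<^sup>2"
  define W where "W = S' s x / S s x"
  have nY: "\<bar>n * Y\<bar> \<le> k * (4 / x\<^sup>2)" if "\<bar>n\<bar> \<le> k" for n k
  proof -
    have "\<bar>n\<bar> * Y \<le> k * (4 / x\<^sup>2)" using that Y by (intro mult_mono) (auto simp: Y_def)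
    then show ?thesis using Y by (simp add: abs_mult Y_def)
  qed
  have nw: "\<bar>n' - 2 * n * W\<bar> \<le> k' + 2 * k * (4 / x)" if "\<bar>n'\<bar> \<le> k'" "\<bar>n\<bar> \<le> k" for n n' k k'
  proof -
    have "\<bar>2 * n\<bar> * \<bar>W\<bar> \<le> 2 * k * (4 / x)"
      unfolding W_def by (intro mult_mono w) (use that in auto)
    then show ?thesis using that abs_triangle_ineq4[of n' "2 * n * W"] unfolding abs_mult by linarith
  qed
  have div: "\<bar>z / k\<bar> \<le> b / k" if "\<bar>z\<bar> \<le> b" "k > 0" for z b k :: real
    using that by (simp add: divide_right_mono)
  have MR: "2 * M * \<rho>\<^sup>2 > 0" "M * \<rho>\<^sup>2 > 0" using M \<rho> by auto
  have x0: "0 \<le> x" using x by simp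
  have "\<bar>pa x\<bar> \<le> 16 * M * x ^ Suc (Suc 2) * (4 / x\<^sup>2) / (2 * M * \<rho>\<^sup>2)"
    unfolding pa_def Y_def[symmetric] W_def[symmetric] by (rule div[OF nY[OF na] MR(1)])
  also have "\<dots> = 32 / \<rho>\<^sup>2 * x * x" using x \<rho> M by (simp add: eval_nat_numeral)
  also have "\<dots> \<le> 576 / \<rho>\<^sup>2 * x * 1" using x \<rho> by (intro mult_mono) (auto simp: divide_right_mono)
  finally show "\<bar>pa x\<bar> \<le> 576 / \<rho>\<^sup>2 * x" by simp
  have "\<bar>pb x\<bar> \<le> 8 * M * x ^ Suc 2 * (4 / x\<^sup>2) / (M * \<rho>\<^sup>2)"
    unfolding pb_def Y_def[symmetric] W_def[symmetric] by (rule div[OF nY[OF nb] MR(2)])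
  also have "\<dots> = 32 / \<rho>\<^sup>2 * x" using x \<rho> M by (simp add: eval_nat_numeral)
  also have "\<dots> \<le> 576 / \<rho>\<^sup>2 * x" using x \<rho> by (intro mult_right_mono divide_right_mono) auto
  finally show "\<bar>pb x\<bar> \<le> 576 / \<rho>\<^sup>2 * x" .
  have "\<bar>pa' x\<bar> \<le> (16 * M * x ^ Suc 2 + 2 * (16 * M * x ^ Suc (Suc 2)) * (4 / x)) * (4 / x\<^sup>2) / (2 * M * \<rho>\<^sup>2)"
    unfolding pa'_def Y_def[symmetric] W_def[symmetric] by (rule div[OF nY[OF nw[OF na'[OF x0 x(2)] na]] MR(1)])
  also have "\<dots> = 288 / \<rho>\<^sup>2 * x" using x \<rho> M by (simp add: eval_nat_numeral)
  also have "\<dots> \<le> 576 / \<rho>\<^sup>2 * 1" using x \<rho> by (intro mult_mono divide_right_mono) auto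
  finally show "\<bar>pa' x\<bar> \<le> 576 / \<rho>\<^sup>2" by simp
  have "\<bar>pb' x\<bar> \<le> (8 * M * x ^ 2 + 2 * (8 * M * x ^ Suc 2) * (4 / x)) * (4 / x\<^sup>2) / (M * \<rho>\<^sup>2)"
    unfolding pb'_def Y_def[symmetric] W_def[symmetric] by (rule div[OF nY[OF nw[OF nb'[OF x0 x(2)] nb]] MR(2)])
  also have "\<dots> = 288 / \<rho>\<^sup>2" using x \<rho> M by (simp add: eval_nat_numeral)
  also have "\<dots> \<le> 576 / \<rho>\<^sup>2" using \<rho> by (intro divide_right_mono) auto
  finally show "\<bar>pb' x\<bar> \<le> 576 / \<rho>\<^sup>2" .
qed

end

section \<open>Motion of the osculating elements\<close>

lemma abs_mult_le:
  fixes a b :: real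
  assumes "\<bar>a\<bar> \<le> A" "\<bar>b\<bar> \<le> B"
  shows "\<bar>a * b\<bar> \<le> A * B"
  unfolding abs_mult using assms by (intro mult_mono) auto

lemma abs_add_le:
  fixes a b :: real
  assumes "\<bar>a\<bar> \<le> A" "\<bar>b\<bar> \<le> B"
  shows "\<bar>a + b\<bar> \<le> A + B" "\<bar>a - b\<bar> \<le> A + B"
  using assms by auto

context two_body
begin

text \<open>
  \<open>(xi, eta)\<close> is the part of the time derivative of \<open>e (cos f, sin f)\<close> that is due to the
  perturbation, so that \<open>e' = xi cos f + eta sin f\<close> and \<open>f' = knu + qq\<close>. The elements
  \<open>(g, e, G)\<close> are studied as functions of \<open>f\<close>; \<open>Vg\<close>, \<open>Ve\<close> and \<open>VG\<close> are their derivatives.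
\<close>

definition xi :: "real \<Rightarrow> real \<Rightarrow> real \<Rightarrow> real \<Rightarrow> real \<Rightarrow> real" where
  "xi c g e G f = 2 * (1 + e * cos f) * Xi c (kphi e G f) (g + f) G * (1 / G)"

definition eta :: "real \<Rightarrow> real \<Rightarrow> real \<Rightarrow> real \<Rightarrow> real \<Rightarrow> real" where
  "eta c g e G f = G * Psi c (kphi e G f) (g + f) G * (1 / (M\<^sup>2 * \<rho>))
     + e * sin f * Xi c (kphi e G f) (g + f) G * (1 / G)"

definition qq :: "real \<Rightarrow> real \<Rightarrow> real \<Rightarrow> real \<Rightarrow> real \<Rightarrow> real" where
  "qq c g e G f = (eta c g e G f * cos f - xi c g e G f * sin f) * (1 / e)"

definition fdot :: "real \<Rightarrow> real \<Rightarrow> real \<Rightarrow> real \<Rightarrow> real \<Rightarrow> real" where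
  "fdot c g e G f = knu e G f + qq c g e G f"

definition Vg :: "real \<Rightarrow> real \<Rightarrow> real \<Rightarrow> real \<Rightarrow> real \<Rightarrow> real" where
  "Vg c g e G f = (La c (kphi e G f) (g + f) G - qq c g e G f) * (1 / fdot c g e G f)"

definition Ve :: "real \<Rightarrow> real \<Rightarrow> real \<Rightarrow> real \<Rightarrow> real \<Rightarrow> real" where
  "Ve c g e G f = (xi c g e G f * cos f + eta c g e G f * sin f) * (1 / fdot c g e G f)"

definition VG :: "real \<Rightarrow> real \<Rightarrow> real \<Rightarrow> real \<Rightarrow> real \<Rightarrow> real" where
  "VG c g e G f = Xi c (kphi e G f) (g + f) G * (1 / fdot c g e G f)"

section \<open>Sizes of the perturbation terms\<close>

text \<open>The region of uniform estimates: \<open>e\<close> is away from 0, where the direction of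
  the pericenter is undefined, and from 1, and \<open>G\<close> is comparable with \<delta>. The
  small factor \<gamma> leaves room to vary \<open>G\<close>.\<close>

definition box :: "real \<Rightarrow> real \<Rightarrow> real \<Rightarrow> real \<Rightarrow> bool" where
  "box \<gamma> \<delta> e G \<longleftrightarrow> 1 / 4 \<le> e \<and> e \<le> 3 / 4 \<and> \<gamma> * \<delta> \<le> G \<and> G \<le> 2 * \<delta>"

text \<open>
  Collects the bounds of all perturbation terms: \<open>576 / \<rho>\<^sup>2\<close> comes from \<open>pa_pb_bounds\<close>,
  \<open>32 / (M\<^sup>2 \<rho>)\<close> from \<open>\<phi> \<le> 32 / (M\<^sup>2 \<rho>) \<delta>\<^sup>2\<close>, and \<open>1 / \<gamma>\<close> from \<open>G \<ge> \<gamma> \<delta>\<close>.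
\<close>

definition K1 :: "real \<Rightarrow> real" where
  "K1 \<gamma> = 24 * (576 / \<rho>\<^sup>2) * (32 / (M\<^sup>2 * \<rho>)) + 4 * (38 * (576 / \<rho>\<^sup>2) / (M\<^sup>2 * \<rho>)
     + 5 * (24 * (576 / \<rho>\<^sup>2) * (32 / (M\<^sup>2 * \<rho>)) / \<gamma>))"

text \<open>Since \<open>e \<le> 3 / 4\<close>, the factor \<open>1 + e * cos f\<close> lies between
  1/4 and 7/4. The smallness of \<delta> makes \<open>kw\<close> at least 2 even at apocenter, so
  \<open>s\<close> is absorbed by a quarter of its square.\<close>

lemma kepler_box:
  assumes b: "box \<gamma> \<delta> e G" and \<gamma>: "\<gamma> > 0" and \<delta>: "\<delta> > 0" and small: "32 * \<delta>\<^sup>2 \<le> M\<^sup>2 * \<rho>"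
  shows "G > 0" "conic e G" "2 \<le> kw e G f" "0 < kphi e G f" "kphi e G f \<le> 32 / (M\<^sup>2 * \<rho>) * \<delta>\<^sup>2"
    "kphi e G f \<le> 1" "(kw e G f)\<^sup>2 + s \<le> 7 * (M\<^sup>2 * \<rho>)\<^sup>2 / G ^ 4"
    "(M\<^sup>2 * \<rho>)\<^sup>2 / (32 * G ^ 4) \<le> (kw e G f)\<^sup>2 + s"
proof -
  let ?P = "M\<^sup>2 * \<rho>"
  have P: "?P > 0" using M \<rho> by simp
  show G: "G > 0" using b mult_pos_pos[OF \<gamma> \<delta>] by (simp add: box_def)
  have e: "1 / 4 \<le> e" "e \<le> 3 / 4" using b by (auto simp: box_def)
  have "G\<^sup>2 \<le> (2 * \<delta>)\<^sup>2" using b G by (intro power_mono) (auto simp: box_def)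
  then have G2: "G\<^sup>2 \<le> 4 * \<delta>\<^sup>2" by simp
  have "?P * (1 / 4) \<le> ?P * (1 - e)" using e P by (intro mult_left_mono) auto
  moreover have "\<delta>\<^sup>2 > 0" using \<delta> by simp
  ultimately have "G\<^sup>2 < ?P * (1 - e)" using G2 small by linarith
  then show c: "conic e G" using e G unfolding conic_def by auto
  have ecos: "1 / 4 \<le> 1 + e * cos f" "1 + e * cos f \<le> 7 / 4"
    using abs_mult_le[of e "3/4" "cos f" 1] e by (auto simp: abs_le_iff)
  have PG: "0 \<le> ?P / G\<^sup>2" using P by simp
  have kw1: "?P / G\<^sup>2 * (1 / 4) \<le> kw e G f" and kw2: "kw e G f \<le> ?P / G\<^sup>2 * (7 / 4)"
    unfolding kw_def by (rule mult_left_mono[OF ecos(1) PG], rule mult_left_mono[OF ecos(2) PG])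
  have PG2: "?P / (4 * \<delta>\<^sup>2) \<le> ?P / G\<^sup>2" using P G G2 \<delta> by (intro divide_left_mono) auto
  have kwd: "?P / (16 * \<delta>\<^sup>2) \<le> kw e G f"
  proof -
    have "?P / (4 * \<delta>\<^sup>2) * (1 / 4) \<le> ?P / G\<^sup>2 * (1 / 4)" using PG2 by (rule mult_right_mono) simp
    also note kw1
    finally show ?thesis by simp
  qed
  moreover have "2 \<le> ?P / (16 * \<delta>\<^sup>2)" using small \<delta> by (simp add: field_simps)
  ultimately show kw: "2 \<le> kw e G f" by linarith
  show "0 < kphi e G f" by (rule kphi_facts[OF c])
  have "kphi e G f \<le> 2 / kw e G f" unfolding kphi_def by (rule acot_le[OF s kw])
  also have "\<dots> \<le> 2 / (?P / (16 * \<delta>\<^sup>2))" using kwd kw P \<delta> by (intro divide_left_mono mult_pos_pos) auto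
  also have "\<dots> = 32 / ?P * \<delta>\<^sup>2" by simp
  finally show "kphi e G f \<le> 32 / ?P * \<delta>\<^sup>2" .
  also have "\<dots> \<le> 1" using small P by (simp add: field_simps)
  finally show "kphi e G f \<le> 1" .
  have sq: "4 \<le> (kw e G f)\<^sup>2" using power_mono[OF kw, of 2] by simp
  have "(kw e G f)\<^sup>2 \<le> (?P / G\<^sup>2 * (7 / 4))\<^sup>2" using kw kw2 by (intro power_mono) auto
  then have up: "(kw e G f)\<^sup>2 \<le> 49 / 16 * (?P\<^sup>2 / G ^ 4)"
    by (simp add: power_mult_distrib power_divide flip: power_mult)
  have "(?P / G\<^sup>2 * (1 / 4))\<^sup>2 \<le> (kw e G f)\<^sup>2" using kw1 P by (intro power_mono) auto
  then have lo: "1 / 16 * (?P\<^sup>2 / G ^ 4) \<le> (kw e G f)\<^sup>2"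
    by (simp add: power_mult_distrib power_divide flip: power_mult)
  have s1: "-1 \<le> s" "s \<le> 1" using s by auto
  show "(kw e G f)\<^sup>2 + s \<le> 7 * ?P\<^sup>2 / G ^ 4" using up sq s1 by simp
  show "?P\<^sup>2 / (32 * G ^ 4) \<le> (kw e G f)\<^sup>2 + s" using lo sq s1 by simp
qed

text \<open>Counting powers: \<open>G\<close> and \<open>NN c G\<close> have order 1 in \<delta>,
  and \<phi>, hence \<open>pa\<close> and \<open>pb\<close>, order 2. So \<open>Xi\<close> has order
  4 and loses one through the factor \<open>1 / G\<close>; \<open>Psi\<close> has only order 2, as
  \<open>pb'\<close> does not tend to 0, but enters with a factor \<open>G\<close>.\<close>

lemma perturbation_bounds:
  assumes b: "box \<gamma> \<delta> e G" and \<gamma>: "\<gamma> > 0" and \<delta>: "\<delta> > 0" and small: "32 * \<delta>\<^sup>2 \<le> M\<^sup>2 * \<rho>"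
  defines "c \<equiv> 5 * \<delta>\<^sup>2"
  shows "\<delta>\<^sup>2 \<le> c - s * G\<^sup>2" "\<bar>Xi c (kphi e G f) (g + f) G\<bar> \<le> K1 \<gamma> * \<delta> ^ 4"
    "\<bar>La1 c (kphi e G f) (g + f) G\<bar> \<le> K1 \<gamma> * \<delta> ^ 3"
    "\<bar>xi c g e G f\<bar> \<le> K1 \<gamma> * \<delta> ^ 3" "\<bar>eta c g e G f\<bar> \<le> K1 \<gamma> * \<delta> ^ 3" "\<bar>qq c g e G f\<bar> \<le> K1 \<gamma> * \<delta> ^ 3"
proof -
  note kb = kepler_box[OF b \<gamma> \<delta> small]
  let ?P = "M\<^sup>2 * \<rho>" and ?K = "576 / \<rho>\<^sup>2" and ?\<phi> = "kphi e G f" and ?\<theta> = "g + f"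
  define Kx where "Kx = 24 * ?K * (32 / ?P)"
  have P: "?P > 0" using M \<rho> by simp
  have K: "?K > 0" using \<rho> by simp
  have Kx: "Kx > 0" using K P by (simp add: Kx_def)
  have e: "1 / 4 \<le> e" "e \<le> 3 / 4" and G: "G > 0" "\<gamma> * \<delta> \<le> G" "G \<le> 2 * \<delta>" using b kb by (auto simp: box_def)
  have "G\<^sup>2 \<le> (2 * \<delta>)\<^sup>2" using G by (intro power_mono) auto
  then have G2: "G\<^sup>2 \<le> 4 * \<delta>\<^sup>2" by simp
  have sG: "\<bar>s * G\<^sup>2\<bar> \<le> 4 * \<delta>\<^sup>2" using s G2 by auto
  show c1: "\<delta>\<^sup>2 \<le> c - s * G\<^sup>2" using sG by (simp add: c_def abs_le_iff)
  have c2: "\<bar>c - s * G\<^sup>2\<bar> \<le> 9 * \<delta>\<^sup>2" using sG c1 by (simp add: c_def abs_le_iff)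
  define N where "N = NN c G"
  have "sqrt (\<delta>\<^sup>2) \<le> N" unfolding N_def NN_def using c1 by (rule real_sqrt_le_mono)
  then have N1: "\<delta> \<le> N" using \<delta> by simp
  have N2: "N \<le> 3 * \<delta>" unfolding N_def NN_def using c2 \<delta> by (intro real_le_lsqrt) auto
  have N: "\<bar>N\<bar> \<le> 3 * \<delta>" "\<bar>1 / N\<bar> \<le> 1 / \<delta>" using N1 N2 \<delta> by (auto simp: divide_left_mono)
  have G': "\<bar>G\<bar> \<le> 2 * \<delta>" "\<bar>1 / G\<bar> \<le> 1 / (\<gamma> * \<delta>)" using G \<gamma> \<delta> by (auto simp: divide_left_mono)
  have trig: "\<bar>cos x\<bar> \<le> 1" "\<bar>sin x\<bar> \<le> 1" "\<bar>(cos x)\<^sup>2\<bar> \<le> 1" for x :: real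
    by (auto simp: abs_square_le_1)
  have two: "\<bar>2 :: real\<bar> \<le> 2" "\<bar>s\<bar> \<le> 1" "\<bar>- 2 * s\<bar> \<le> 2" "\<bar>2 * s\<bar> \<le> 2" using s by auto
  note pab = pa_pb_bounds[OF kb(4)[of f] kb(6)[of f]]
  have \<phi>: "?K * ?\<phi> \<le> ?K * (32 / ?P * \<delta>\<^sup>2)" using kb(5) K by (intro mult_left_mono) auto
  have pa: "\<bar>pa ?\<phi>\<bar> \<le> ?K * (32 / ?P * \<delta>\<^sup>2)" and pb: "\<bar>pb ?\<phi>\<bar> \<le> ?K * (32 / ?P * \<delta>\<^sup>2)"
    by (rule order_trans[OF pab(1) \<phi>], rule order_trans[OF pab(2) \<phi>])
  have "\<bar>Xi c ?\<phi> ?\<theta> G\<bar> \<le> 2 * (?K * (32 / ?P * \<delta>\<^sup>2)) * (9 * \<delta>\<^sup>2) * 1 * 1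
      + 3 * \<delta> * (2 * \<delta>) * 1 * (?K * (32 / ?P * \<delta>\<^sup>2))"
    unfolding Xi_def N_def[symmetric] by (intro abs_add_le abs_mult_le pa pb two trig c2 N G')
  also have "\<dots> = Kx * \<delta> ^ 4" by (simp add: Kx_def power2_eq_square power4_eq_xxxx mult_ac)
  finally have Xi: "\<bar>Xi c ?\<phi> ?\<theta> G\<bar> \<le> Kx * \<delta> ^ 4" .
  have "\<bar>La1 c ?\<phi> ?\<theta> G\<bar> \<le> ?K * (32 / ?P * \<delta>\<^sup>2) * (2 * (2 * \<delta>) * 1 + 2 * (2 * \<delta>))
      + (3 * \<delta> + 4 * \<delta>\<^sup>2 * (1 / \<delta>)) * 1 * (?K * (32 / ?P * \<delta>\<^sup>2))"
    unfolding La1_def N_def[symmetric] by (intro abs_add_le abs_mult_le pa pb two trig sG N G')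
  also have "\<dots> = 15 * ?K * (32 / ?P) * \<delta> ^ 3" using \<delta> by (simp add: power2_eq_square power3_eq_cube algebra_simps)
  finally have La1: "\<bar>La1 c ?\<phi> ?\<theta> G\<bar> \<le> 15 * ?K * (32 / ?P) * \<delta> ^ 3" .
  have "\<bar>Psi c ?\<phi> ?\<theta> G\<bar> \<le> ?K * (9 * \<delta>\<^sup>2 * 1 + 4 * \<delta>\<^sup>2) + 3 * \<delta> * (2 * \<delta>) * 1 * ?K"
    unfolding Psi_def N_def[symmetric] abs_minus_cancel
    by (intro abs_add_le abs_mult_le pab two trig sG c2 N G')
  also have "\<dots> = 19 * ?K * \<delta>\<^sup>2" by (simp add: power2_eq_square)
  finally have Psi: "\<bar>Psi c ?\<phi> ?\<theta> G\<bar> \<le> 19 * ?K * \<delta>\<^sup>2" .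
  have ec: "\<bar>1 + e * cos f\<bar> \<le> 2" "\<bar>e\<bar> \<le> 1"
    using abs_mult_le[of e "3/4" "cos f" 1] e by (auto simp: abs_le_iff)
  have "\<bar>xi c g e G f\<bar> \<le> 2 * 2 * (Kx * \<delta> ^ 4) * (1 / (\<gamma> * \<delta>))"
    unfolding xi_def by (intro abs_mult_le two ec Xi G')
  also have "\<dots> = 4 * (Kx / \<gamma>) * \<delta> ^ 3" using \<delta> by (simp add: power3_eq_cube power4_eq_xxxx)
  finally have xi: "\<bar>xi c g e G f\<bar> \<le> 4 * (Kx / \<gamma>) * \<delta> ^ 3" .
  have P': "\<bar>1 / ?P\<bar> \<le> 1 / ?P" using P by simp
  have "\<bar>eta c g e G f\<bar> \<le> 2 * \<delta> * (19 * ?K * \<delta>\<^sup>2) * (1 / ?P) + 1 * 1 * (Kx * \<delta> ^ 4) * (1 / (\<gamma> * \<delta>))"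
    unfolding eta_def by (intro abs_add_le abs_mult_le ec trig Xi G' Psi P')
  also have "\<dots> = (38 * ?K / ?P + Kx / \<gamma>) * \<delta> ^ 3"
    using \<delta> by (simp add: power2_eq_square power3_eq_cube power4_eq_xxxx distrib_right)
  finally have eta: "\<bar>eta c g e G f\<bar> \<le> (38 * ?K / ?P + Kx / \<gamma>) * \<delta> ^ 3" .
  have e4: "\<bar>1 / e\<bar> \<le> 4" using e by (simp add: field_simps)
  have "\<bar>qq c g e G f\<bar> \<le> ((38 * ?K / ?P + Kx / \<gamma>) * \<delta> ^ 3 * 1 + 4 * (Kx / \<gamma>) * \<delta> ^ 3 * 1) * 4"
    unfolding qq_def by (intro abs_add_le abs_mult_le eta xi trig e4)
  also have "\<dots> = 4 * (38 * ?K / ?P + 5 * (Kx / \<gamma>)) * \<delta> ^ 3" by (simp add: algebra_simps)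
  finally have qq: "\<bar>qq c g e G f\<bar> \<le> 4 * (38 * ?K / ?P + 5 * (Kx / \<gamma>)) * \<delta> ^ 3" .
  define A where "A = 38 * ?K / ?P"
  define B where "B = Kx / \<gamma>"
  have AB: "A > 0" "B > 0" using K P Kx \<gamma> by (auto simp: A_def B_def)
  have K1: "K1 \<gamma> = Kx + 4 * (A + 5 * B)" by (simp add: K1_def Kx_def A_def B_def)
  have d: "\<delta> ^ 3 \<ge> 0" "\<delta> ^ 4 \<ge> 0" using \<delta> by auto
  have le: "y \<le> K1 \<gamma> * z" if "y \<le> k * z" "k \<le> K1 \<gamma>" "z \<ge> 0" for y z k
    using that mult_right_mono[OF that(2,3)] by linarith
  have "15 * ?K * (32 / ?P) \<le> Kx" unfolding Kx_def using K P by (intro mult_right_mono) auto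
  then show "\<bar>La1 c ?\<phi> ?\<theta> G\<bar> \<le> K1 \<gamma> * \<delta> ^ 3" using AB by (intro le[OF La1 _ d(1)]) (simp add: K1)
  show "\<bar>Xi c ?\<phi> ?\<theta> G\<bar> \<le> K1 \<gamma> * \<delta> ^ 4" using AB by (intro le[OF Xi _ d(2)]) (simp add: K1)
  show "\<bar>xi c g e G f\<bar> \<le> K1 \<gamma> * \<delta> ^ 3"
    using AB Kx by (intro le[OF xi[folded B_def] _ d(1)]) (simp add: K1)
  show "\<bar>eta c g e G f\<bar> \<le> K1 \<gamma> * \<delta> ^ 3"
    using AB Kx by (intro le[OF eta[folded A_def B_def] _ d(1)]) (simp add: K1)
  show "\<bar>qq c g e G f\<bar> \<le> K1 \<gamma> * \<delta> ^ 3"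
    using AB Kx by (intro le[OF qq[folded A_def B_def] _ d(1)]) (simp add: K1)
qed

text \<open>Constants of the precession per radian of true anomaly: in units of
  \<open>M / ((kw e G f)\<^sup>2 + s)\<close> it lies between 1/2 and 6, and the denominator lies
  between 1/32 and 7 times \<open>(M\<^sup>2 * \<rho>)\<^sup>2 / G ^ 4\<close>.\<close>

definition \<kappa>1 :: real where "\<kappa>1 = M / (14 * (M\<^sup>2 * \<rho>)\<^sup>2)"
definition \<kappa>2 :: real where "\<kappa>2 = 192 * M / (M\<^sup>2 * \<rho>)\<^sup>2"

lemma eventually_le_power:
  fixes a b :: real
  assumes "b > 0" "n > 0"
  shows "eventually (\<lambda>\<delta>. a * \<delta> ^ n \<le> b) (at_right 0)"
proof -
  have "((\<lambda>\<delta>. a * \<delta> ^ n) \<longlongrightarrow> a * 0 ^ n) (at_right 0)" by (intro tendsto_intros)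
  then have "((\<lambda>\<delta>. a * \<delta> ^ n) \<longlongrightarrow> 0) (at_right 0)" using assms by (simp add: zero_power)
  from order_tendstoD(2)[OF this assms(1)] show ?thesis by eventually_elim simp
qed

text \<open>Dividing by \<open>fdot\<close>, which has order -3 in \<delta>, gives \<open>Ve\<close>
  order 6 and \<open>VG\<close> order 7. Two powers are thus left over, and they allow any
  prescribed factor \<epsilon>. In \<open>Vg\<close> the term \<open>2 * G / \<rho>\<^sup>2\<close>
  dominates \<open>La1\<close> and \<open>qq\<close>, which have order 3.\<close>

lemma field_bounds:
  assumes \<gamma>: "\<gamma> > 0" and \<epsilon>: "\<epsilon> > 0"
  shows "eventually (\<lambda>\<delta>. \<delta> > 0 \<and> 32 * \<delta>\<^sup>2 \<le> M\<^sup>2 * \<rho> \<and> (\<forall>e G g f. box \<gamma> \<delta> e G \<longrightarrow>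
    \<gamma> * (M\<^sup>2 * \<rho>)\<^sup>2 / (1024 * M * \<rho>\<^sup>2 * \<delta> ^ 3) \<le> fdot (5 * \<delta>\<^sup>2) g e G f \<and>
    \<bar>Ve (5 * \<delta>\<^sup>2) g e G f\<bar> \<le> \<epsilon> * \<delta> ^ 4 \<and> \<bar>VG (5 * \<delta>\<^sup>2) g e G f\<bar> \<le> \<epsilon> * \<delta> ^ 5 \<and>
    \<kappa>1 * G ^ 4 \<le> - s * Vg (5 * \<delta>\<^sup>2) g e G f \<and> - s * Vg (5 * \<delta>\<^sup>2) g e G f \<le> \<kappa>2 * G ^ 4)) (at_right 0)"
proof -
  let ?P = "M\<^sup>2 * \<rho>" and ?K = "K1 \<gamma>"
  have P: "?P > 0" using M \<rho> by simp
  \<comment> \<open>\<open>k / \<delta> ^ 3\<close> bounds \<open>knu\<close> from below: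
    \<open>G \<ge> \<gamma> * \<delta>\<close> in the linear factor and
    \<open>G \<le> 2 * \<delta>\<close> in \<open>?P\<^sup>2 / (32 * G ^ 4)\<close>, with
    \<open>32 * 2 ^ 4 = 512\<close>.\<close>
  define k where "k = \<gamma> * ?P\<^sup>2 / (512 * M * \<rho>\<^sup>2)"
  have k: "k > 0"
    unfolding k_def using \<gamma> P M \<rho> by simp
  have K0: "?K \<ge> 0" using \<gamma> P M \<rho> by (simp add: K1_def)
  have ev: "eventually (\<lambda>\<delta>. \<delta> > 0 \<and> 32 * \<delta> ^ 2 \<le> ?P \<and> ?K * \<delta> ^ 6 \<le> k / 2 \<and>
     4 * ?K / k * \<delta> ^ 2 \<le> \<epsilon> \<and> 2 * ?K * \<rho>\<^sup>2 / \<gamma> * \<delta> ^ 2 \<le> 1) (at_right 0)"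
    by (intro eventually_conj eventually_le_power eventually_at_right_less) (use P k \<epsilon> in auto)
  show ?thesis using ev
  proof eventually_elim
    case (elim \<delta>)
    then have \<delta>: "\<delta> > 0" and small: "32 * \<delta>\<^sup>2 \<le> ?P" and d1: "?K * \<delta> ^ 6 \<le> k / 2"
      and d2: "4 * ?K / k * \<delta>\<^sup>2 \<le> \<epsilon>" and d3: "2 * ?K * \<rho>\<^sup>2 / \<gamma> * \<delta>\<^sup>2 \<le> 1" by auto
    let ?c = "5 * \<delta>\<^sup>2"
    define A where "A = k / \<delta> ^ 3"
    have main: "\<gamma> * ?P\<^sup>2 / (1024 * M * \<rho>\<^sup>2 * \<delta> ^ 3) \<le> fdot ?c g e G f \<and>
      \<bar>Ve ?c g e G f\<bar> \<le> \<epsilon> * \<delta> ^ 4 \<and> \<bar>VG ?c g e G f\<bar> \<le> \<epsilon> * \<delta> ^ 5 \<and>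
      \<kappa>1 * G ^ 4 \<le> - s * Vg ?c g e G f \<and> - s * Vg ?c g e G f \<le> \<kappa>2 * G ^ 4"
      if b: "box \<gamma> \<delta> e G" for e G g f
    proof -
      note kb = kepler_box[OF b \<gamma> \<delta> small] and pb = perturbation_bounds[OF b \<gamma> \<delta> small]
      let ?w = "(kw e G f)\<^sup>2 + s" and ?nu = "knu e G f" and ?q = "qq ?c g e G f" and ?D = "fdot ?c g e G f"
      have G: "G > 0" "\<gamma> * \<delta> \<le> G" "G \<le> 2 * \<delta>" using b kb by (auto simp: box_def)
      have w: "?w > 0" using kw_square_gt[OF kb(2)] .
      have G4: "0 < G ^ 4" using G by simp
      have G4': "G ^ 4 \<le> (2 * \<delta>) ^ 4" using G by (intro power_mono) auto
      have nu: "A \<le> ?nu"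
      proof -
        have "A = \<gamma> * \<delta> * (?P\<^sup>2 / (32 * (2 * \<delta>) ^ 4)) / (M * \<rho>\<^sup>2)"
          unfolding A_def k_def using \<delta> by (simp add: power_mult_distrib power3_eq_cube power4_eq_xxxx)
        also have "\<dots> \<le> G * ?w / (M * \<rho>\<^sup>2)"
        proof (intro divide_right_mono mult_mono)
          have "?P\<^sup>2 / (32 * (2 * \<delta>) ^ 4) \<le> ?P\<^sup>2 / (32 * G ^ 4)"
            using G4 G4' \<delta> by (intro divide_left_mono) auto
          then show "?P\<^sup>2 / (32 * (2 * \<delta>) ^ 4) \<le> ?w" using kb(8)[of f] by linarith
        qed (use G M \<rho> in auto)
        finally show ?thesis by (simp add: knu_def)
      qed
      have "?K * \<delta> ^ 3 \<le> A / 2"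
        unfolding A_def using d1 \<delta> by (simp add: field_simps flip: power_add)
      then have q: "\<bar>?q\<bar> \<le> ?nu / 2" using pb(6)[of g f] nu by linarith
      have kd: "0 < A" using k \<delta> by (simp add: A_def)
      have D: "A / 2 \<le> ?D" "?nu / 2 \<le> ?D" "?D \<le> 2 * ?nu"
        unfolding fdot_def using q nu kd by auto
      have Dpos: "?D > 0" using D kd by linarith
      have iD: "\<bar>1 / ?D\<bar> \<le> 2 * \<delta> ^ 3 / k"
      proof -
        have "1 / ?D \<le> 1 / (A / 2)" using D(1) kd by (intro divide_left_mono) auto
        then show ?thesis using Dpos by (simp add: A_def mult.commute)
      qed
      have trig: "\<bar>cos f\<bar> \<le> 1" "\<bar>sin f\<bar> \<le> 1" by auto
      have "\<bar>Ve ?c g e G f\<bar> \<le> (?K * \<delta> ^ 3 * 1 + ?K * \<delta> ^ 3 * 1) * (2 * \<delta> ^ 3 / k)"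
        unfolding Ve_def by (intro abs_mult_le abs_add_le pb trig iD)
      also have "\<dots> = 4 * ?K / k * \<delta>\<^sup>2 * \<delta> ^ 4" by (simp add: eval_nat_numeral)
      also have "\<dots> \<le> \<epsilon> * \<delta> ^ 4" using d2 by (intro mult_right_mono) auto
      finally have Ve: "\<bar>Ve ?c g e G f\<bar> \<le> \<epsilon> * \<delta> ^ 4" .
      have "\<bar>VG ?c g e G f\<bar> \<le> ?K * \<delta> ^ 4 * (2 * \<delta> ^ 3 / k)"
        unfolding VG_def by (intro abs_mult_le pb iD)
      also have "\<dots> = 2 * ?K / k * \<delta>\<^sup>2 * \<delta> ^ 5" by (simp add: eval_nat_numeral)
      also have "\<dots> \<le> 4 * ?K / k * \<delta>\<^sup>2 * \<delta> ^ 5"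
        using \<delta> K0 k by (intro mult_right_mono divide_right_mono) auto
      also have "\<dots> \<le> \<epsilon> * \<delta> ^ 5" using d2 \<delta> by (intro mult_right_mono) auto
      finally have VG: "\<bar>VG ?c g e G f\<bar> \<le> \<epsilon> * \<delta> ^ 5" .
      let ?La = "La ?c (kphi e G f) (g + f) G" and ?La1 = "La1 ?c (kphi e G f) (g + f) G"
      have rest: "2 * ?K * \<delta> ^ 3 \<le> G / \<rho>\<^sup>2"
      proof -
        have "2 * ?K * \<delta> ^ 3 = (2 * ?K * \<rho>\<^sup>2 / \<gamma> * \<delta>\<^sup>2) * (\<gamma> * \<delta> / \<rho>\<^sup>2)"
          using \<gamma> \<rho> by (simp add: eval_nat_numeral)
        also have "\<dots> \<le> 1 * (\<gamma> * \<delta> / \<rho>\<^sup>2)" using d3 \<gamma> \<delta> \<rho> by (intro mult_right_mono) auto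
        also have "\<dots> \<le> G / \<rho>\<^sup>2" using G \<rho> by (simp add: divide_right_mono)
        finally show ?thesis .
      qed
      have "- s * (?La - ?q) = 2 * (G / \<rho>\<^sup>2) - s * (?La1 - ?q)"
        using s by (auto simp: La_def)
      moreover have "\<bar>s * (?La1 - ?q)\<bar> \<le> 1 * (?K * \<delta> ^ 3 + ?K * \<delta> ^ 3)"
        by (intro abs_mult_le abs_add_le pb) (use s in auto)
      ultimately have num: "G / \<rho>\<^sup>2 \<le> - s * (?La - ?q)" "- s * (?La - ?q) \<le> 3 * (G / \<rho>\<^sup>2)"
        using rest by (auto simp: abs_le_iff)
      have nupos: "?nu > 0" by (rule knu_pos[OF kb(2)])
      have Vg: "- s * Vg ?c g e G f = - s * (?La - ?q) / ?D" by (simp add: Vg_def)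
      have Gnu: "G / \<rho>\<^sup>2 / ?nu = M / ?w"
      proof -
        have "G / \<rho>\<^sup>2 / (G * y / (M * \<rho>\<^sup>2)) = M / y" if "y > 0" for y
          using G \<rho> M that by (simp add: field_simps)
        from this[OF w] show ?thesis by (simp only: knu_def)
      qed
      have Gr: "G / \<rho>\<^sup>2 > 0" using G \<rho> by simp
      have lo: "G / \<rho>\<^sup>2 / (2 * ?nu) \<le> - s * Vg ?c g e G f"
        unfolding Vg using num D Dpos Gr by (intro frac_le) auto
      have up: "- s * Vg ?c g e G f \<le> 3 * (G / \<rho>\<^sup>2) / (?nu / 2)"
        unfolding Vg using num D nupos Gr by (intro frac_le) auto
      have "\<kappa>1 * G ^ 4 = M / (7 * ?P\<^sup>2 / G ^ 4) / 2" by (simp add: \<kappa>1_def)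
      also have "\<dots> \<le> M / ?w / 2"
        using M w less_le_trans[OF w kb(7)] by (intro divide_right_mono divide_left_mono[OF kb(7)] mult_pos_pos) linarith+
      also have "\<dots> = G / \<rho>\<^sup>2 / (2 * ?nu)" by (simp flip: Gnu)
      finally have lo': "\<kappa>1 * G ^ 4 \<le> - s * Vg ?c g e G f" using lo by linarith
      have "3 * (G / \<rho>\<^sup>2) / (?nu / 2) = 6 * (M / ?w)" by (simp flip: Gnu)
      also have "\<dots> \<le> 6 * (M / (?P\<^sup>2 / (32 * G ^ 4)))"
        using P G4 w M by (intro mult_left_mono divide_left_mono[OF kb(8)] mult_pos_pos divide_pos_pos) auto
      also have "\<dots> = \<kappa>2 * G ^ 4" by (simp add: \<kappa>2_def)
      finally have up': "- s * Vg ?c g e G f \<le> \<kappa>2 * G ^ 4" using up by linarith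
      have "\<gamma> * ?P\<^sup>2 / (1024 * M * \<rho>\<^sup>2 * \<delta> ^ 3) = A / 2" by (simp add: A_def k_def)
      then show ?thesis using D(1) Ve VG lo' up' by metis
    qed
    show ?case using \<delta> small main by blast
  qed
qed

section \<open>Variation of constants\<close>

text \<open>The computation runs in \<open>e * cos f\<close> and \<open>e * sin f\<close>, in which
  \<phi> and \<open>p\<^sub>\<phi>\<close> are simple and the factor \<open>1 / e\<close> of
  \<open>qq\<close> disappears.\<close>

lemma osculating_motion:
  fixes f g e G :: "real \<Rightarrow> real"
  defines "x \<equiv> \<lambda>t. (kphi (e t) (G t) (f t), kp (e t) (G t) (f t), g t + f t, G t)"
  assumes con: "conic (e t) (G t)" and c: "c - s * (G t)\<^sup>2 > 0"
    and f: "(f has_real_derivative fdot c (g t) (e t) (G t) (f t)) (at t)"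
    and g: "(g has_real_derivative La c (kphi (e t) (G t) (f t)) (g t + f t) (G t) - qq c (g t) (e t) (G t) (f t)) (at t)"
    and e: "(e has_real_derivative xi c (g t) (e t) (G t) (f t) * cos (f t) + eta c (g t) (e t) (G t) (f t) * sin (f t)) (at t)"
    and G: "(G has_real_derivative Xi c (kphi (e t) (G t) (f t)) (g t + f t) (G t)) (at t)"
  shows "(x has_vector_derivative hamiltonian_field (F_red s \<rho> m1 m2 c) (x t)) (at t)"
proof -
  define xi0 eta0 q0 nu0 X0 P0 L0 w0 k0 where
    "xi0 = xi c (g t) (e t) (G t) (f t)" and "eta0 = eta c (g t) (e t) (G t) (f t)" and
    "q0 = qq c (g t) (e t) (G t) (f t)" and "nu0 = knu (e t) (G t) (f t)" and
    "X0 = Xi c (kphi (e t) (G t) (f t)) (g t + f t) (G t)" and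
    "P0 = Psi c (kphi (e t) (G t) (f t)) (g t + f t) (G t)" and
    "L0 = La c (kphi (e t) (G t) (f t)) (g t + f t) (G t)" and
    "w0 = kw (e t) (G t) (f t)" and "k0 = M\<^sup>2 * \<rho>"
  note defs = xi0_def[symmetric] eta0_def[symmetric] q0_def[symmetric] nu0_def[symmetric] X0_def[symmetric]
    L0_def[symmetric]
  have k0: "k0 > 0" using M \<rho> by (simp add: k0_def)
  have cD: "e t > 0" "G t > 0" using conicD[OF con] by auto
  have w0: "w0\<^sup>2 + s > 0" unfolding w0_def by (rule kw_square_gt[OF con])
  have f': "(f has_real_derivative nu0 + q0) (at t)" using f unfolding fdot_def defs .
  have e': "(e has_real_derivative xi0 * cos (f t) + eta0 * sin (f t)) (at t)" using e unfolding defs .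
  have G': "(G has_real_derivative X0) (at t)" using G unfolding defs .
  have q0: "e t * q0 = eta0 * cos (f t) - xi0 * sin (f t)"
    using cD by (simp add: q0_def qq_def xi0_def eta0_def)
  \<comment> \<open>The vector \<open>e * (cos f, sin f)\<close> rotates with the Kepler rate
    \<open>nu0\<close>; the contributions of \<open>q0\<close> and of the change of \<open>e\<close>
    recombine into \<open>(xi0, eta0)\<close>.\<close>
  have dX: "((\<lambda>t. e t * cos (f t)) has_real_derivative xi0 - nu0 * (e t * sin (f t))) (at t)"
  proof -
    have "((\<lambda>t. e t * cos (f t)) has_real_derivative
      (xi0 * cos (f t) + eta0 * sin (f t)) * cos (f t) - sin (f t) * (nu0 + q0) * e t) (at t)"
      by (auto intro!: derivative_eq_intros f' e')
    also have "(xi0 * cos (f t) + eta0 * sin (f t)) * cos (f t) - sin (f t) * (nu0 + q0) * e t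
      = xi0 * (cos (f t))\<^sup>2 + eta0 * sin (f t) * cos (f t) - nu0 * (e t * sin (f t)) - sin (f t) * (e t * q0)"
      by (simp add: algebra_simps power2_eq_square)
    also have "\<dots> = xi0 * ((cos (f t))\<^sup>2 + (sin (f t))\<^sup>2) - nu0 * (e t * sin (f t))"
      unfolding q0 by (simp add: algebra_simps power2_eq_square del: sin_cos_squared_add2 sin_cos_squared_add3)
    also have "\<dots> = xi0 - nu0 * (e t * sin (f t))" by (simp only: sin_cos_squared_add2 mult_1_right)
    finally show ?thesis .
  qed
  have dY: "((\<lambda>t. e t * sin (f t)) has_real_derivative eta0 + nu0 * (e t * cos (f t))) (at t)"
  proof -
    have "((\<lambda>t. e t * sin (f t)) has_real_derivative
      (xi0 * cos (f t) + eta0 * sin (f t)) * sin (f t) + cos (f t) * (nu0 + q0) * e t) (at t)"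
      by (auto intro!: derivative_eq_intros f' e')
    also have "(xi0 * cos (f t) + eta0 * sin (f t)) * sin (f t) + cos (f t) * (nu0 + q0) * e t
      = xi0 * sin (f t) * cos (f t) + eta0 * (sin (f t))\<^sup>2 + nu0 * (e t * cos (f t)) + cos (f t) * (e t * q0)"
      by (simp add: algebra_simps power2_eq_square)
    also have "\<dots> = eta0 * ((cos (f t))\<^sup>2 + (sin (f t))\<^sup>2) + nu0 * (e t * cos (f t))"
      unfolding q0 by (simp add: algebra_simps power2_eq_square del: sin_cos_squared_add2 sin_cos_squared_add3)
    also have "\<dots> = eta0 + nu0 * (e t * cos (f t))" by (simp only: sin_cos_squared_add2 mult_1_right)
    finally show ?thesis .
  qed
  have dphi: "((\<lambda>t. kphi (e t) (G t) (f t)) has_real_derivative kp (e t) (G t) (f t) / (M * \<rho>\<^sup>2)) (at t)"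
  proof -
    have "((\<lambda>t. k0 / (G t)\<^sup>2 * (1 + e t * cos (f t))) has_real_derivative
       - (k0 * (2 * G t * X0)) / ((G t)\<^sup>2 * (G t)\<^sup>2) * (1 + e t * cos (f t))
         + k0 / (G t)\<^sup>2 * (xi0 - nu0 * (e t * sin (f t)))) (at t)"
    proof -
      have "((\<lambda>t. k0 / (G t)\<^sup>2 * (1 + X t)) has_real_derivative
         - (k0 * (2 * G t * X0)) / ((G t)\<^sup>2 * (G t)\<^sup>2) * (1 + X t) + k0 / (G t)\<^sup>2 * X') (at t)"
        if "(X has_real_derivative X') (at t)" for X X'
        using cD by (auto intro!: derivative_eq_intros G' that simp: field_simps)
      from this[OF dX] show ?thesis .
    qed
    \<comment> \<open>\<open>R\<close> does not contain \<open>p\<^sub>\<phi>\<close>, so \<phi>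
      must move as in the Kepler problem: \<open>xi\<close> is the value that compensates the effect
      of the changing \<open>G\<close> on \<open>kw\<close>.\<close>
    moreover have "- (k0 * (2 * G t * X0)) / ((G t)\<^sup>2 * (G t)\<^sup>2) * (1 + e t * cos (f t))
         + k0 / (G t)\<^sup>2 * (xi0 - nu0 * (e t * sin (f t))) = - nu0 * kp (e t) (G t) (f t) / G t"
    proof -
      have "xi0 = 2 * (1 + e t * cos (f t)) * X0 / G t" by (simp add: xi0_def xi_def X0_def)
      then show ?thesis using cD unfolding kp_def k0_def[symmetric]
        by (simp add: field_simps power2_eq_square)
    qed
    ultimately have "((\<lambda>t. kw (e t) (G t) (f t)) has_real_derivative - nu0 * kp (e t) (G t) (f t) / G t) (at t)"
      unfolding kw_def k0_def[symmetric] by simp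
    from DERIV_chain2[OF acot_has_derivative[OF s kw_gt_1[OF con]] this]
    have "((\<lambda>t. kphi (e t) (G t) (f t)) has_real_derivative
      - 1 / (w0\<^sup>2 + s) * (- nu0 * kp (e t) (G t) (f t) / G t)) (at t)"
      unfolding kphi_def w0_def .
    moreover have "- 1 / (w0\<^sup>2 + s) * (- nu0 * kp (e t) (G t) (f t) / G t) = kp (e t) (G t) (f t) / (M * \<rho>\<^sup>2)"
      using w0 cD M \<rho> unfolding nu0_def knu_def w0_def[symmetric] by simp
    ultimately show ?thesis by simp
  qed
  have dp: "((\<lambda>t. kp (e t) (G t) (f t)) has_real_derivative
      (w0\<^sup>2 + s) * ((G t)\<^sup>2 * w0 / (M * \<rho>\<^sup>2) - M / \<rho>) + P0) (at t)"
  proof -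
    have "((\<lambda>t. k0 / G t * (e t * sin (f t))) has_real_derivative
       - (k0 * X0) / (G t * G t) * (e t * sin (f t)) + k0 / G t * (eta0 + nu0 * (e t * cos (f t)))) (at t)"
    proof -
      have "((\<lambda>t. k0 / G t * Y t) has_real_derivative
         - (k0 * X0) / (G t * G t) * Y t + k0 / G t * Y') (at t)"
        if "(Y has_real_derivative Y') (at t)" for Y Y'
        using cD by (auto intro!: derivative_eq_intros G' that simp: field_simps)
      from this[OF dY] show ?thesis .
    qed
    \<comment> \<open>Likewise \<open>eta\<close> is the value for which exactly the perturbing
      force \<open>P0\<close> is left over.\<close>
    moreover have "- (k0 * X0) / (G t * G t) * (e t * sin (f t)) + k0 / G t * (eta0 + nu0 * (e t * cos (f t)))
      = k0 / G t * (e t * cos (f t)) * nu0 + P0"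
    proof -
      have "eta0 = G t * P0 / k0 + e t * sin (f t) * X0 / G t"
        by (simp add: eta0_def eta_def P0_def X0_def k0_def)
      then show ?thesis using cD k0 by (simp add: field_simps)
    qed
    moreover have "k0 / G t * (e t * cos (f t)) * nu0 = (w0\<^sup>2 + s) * ((G t)\<^sup>2 * w0 / (M * \<rho>\<^sup>2) - M / \<rho>)"
      using kp_force[OF con] unfolding k0_def nu0_def w0_def by blast
    moreover have "(\<lambda>t. kp (e t) (G t) (f t)) = (\<lambda>t. k0 / G t * (e t * sin (f t)))"
      by (simp add: kp_def k0_def mult_ac)
    ultimately show ?thesis by simp
  qed
  have d\<theta>: "((\<lambda>t. g t + f t) has_real_derivative nu0 + L0) (at t)"
  proof -
    have "((\<lambda>t. g t + f t) has_real_derivative (L0 - q0) + (nu0 + q0)) (at t)"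
      by (rule DERIV_add[OF g[unfolded defs] f'])
    then show ?thesis by (simp add: algebra_simps)
  qed
  have S0: "S s (kphi (e t) (G t) (f t)) \<noteq> 0" using kphi_facts(3)[OF con, of "f t"] by simp
  have "hamiltonian_field (F_red s \<rho> m1 m2 c) (x t) =
    (kp (e t) (G t) (f t) / (M * \<rho>\<^sup>2), (w0\<^sup>2 + s) * ((G t)\<^sup>2 * w0 / (M * \<rho>\<^sup>2) - M / \<rho>) + P0, nu0 + L0, X0)"
    unfolding x_def reduced_field[OF S0 c] kphi_facts(4,5)[OF con] P0_def L0_def X0_def w0_def nu0_def knu_def
    by simp
  then show ?thesis
    using dphi dp d\<theta> G' unfolding has_real_derivative_iff_has_vector_derivative x_def
    by (auto intro!: has_vector_derivative_Pair)
qed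

end

section \<open>Bounded Lipschitz functions\<close>

text \<open>Boundedness is carried along because Lipschitz functions are closed under products only
  when bounded.\<close>

definition bl :: "'a::metric_space set \<Rightarrow> ('a \<Rightarrow> real) \<Rightarrow> bool" where
  "bl D F \<longleftrightarrow> (\<exists>B. \<forall>x\<in>D. \<bar>F x\<bar> \<le> B) \<and> (\<exists>L. L-lipschitz_on D F)"

lemma blI: "(\<And>x. x \<in> D \<Longrightarrow> \<bar>F x\<bar> \<le> B) \<Longrightarrow> L-lipschitz_on D F \<Longrightarrow> bl D F"
  by (auto simp: bl_def)

lemma blE:
  assumes "bl D F"
  obtains B L where "\<And>x. x \<in> D \<Longrightarrow> \<bar>F x\<bar> \<le> B" "B \<ge> 0" "L-lipschitz_on D F"
proof -
  from assms obtain B L where "\<And>x. x \<in> D \<Longrightarrow> \<bar>F x\<bar> \<le> B" "L-lipschitz_on D F" by (auto simp: bl_def)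
  then show ?thesis using that[of "max 0 B" L] by (auto simp: le_max_iff_disj)
qed

lemma bl_cong: "bl D F \<Longrightarrow> (\<And>x. x \<in> D \<Longrightarrow> F x = H x) \<Longrightarrow> bl D H"
  unfolding bl_def by (metis (mono_tags, lifting) lipschitz_on_transform)

lemma bl_const: "bl D (\<lambda>x. k)"
  by (rule blI[of _ _ "\<bar>k\<bar>" 0]) (auto intro: lipschitz_on_constant)

lemma bl_add: "bl D F \<Longrightarrow> bl D H \<Longrightarrow> bl D (\<lambda>x. F x + H x)"
  by (elim blE, rule blI[of _ _ "_ + _", OF _ lipschitz_on_add]) (auto intro: order_trans[OF abs_triangle_ineq add_mono])

lemma bl_minus: "bl D F \<Longrightarrow> bl D (\<lambda>x. - F x)"
  by (elim blE, rule blI[OF _ lipschitz_on_minus]) auto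

lemma bl_diff: "bl D F \<Longrightarrow> bl D H \<Longrightarrow> bl D (\<lambda>x. F x - H x)"
  using bl_add[OF _ bl_minus, of D F H] by simp

lemma bl_mult:
  assumes "bl D F" "bl D H"
  shows "bl D (\<lambda>x. F x * H x)"
proof -
  obtain B L where F: "\<And>x. x \<in> D \<Longrightarrow> \<bar>F x\<bar> \<le> B" "B \<ge> 0" "L-lipschitz_on D F" using assms(1) by (rule blE) blast
  obtain C K where H: "\<And>x. x \<in> D \<Longrightarrow> \<bar>H x\<bar> \<le> C" "C \<ge> 0" "K-lipschitz_on D H" using assms(2) by (rule blE) blast
  show ?thesis
  proof (rule blI)
    show "\<bar>F x * H x\<bar> \<le> B * C" if "x \<in> D" for x
      using F(1)[OF that] H(1)[OF that] by (rule abs_mult_le)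
    show "(B * K + L * C)-lipschitz_on D (\<lambda>x. F x * H x)"
    proof (rule lipschitz_onI)
      fix x y assume xy: "x \<in> D" "y \<in> D"
      have "F x * H x - F y * H y = F x * (H x - H y) + (F x - F y) * H y" by (simp add: algebra_simps)
      also have "\<bar>\<dots>\<bar> \<le> B * (K * dist x y) + L * dist x y * C"
        using lipschitz_onD[OF F(3) xy] lipschitz_onD[OF H(3) xy] F(1) H(1) xy
        by (intro abs_add_le abs_mult_le) (auto simp: dist_real_def)
      finally show "dist (F x * H x) (F y * H y) \<le> (B * K + L * C) * dist x y"
        by (simp add: dist_real_def algebra_simps)
    qed (use F(2) H(2) lipschitz_on_nonneg[OF F(3)] lipschitz_on_nonneg[OF H(3)] in auto)
  qed
qed

lemma bl_power2: "bl D F \<Longrightarrow> bl D (\<lambda>x. (F x)\<^sup>2)"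
  unfolding power2_eq_square by (rule bl_mult)

lemma bl_cdivide: "bl D F \<Longrightarrow> bl D (\<lambda>x. F x / k)"
  using bl_mult[OF _ bl_const[of D "1 / k"], of F] by simp

text \<open>The bound on \<open>F\<close> and the lower bound \<open>a\<close> confine its values to
  a compact interval, on which the continuous derivative \<open>h'\<close> is bounded.\<close>

lemma bl_compose:
  fixes h h' :: "real \<Rightarrow> real"
  assumes "bl D F" and a: "\<And>x. x \<in> D \<Longrightarrow> a \<le> F x"
    and d: "\<And>y. a \<le> y \<Longrightarrow> (h has_real_derivative h' y) (at y)" and h': "continuous_on {a..} h'"
  shows "bl D (\<lambda>x. h (F x))"
proof -
  obtain B L where F: "\<And>x. x \<in> D \<Longrightarrow> \<bar>F x\<bar> \<le> B" "B \<ge> 0" "L-lipschitz_on D F" using assms(1) by (rule blE) blast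
  have F': "F x \<in> {a..B}" if "x \<in> D" for x using F(1)[OF that] a[OF that] by auto
  have "compact (h' ` {a..B})"
    by (intro compact_continuous_image continuous_on_subset[OF h']) auto
  from compact_imp_bounded[OF this] obtain C where "\<forall>y\<in>{a..B}. \<bar>h' y\<bar> \<le> C" "C > 0"
    by (auto simp: bounded_pos)
  then have C: "\<And>y. y \<in> {a..B} \<Longrightarrow> \<bar>h' y\<bar> \<le> C" "C > 0" by auto
  have lip: "\<bar>h y - h z\<bar> \<le> C * \<bar>y - z\<bar>" if "y \<in> {a..B}" "z \<in> {a..B}" for y z
    using field_differentiable_bound[of "{a..B}" h h' C y z] that C(1) d
    by (auto intro: has_field_derivative_at_within)
  have cont: "continuous_on {a..B} h"
    by (intro continuous_at_imp_continuous_on ballI DERIV_isCont[OF d]) simp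
  from compact_imp_bounded[OF compact_continuous_image[OF cont compact_Icc]]
  obtain E where "\<forall>y\<in>{a..B}. \<bar>h y\<bar> \<le> E" by (auto simp: bounded_iff)
  then have E: "\<And>y. y \<in> {a..B} \<Longrightarrow> \<bar>h y\<bar> \<le> E" by auto
  show ?thesis
  proof (rule blI)
    show "\<bar>h (F x)\<bar> \<le> E" if "x \<in> D" for x using E F'[OF that] .
    show "(C * L)-lipschitz_on D (\<lambda>x. h (F x))"
    proof (rule lipschitz_onI)
      fix x y assume xy: "x \<in> D" "y \<in> D"
      have "\<bar>h (F x) - h (F y)\<bar> \<le> C * \<bar>F x - F y\<bar>" using lip F' xy by blast
      also have "\<dots> \<le> C * (L * dist x y)"
        using lipschitz_onD[OF F(3) xy] C(2) by (intro mult_left_mono) (auto simp: dist_real_def)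
      finally show "dist (h (F x)) (h (F y)) \<le> C * L * dist x y" by (simp add: dist_real_def)
    qed (use C(2) lipschitz_on_nonneg[OF F(3)] in auto)
  qed
qed

lemma bl_inverse:
  assumes "bl D F" "a > 0" "\<And>x. x \<in> D \<Longrightarrow> a \<le> F x"
  shows "bl D (\<lambda>x. 1 / F x)"
  using assms(2)
  by (intro bl_compose[where h = "\<lambda>y. 1 / y" and h' = "\<lambda>y. - 1 / y\<^sup>2", OF assms(1,3)])
     (auto intro!: derivative_eq_intros continuous_intros simp: power2_eq_square)

text \<open>Only a Lipschitz bound is asked of the argument, since the angles \<open>f\<close> and
  \<open>g\<close> are unbounded.\<close>

lemma bl_cos: "L-lipschitz_on D F \<Longrightarrow> bl D (\<lambda>x. cos (F x))"
  and bl_sin: "L-lipschitz_on D F \<Longrightarrow> bl D (\<lambda>x. sin (F x))"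
proof -
  assume F: "L-lipschitz_on D F"
  have "1-lipschitz_on UNIV (cos :: real \<Rightarrow> real)" "1-lipschitz_on UNIV (sin :: real \<Rightarrow> real)"
  proof -
    have "\<bar>cos x - cos y\<bar> \<le> 1 * \<bar>x - y\<bar>" "\<bar>sin x - sin y\<bar> \<le> 1 * \<bar>x - y\<bar>" for x y :: real
      using field_differentiable_bound[of UNIV cos "\<lambda>x. - sin x" 1 x y]
        field_differentiable_bound[of UNIV sin cos 1 x y] by (auto intro: DERIV_cos DERIV_sin)
    then show "1-lipschitz_on UNIV (cos :: real \<Rightarrow> real)" "1-lipschitz_on UNIV (sin :: real \<Rightarrow> real)"
      by (auto intro!: lipschitz_onI simp: dist_real_def)
  qed
  then have "1-lipschitz_on (F ` D) cos" "1-lipschitz_on (F ` D) sin"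
    by (auto intro: lipschitz_on_subset)
  from lipschitz_on_compose2[OF F this(1)] lipschitz_on_compose2[OF F this(2)]
  show "bl D (\<lambda>x. cos (F x))" "bl D (\<lambda>x. sin (F x))"
    by (auto intro!: blI[of D _ 1])
qed

lemma (in two_body) bl_field:
  fixes f g e G :: "'a::metric_space \<Rightarrow> real"
  assumes f: "L-lipschitz_on D f" and g: "L'-lipschitz_on D g" and e: "bl D e" and G: "bl D G"
    and b: "\<And>x. x \<in> D \<Longrightarrow> box \<gamma> \<delta> (e x) (G x)" and \<gamma>: "\<gamma> > 0" and \<delta>: "\<delta> > 0" and small: "32 * \<delta>\<^sup>2 \<le> M\<^sup>2 * \<rho>"
    and k: "k > 0" "\<And>x. x \<in> D \<Longrightarrow> k \<le> fdot (5 * \<delta>\<^sup>2) (g x) (e x) (G x) (f x)"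
  shows "bl D (\<lambda>x. Vg (5 * \<delta>\<^sup>2) (g x) (e x) (G x) (f x))" "bl D (\<lambda>x. Ve (5 * \<delta>\<^sup>2) (g x) (e x) (G x) (f x))"
    "bl D (\<lambda>x. VG (5 * \<delta>\<^sup>2) (g x) (e x) (G x) (f x))" "bl D (\<lambda>x. 1 / fdot (5 * \<delta>\<^sup>2) (g x) (e x) (G x) (f x))"
proof -
  note kb = kepler_box[OF b \<gamma> \<delta> small] and pb = perturbation_bounds[OF b \<gamma> \<delta> small]
  note I = bl_const bl_add bl_minus bl_diff bl_mult bl_power2 bl_cdivide
  let ?c = "5 * \<delta>\<^sup>2"
  have trig: "bl D (\<lambda>x. cos (f x))" "bl D (\<lambda>x. sin (f x))" "bl D (\<lambda>x. cos (g x + f x))" "bl D (\<lambda>x. sin (g x + f x))"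
    using f g by (auto intro!: bl_cos bl_sin lipschitz_on_add)
  have iG: "bl D (\<lambda>x. 1 / G x)" by (rule bl_inverse[OF G mult_pos_pos[OF \<gamma> \<delta>]]) (use b in \<open>auto simp: box_def\<close>)
  have ie: "bl D (\<lambda>x. 1 / e x)" by (rule bl_inverse[OF e, of "1 / 4"]) (use b in \<open>auto simp: box_def\<close>)
  have w: "bl D (\<lambda>x. kw (e x) (G x) (f x))"
  proof -
    have "kw (e x) (G x) (f x) = M\<^sup>2 * \<rho> * (1 / G x)\<^sup>2 * (1 + e x * cos (f x))" for x
      by (simp add: kw_def power_divide)
    then show ?thesis using iG e trig by (auto intro!: I)
  qed
  have phi: "bl D (\<lambda>x. kphi (e x) (G x) (f x))"
    unfolding kphi_def
  proof (rule bl_compose[where h' = "\<lambda>y. - 1 / (y\<^sup>2 + s)", OF w kb(3)])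
    have "y\<^sup>2 + s \<noteq> 0" if "2 \<le> y" for y using power_mono[OF that, of 2] s by auto
    then show "continuous_on {2..} (\<lambda>y. - 1 / (y\<^sup>2 + s))" by (intro continuous_intros) auto
    show "(acot s has_real_derivative - 1 / (y\<^sup>2 + s)) (at y)" if "2 \<le> y" for y
      using that by (intro acot_has_derivative s) simp
  qed
  define \<Phi> where "\<Phi> x = kphi (e x) (G x) (f x)" for x
  note phi = phi[folded \<Phi>_def]
  have \<Phi>: "\<Phi> x > 0" if "x \<in> D" for x unfolding \<Phi>_def using kb(4)[OF that] .
  have cS: "continuous_on A (S s)" "continuous_on A (S' s)" for A
    using S_has_derivative S'_has_derivative[OF s]
    by (auto intro!: continuous_at_imp_continuous_on intro: DERIV_isCont)
  have S: "bl D (\<lambda>x. S s (m * \<Phi> x))" "bl D (\<lambda>x. S' s (m * \<Phi> x))" if "m \<ge> 0" for m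
  proof -
    have m: "bl D (\<lambda>x. m * \<Phi> x)" by (intro I phi)
    have m0: "0 \<le> m * \<Phi> x" if "x \<in> D" for x using \<Phi>[OF that] \<open>m \<ge> 0\<close> by simp
    show "bl D (\<lambda>x. S s (m * \<Phi> x))" by (rule bl_compose[OF m m0 S_has_derivative cS(2)])
    show "bl D (\<lambda>x. S' s (m * \<Phi> x))"
      by (rule bl_compose[OF m m0 S'_has_derivative[OF s]]) (auto intro!: continuous_intros cS)
  qed
  have SS: "bl D (\<lambda>x. S s (m1 * \<Phi> x))" "bl D (\<lambda>x. S' s (m1 * \<Phi> x))" "bl D (\<lambda>x. S s (m2 * \<Phi> x))"
    "bl D (\<lambda>x. S' s (m2 * \<Phi> x))" "bl D (\<lambda>x. S s (\<Phi> x))" "bl D (\<lambda>x. S' s (\<Phi> x))"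
    using S[of m1] S[of m2] S[of 1] m1 m2 by auto
  \<comment> \<open>Both functions are expressed through \<open>kw\<close>; this avoids a positive
    lower bound for \<open>S s (\<Phi> x)\<close>.\<close>
  have Y: "bl D (\<lambda>x. 1 / (S s (\<Phi> x))\<^sup>2)" and W: "bl D (\<lambda>x. S' s (\<Phi> x) / S s (\<Phi> x))"
  proof -
    have "bl D (\<lambda>x. (kw (e x) (G x) (f x))\<^sup>2 + s)" by (intro I w)
    then show "bl D (\<lambda>x. 1 / (S s (\<Phi> x))\<^sup>2)"
      by (rule bl_cong) (simp add: \<Phi>_def kphi_facts(5)[OF kb(2)])
    show "bl D (\<lambda>x. S' s (\<Phi> x) / S s (\<Phi> x))"
      by (rule bl_cong[OF w]) (simp add: \<Phi>_def kphi_facts(4)[OF kb(2)])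
  qed
  have pab: "bl D (\<lambda>x. pa (\<Phi> x))" "bl D (\<lambda>x. pb (\<Phi> x))" "bl D (\<lambda>x. pa' (\<Phi> x))" "bl D (\<lambda>x. pb' (\<Phi> x))"
    unfolding pa_def pb_def pa'_def pb'_def na_def nb_def na'_def nb'_def
    by (intro I SS Y W)+
  have N2: "bl D (\<lambda>x. ?c - s * (G x)\<^sup>2)" by (intro I G)
  have N: "bl D (\<lambda>x. NN ?c (G x))"
    unfolding NN_def
  proof (rule bl_compose[where h = sqrt and h' = "\<lambda>y. inverse (sqrt y) / 2", OF N2 pb(1)])
    show "(sqrt has_real_derivative inverse (sqrt y) / 2) (at y)" if "\<delta>\<^sup>2 \<le> y" for y
    proof -
      have "0 < \<delta>\<^sup>2" using \<delta> by simp
      then have "0 < y" using that by linarith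
      then show ?thesis by (rule DERIV_real_sqrt)
    qed
    have "sqrt y \<noteq> 0" if "\<delta>\<^sup>2 \<le> y" for y using that \<delta> by (auto simp: power2_eq_square mult_le_0_iff)
    then show "continuous_on {\<delta>\<^sup>2..} (\<lambda>y. inverse (sqrt y) / 2)" by (intro continuous_intros) auto
  qed
  have iN: "bl D (\<lambda>x. 1 / NN ?c (G x))"
  proof (rule bl_inverse[OF N \<delta>])
    fix x assume "x \<in> D"
    from real_sqrt_le_mono[OF pb(1)[OF this]] show "\<delta> \<le> NN ?c (G x)" using \<delta> by (simp add: NN_def)
  qed
  note * = I pab trig G N iN iG ie e phi
  have Psi: "bl D (\<lambda>x. Psi ?c (\<Phi> x) (g x + f x) (G x))" unfolding Psi_def by (intro *)
  have Xi: "bl D (\<lambda>x. Xi ?c (\<Phi> x) (g x + f x) (G x))" unfolding Xi_def by (intro *)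
  have La: "bl D (\<lambda>x. La ?c (\<Phi> x) (g x + f x) (G x))" unfolding La_def La1_def by (intro *)
  note ** = * Psi[unfolded \<Phi>_def] Xi[unfolded \<Phi>_def] La[unfolded \<Phi>_def]
  have xi: "bl D (\<lambda>x. xi ?c (g x) (e x) (G x) (f x))" unfolding xi_def by (intro **)
  have eta: "bl D (\<lambda>x. eta ?c (g x) (e x) (G x) (f x))" unfolding eta_def by (intro **)
  have qq: "bl D (\<lambda>x. qq ?c (g x) (e x) (G x) (f x))" unfolding qq_def by (intro ** xi eta)
  have fdot: "bl D (\<lambda>x. fdot ?c (g x) (e x) (G x) (f x))" unfolding fdot_def knu_def by (intro ** qq w)
  show ifdot: "bl D (\<lambda>x. 1 / fdot ?c (g x) (e x) (G x) (f x))" by (rule bl_inverse[OF fdot k])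
  show "bl D (\<lambda>x. Vg ?c (g x) (e x) (G x) (f x))" unfolding Vg_def by (intro ** qq ifdot)
  show "bl D (\<lambda>x. Ve ?c (g x) (e x) (G x) (f x))" unfolding Ve_def by (intro ** xi eta ifdot)
  show "bl D (\<lambda>x. VG ?c (g x) (e x) (G x) (f x))" unfolding VG_def by (intro ** ifdot)
qed

section \<open>Shooting for a symmetric orbit\<close>

lemma cos_sin_2pi_int_diff:
  fixes x :: real
  shows "cos (2 * pi * of_int i - x) = cos x" "sin (2 * pi * of_int i - x) = - sin x"
  by (simp_all add: cos_diff sin_diff cos_int_2pin sin_int_2pin)

text \<open>Reversibility in the elements: \<open>Xi\<close> is odd in the angles,
  \<open>Psi\<close> and \<open>La\<close> are even. The multiples of \<open>2 * pi\<close> cover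
  both reflections to come, about \<open>f = 0\<close> with \<open>i = j = 0\<close> and about
  \<open>f = pi * m\<close> with \<open>i = m\<close>.\<close>

lemma (in two_body) field_reflect:
  fixes i j :: int
  shows "fdot c (2 * pi * j - g) e G (2 * pi * i - f) = fdot c g e G f"
    "Vg c (2 * pi * j - g) e G (2 * pi * i - f) = Vg c g e G f"
    "Ve c (2 * pi * j - g) e G (2 * pi * i - f) = - Ve c g e G f"
    "VG c (2 * pi * j - g) e G (2 * pi * i - f) = - VG c g e G f"
proof -
  have "2 * pi * j - g + (2 * pi * i - f) = 2 * pi * of_int (i + j) - (g + f)" by (simp add: algebra_simps)
  then have \<theta>: "cos (2 * pi * j - g + (2 * pi * i - f)) = cos (g + f)"
    "sin (2 * pi * j - g + (2 * pi * i - f)) = - sin (g + f)"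
    by (simp_all only: cos_sin_2pi_int_diff)
  note f = cos_sin_2pi_int_diff[of i f]
  have kw: "kw e G (2 * pi * i - f) = kw e G f" by (simp only: kw_def f)
  then have k: "kphi e G (2 * pi * i - f) = kphi e G f" "knu e G (2 * pi * i - f) = knu e G f"
    by (simp_all add: kphi_def knu_def)
  let ?f = "2 * pi * i - f" and ?g = "2 * pi * j - g"
  have Xi: "Xi c \<phi> (?g + ?f) G = - Xi c \<phi> (g + f) G" for \<phi> unfolding Xi_def \<theta> by simp
  have Psi: "Psi c \<phi> (?g + ?f) G = Psi c \<phi> (g + f) G" for \<phi> unfolding Psi_def \<theta> ..
  have La: "La c \<phi> (?g + ?f) G = La c \<phi> (g + f) G" for \<phi> unfolding La_def La1_def \<theta> ..
  have xi: "xi c ?g e G ?f = - xi c g e G f" unfolding xi_def Xi k f by simp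
  have eta: "eta c ?g e G ?f = eta c g e G f" unfolding eta_def Xi Psi k f by simp
  have qq: "qq c ?g e G ?f = qq c g e G f" unfolding qq_def xi eta f by simp
  show fd: "fdot c ?g e G ?f = fdot c g e G f" unfolding fdot_def qq k ..
  show "Vg c ?g e G ?f = Vg c g e G f" unfolding Vg_def fd La qq k ..
  show "Ve c ?g e G ?f = - Ve c g e G f" 
  proof -
    have "(- x * k + y * (- z)) * w = - ((x * k + y * z) * w)" for x y z k w :: real
      by (simp add: algebra_simps)
    then show ?thesis unfolding Ve_def fd xi eta f .
  qed
  show "VG c ?g e G ?f = - VG c g e G f" unfolding VG_def fd Xi k by simp
qed

section \<open>The clamped system with the true anomaly as time\<close>

locale shooting = two_body +
  fixes \<gamma> \<delta> \<epsilon> k0 :: real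
  assumes \<gamma>: "0 < \<gamma>" "\<gamma> \<le> 1 / 4" and \<delta>: "\<delta> > 0" and small: "32 * \<delta>\<^sup>2 \<le> M\<^sup>2 * \<rho>" and k0: "k0 > 0"
    and fdot_ge: "\<And>e G g f. box \<gamma> \<delta> e G \<Longrightarrow> k0 \<le> fdot (5 * \<delta>\<^sup>2) g e G f"
    and Ve_le: "\<And>e G g f. box \<gamma> \<delta> e G \<Longrightarrow> \<bar>Ve (5 * \<delta>\<^sup>2) g e G f\<bar> \<le> \<epsilon> * \<delta> ^ 4"
    and VG_le: "\<And>e G g f. box \<gamma> \<delta> e G \<Longrightarrow> \<bar>VG (5 * \<delta>\<^sup>2) g e G f\<bar> \<le> \<epsilon> * \<delta> ^ 5"
    and Vg_ge: "\<And>e G g f. box \<gamma> \<delta> e G \<Longrightarrow> \<kappa>1 * G ^ 4 \<le> - s * Vg (5 * \<delta>\<^sup>2) g e G f"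
    and Vg_le: "\<And>e G g f. box \<gamma> \<delta> e G \<Longrightarrow> - s * Vg (5 * \<delta>\<^sup>2) g e G f \<le> \<kappa>2 * G ^ 4"
begin

text \<open>Clamping extends the field from the box to the whole space and keeps its bounds. The
  extension is bounded and globally Lipschitz, so its solutions exist for all \<open>f\<close>;
  inside the box nothing is changed.\<close>

definition ce :: "real \<Rightarrow> real" where "ce e = max (1 / 4) (min (3 / 4) e)"
definition cG :: "real \<Rightarrow> real" where "cG G = max (\<gamma> * \<delta>) (min (2 * \<delta>) G)"

lemma box_clamp: "box \<gamma> \<delta> (ce e) (cG G)"
proof -
  have "\<gamma> * \<delta> \<le> 2 * \<delta>" using \<gamma> \<delta> by (intro mult_right_mono) auto
  then show ?thesis by (auto simp: box_def ce_def cG_def)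
qed

lemma clamp_id: "box \<gamma> \<delta> e G \<Longrightarrow> ce e = e" "box \<gamma> \<delta> e G \<Longrightarrow> cG G = G"
  by (auto simp: box_def ce_def cG_def)

definition W :: "real \<Rightarrow> real \<times> real \<times> real \<Rightarrow> real \<times> real \<times> real" where
  "W t y = (Vg (5 * \<delta>\<^sup>2) (fst y) (ce (fst (snd y))) (cG (snd (snd y))) t,
            Ve (5 * \<delta>\<^sup>2) (fst y) (ce (fst (snd y))) (cG (snd (snd y))) t,
            VG (5 * \<delta>\<^sup>2) (fst y) (ce (fst (snd y))) (cG (snd (snd y))) t)"

lemma bl_clamped:
  defines "D \<equiv> UNIV :: (real \<times> real \<times> real \<times> real) set"
    and "v \<equiv> \<lambda>V x. V (5 * \<delta>\<^sup>2) (fst (snd x)) (ce (fst (snd (snd x)))) (cG (snd (snd (snd x)))) (fst x)"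
  shows "bl D (v Vg)" "bl D (v Ve)" "bl D (v VG)" "bl D (\<lambda>x. 1 / v fdot x)"
proof -
  have d: "dist (fst (snd x)) (fst (snd y)) \<le> dist x y"
    "dist (fst (snd (snd x))) (fst (snd (snd y))) \<le> dist x y"
    "dist (snd (snd (snd x))) (snd (snd (snd y))) \<le> dist x y" for x y :: "real \<times> real \<times> real \<times> real"
    by (rule order_trans[OF dist_fst_le dist_snd_le],
        rule order_trans[OF dist_fst_le order_trans[OF dist_snd_le dist_snd_le]],
        rule order_trans[OF dist_snd_le order_trans[OF dist_snd_le dist_snd_le]])
  have p: "1-lipschitz_on D fst" "1-lipschitz_on D (\<lambda>x. fst (snd x))"
    "1-lipschitz_on D (\<lambda>x. fst (snd (snd x)))" "1-lipschitz_on D (\<lambda>x. snd (snd (snd x)))"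
    by (rule lipschitz_onI; simp only: mult_1 zero_le_one d dist_fst_le)+
  have clamp: "bl D (\<lambda>x. max a (min b (F x)))" if F: "1-lipschitz_on D F" for F and a b :: real
  proof (rule blI)
    show "1-lipschitz_on D (\<lambda>x. max a (min b (F x)))"
    proof (rule lipschitz_onI)
      fix x y assume "x \<in> D" "y \<in> D"
      then have "dist (F x) (F y) \<le> 1 * dist x y" by (rule lipschitz_onD[OF F])
      moreover have "dist (max a (min b (F x))) (max a (min b (F y))) \<le> dist (F x) (F y)"
        by (auto simp: dist_real_def max_def min_def)
      ultimately show "dist (max a (min b (F x))) (max a (min b (F y))) \<le> 1 * dist x y" by linarith
    qed simp
    show "\<bar>max a (min b (F x))\<bar> \<le> \<bar>a\<bar> + \<bar>b\<bar>" for x by (auto simp: max_def min_def)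
  qed
  have c: "bl D (\<lambda>x. ce (fst (snd (snd x))))" "bl D (\<lambda>x. cG (snd (snd (snd x))))"
    unfolding ce_def cG_def by (intro clamp p)+
  show "bl D (v Vg)" "bl D (v Ve)" "bl D (v VG)" "bl D (\<lambda>x. 1 / v fdot x)"
    unfolding v_def by (rule bl_field[OF p(1,2) c box_clamp \<gamma>(1) \<delta> small k0 fdot_ge[OF box_clamp]])+
qed

lemma W_bounded_lipschitz:
  obtains L B where "L > 0" "\<And>t x y. norm (W t x - W t y) \<le> L * norm (x - y)"
    "\<And>t x. norm (W t x) \<le> B" "continuous_on UNIV (\<lambda>(t, x). W t x)"
proof -
  let ?D = "UNIV :: (real \<times> real \<times> real \<times> real) set"
  let ?V = "\<lambda>V x. V (5 * \<delta>\<^sup>2) (fst (snd x)) (ce (fst (snd (snd x)))) (cG (snd (snd (snd x)))) (fst x)"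
  note V = bl_clamped
  obtain B1 L1 where 1: "\<And>x. \<bar>?V Vg x\<bar> \<le> B1" "L1-lipschitz_on ?D (?V Vg)" using V(1) by (auto elim!: blE)
  obtain B2 L2 where 2: "\<And>x. \<bar>?V Ve x\<bar> \<le> B2" "L2-lipschitz_on ?D (?V Ve)" using V(2) by (auto elim!: blE)
  obtain B3 L3 where 3: "\<And>x. \<bar>?V VG x\<bar> \<le> B3" "L3-lipschitz_on ?D (?V VG)" using V(3) by (auto elim!: blE)
  define L where "L = sqrt (L1\<^sup>2 + (sqrt (L2\<^sup>2 + L3\<^sup>2))\<^sup>2)"
  have lip: "L-lipschitz_on ?D (\<lambda>x. W (fst x) (snd x))"
    unfolding W_def L_def by (intro lipschitz_on_Pair 1 2 3)
  have L: "L \<ge> 0" by (rule lipschitz_on_nonneg[OF lip])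
  show ?thesis
  proof (rule that)
    show "L + 1 > 0" using L by simp
    show "norm (W t x - W t y) \<le> (L + 1) * norm (x - y)" for t x y
    proof -
      have "norm (W t x - W t y) \<le> L * norm (x - y)"
        using lipschitz_onD[OF lip, of "(t, x)" "(t, y)"] by (simp add: dist_Pair_Pair dist_norm)
      then show ?thesis using norm_ge_zero[of "x - y"] by (simp only: distrib_right)
    qed
    show "norm (W t x) \<le> B1 + (B2 + B3)" for t x
      unfolding W_def using 1(1)[of "(t, x)"] 2(1)[of "(t, x)"] 3(1)[of "(t, x)"]
      by (intro order_trans[OF norm_Pair_le] add_mono) auto
    show "continuous_on UNIV (\<lambda>(t, x). W t x)"
      using lipschitz_on_continuous_on[OF lip] by (simp add: case_prod_unfold)
  qed
qed

definition sol :: "(real \<Rightarrow> real \<times> real \<times> real) \<Rightarrow> bool" where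
  "sol y \<longleftrightarrow> (\<forall>t. (y has_vector_derivative W t (y t)) (at t))"

lemma sol_exists: "\<exists>y. sol y \<and> y 0 = y0"
proof -
  obtain L B where "L > 0" "\<And>t x y. norm (W t x - W t y) \<le> L * norm (x - y)"
    "\<And>t x. norm (W t x) \<le> B" "continuous_on UNIV (\<lambda>(t, x). W t x)"
    by (rule W_bounded_lipschitz) blast
  from picard_lindelof[OF this(4,1,2,3), of y0] show ?thesis by (auto simp: sol_def)
qed

lemma sol_gronwall:
  "\<exists>L. \<forall>y z t. sol y \<longrightarrow> sol z \<longrightarrow> norm (y t - z t) \<le> norm (y t0 - z t0) * exp (L * \<bar>t - t0\<bar>)"
proof -
  obtain L where L: "\<And>t x y. norm (W t x - W t y) \<le> L * norm (x - y)"
    by (rule W_bounded_lipschitz) blast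
  have "norm (y t - z t) \<le> norm (y t0 - z t0) * exp (L * \<bar>t - t0\<bar>)" if "sol y" "sol z" for y z t
    by (rule gronwall[of y W z L]) (use that L in \<open>simp_all only: sol_def\<close>)
  then show ?thesis by blast
qed

lemma sol_unique:
  assumes "sol y" "sol z" "y a = z a"
  shows "y t = z t"
proof -
  obtain L where "norm (y t - z t) \<le> norm (y a - z a) * exp (L * \<bar>t - a\<bar>)"
    using sol_gronwall[of a] assms(1,2) by blast
  then show ?thesis using assms(3) by simp
qed

lemma sol_components:
  assumes "sol y"
  shows "((\<lambda>t. fst (y t)) has_real_derivative fst (W t (y t))) (at t)"
    "((\<lambda>t. fst (snd (y t))) has_real_derivative fst (snd (W t (y t)))) (at t)"
    "((\<lambda>t. snd (snd (y t))) has_real_derivative snd (snd (W t (y t)))) (at t)"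
proof -
  have y: "(y has_vector_derivative W t (y t)) (at t)" using assms by (simp add: sol_def)
  note f = bounded_linear.has_vector_derivative[OF bounded_linear_fst]
    and s = bounded_linear.has_vector_derivative[OF bounded_linear_snd]
  show "((\<lambda>t. fst (y t)) has_real_derivative fst (W t (y t))) (at t)"
    "((\<lambda>t. fst (snd (y t))) has_real_derivative fst (snd (W t (y t)))) (at t)"
    "((\<lambda>t. snd (snd (y t))) has_real_derivative snd (snd (W t (y t)))) (at t)"
    unfolding has_real_derivative_iff_has_vector_derivative
    using f[OF y] f[OF s[OF y]] s[OF s[OF y]] by auto
qed

lemma sol_reflect:
  fixes i j :: int
  assumes "sol y"
  defines "u \<equiv> \<lambda>t. 2 * pi * of_int i - t"
  shows "sol (\<lambda>t. (2 * pi * of_int j - fst (y (u t)), fst (snd (y (u t))), snd (snd (y (u t)))))" (is "sol ?z")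
  unfolding sol_def
proof
  fix t
  have u: "(u has_real_derivative -1) (at t)" unfolding u_def by (auto intro!: derivative_eq_intros)
  note d = DERIV_chain2[OF sol_components(1)[OF assms(1)] u] DERIV_chain2[OF sol_components(2)[OF assms(1)] u]
    DERIV_chain2[OF sol_components(3)[OF assms(1)] u]
  have t: "t = 2 * pi * of_int i - u t" by (simp add: u_def)
  have "W t (?z t) = W (2 * pi * of_int i - u t) (?z t)" by (simp add: u_def)
  also have "\<dots> = (fst (W (u t) (y (u t))), - fst (snd (W (u t) (y (u t)))), - snd (snd (W (u t) (y (u t)))))"
    unfolding W_def fst_conv snd_conv field_reflect ..
  finally have W: "W t (?z t) = \<dots>" .
  have "((\<lambda>t. 2 * pi * of_int j - fst (y (u t))) has_real_derivative fst (W (u t) (y (u t)))) (at t)"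
    using DERIV_diff[OF DERIV_const d(1), of "2 * pi * of_int j"] by simp
  then show "(?z has_vector_derivative W t (?z t)) (at t)"
    unfolding W has_real_derivative_iff_has_vector_derivative
    using d(2,3) by (intro has_vector_derivative_Pair)
      (simp_all add: has_real_derivative_iff_has_vector_derivative)
qed

text \<open>The clamped field obeys the bounds everywhere, so no solution has to be known to stay in
  the box. This removes the circularity in proving that it does stay there.\<close>

lemma sol_drift:
  assumes y: "sol y" and t: "0 \<le> t"
  shows "\<bar>fst (snd (y t)) - fst (snd (y 0))\<bar> \<le> \<epsilon> * \<delta> ^ 4 * t"
    and "\<bar>snd (snd (y t)) - snd (snd (y 0))\<bar> \<le> \<epsilon> * \<delta> ^ 5 * t"
proof -
  have mv: "\<bar>f t - f 0\<bar> \<le> B * t"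
    if "\<And>u. (f has_real_derivative f' u) (at u)" "\<And>u. \<bar>f' u\<bar> \<le> B" for f f' :: "real \<Rightarrow> real" and B
    using field_differentiable_bound[of UNIV f f' B t 0] that t by auto
  show "\<bar>fst (snd (y t)) - fst (snd (y 0))\<bar> \<le> \<epsilon> * \<delta> ^ 4 * t"
    by (rule mv[OF sol_components(2)[OF y]]) (simp add: W_def Ve_le box_clamp)
  show "\<bar>snd (snd (y t)) - snd (snd (y 0))\<bar> \<le> \<epsilon> * \<delta> ^ 5 * t"
    by (rule mv[OF sol_components(3)[OF y]]) (simp add: W_def VG_le box_clamp)
qed

text \<open>Mean value theorem. The factor \<open>- s\<close> makes the angle positive for both
  signs of the curvature.\<close>

lemma sol_precession:
  assumes y: "sol y" "fst (y 0) = 0" and t: "0 \<le> t"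
    and ab: "\<And>u. 0 \<le> u \<Longrightarrow> u \<le> t \<Longrightarrow> a \<le> cG (snd (snd (y u))) \<and> cG (snd (snd (y u))) \<le> b" and a: "a \<ge> 0"
  shows "\<kappa>1 * a ^ 4 * t \<le> - s * fst (y t)" "- s * fst (y t) \<le> \<kappa>2 * b ^ 4 * t"
proof -
  have "\<kappa>1 * a ^ 4 * t \<le> - s * fst (y t) \<and> - s * fst (y t) \<le> \<kappa>2 * b ^ 4 * t"
  proof (cases "t = 0")
    case False
    have d: "((\<lambda>u. - s * fst (y u)) has_real_derivative - s * fst (W u (y u))) (at u)" for u
      by (intro DERIV_cmult sol_components y)
    obtain u where u: "0 < u" "u < t" "- s * fst (y t) - (- s * fst (y 0)) = (t - 0) * (- s * fst (W u (y u)))"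
      using MVT2[of 0 t "\<lambda>u. - s * fst (y u)" "\<lambda>u. - s * fst (W u (y u))"] d t False by auto
    let ?G = "cG (snd (snd (y u)))"
    have G: "a \<le> ?G" "?G \<le> b" using ab[of u] u by auto
    have \<kappa>: "\<kappa>1 \<ge> 0" "\<kappa>2 \<ge> 0" using M by (auto simp: \<kappa>1_def \<kappa>2_def)
    have "\<kappa>1 * a ^ 4 \<le> \<kappa>1 * ?G ^ 4" "\<kappa>2 * ?G ^ 4 \<le> \<kappa>2 * b ^ 4"
      using G a \<kappa> by (auto intro!: mult_left_mono power_mono)
    then have "\<kappa>1 * a ^ 4 \<le> - s * fst (W u (y u))" "- s * fst (W u (y u)) \<le> \<kappa>2 * b ^ 4"
      unfolding W_def fst_conv by - (erule order_trans[OF _ Vg_ge[OF box_clamp]], erule order_trans[OF Vg_le[OF box_clamp]])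
    then have "t * (\<kappa>1 * a ^ 4) \<le> t * (- s * fst (W u (y u)))" "t * (- s * fst (W u (y u))) \<le> t * (\<kappa>2 * b ^ 4)"
      using t by - (erule mult_left_mono, assumption)+
    moreover have "- s * fst (y t) = t * (- s * fst (W u (y u)))"
      using u(3) by (simp only: y(2) mult_zero_right diff_zero)
    ultimately show ?thesis by (simp only: mult.commute[of _ t])
  qed (use y in simp)
  then show "\<kappa>1 * a ^ 4 * t \<le> - s * fst (y t)" "- s * fst (y t) \<le> \<kappa>2 * b ^ 4 * t" by auto
qed

text \<open>The precession grows like \<open>G ^ 4\<close>. Started at
  \<open>2 * \<gamma> * \<delta>\<close>, \<open>G\<close> stays below
  \<open>3 * \<gamma> * \<delta>\<close> and the angle falls short of \<open>z\<close>; started at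
  \<delta>, \<open>G\<close> stays above \<open>\<delta> / 2\<close> and the angle reaches
  \<open>z\<close>. The allowed drift \<open>\<gamma> / 4\<close> of \<open>e\<close>, and
  \<open>\<gamma> / 4 * \<delta>\<close> of \<open>G\<close>, keeps all these solutions in the
  box.\<close>

lemma shoot:
  assumes \<tau>: "\<tau> \<ge> 0" and drift: "\<epsilon> * \<delta> ^ 4 * \<tau> \<le> \<gamma> / 4"
    and lo: "\<kappa>2 * (3 * \<gamma> * \<delta>) ^ 4 * \<tau> \<le> z" and up: "z \<le> \<kappa>1 * (\<delta> / 2) ^ 4 * \<tau>"
  obtains y G0 where "sol y" "y 0 = (0, 1 / 2, G0)" "- s * fst (y \<tau>) = z"
    "\<And>t. 0 \<le> t \<Longrightarrow> t \<le> \<tau> \<Longrightarrow> box \<gamma> \<delta> (fst (snd (y t))) (snd (snd (y t)))"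
proof -
  obtain Y where Y: "\<And>a. sol (Y a)" "\<And>a. Y a 0 = (0, 1 / 2, a)"
    using sol_exists[of "(0, 1 / 2, a)" for a] by metis
  have drift_e: "\<bar>fst (snd (Y a t)) - 1 / 2\<bar> \<le> \<gamma> / 4" and drift_G: "\<bar>snd (snd (Y a t)) - a\<bar> \<le> \<gamma> / 4 * \<delta>"
    if "0 \<le> t" "t \<le> \<tau>" for a t
  proof -
    have \<epsilon>: "\<epsilon> * \<delta> ^ 4 \<ge> 0" using order_trans[OF abs_ge_zero Ve_le[OF box_clamp]] .
    then have "\<epsilon> * \<delta> ^ 4 * t \<le> \<epsilon> * \<delta> ^ 4 * \<tau>" using that by (intro mult_left_mono)
    then have le: "\<epsilon> * \<delta> ^ 4 * t \<le> \<gamma> / 4" using drift by linarith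
    then show "\<bar>fst (snd (Y a t)) - 1 / 2\<bar> \<le> \<gamma> / 4"
      using sol_drift(1)[OF Y(1) that(1), of a] by (simp add: Y)
    have "\<epsilon> * \<delta> ^ 5 * t = \<epsilon> * \<delta> ^ 4 * t * \<delta>" by (simp add: eval_nat_numeral)
    also have "\<dots> \<le> \<gamma> / 4 * \<delta>" using le \<delta> by (intro mult_right_mono) auto
    finally show "\<bar>snd (snd (Y a t)) - a\<bar> \<le> \<gamma> / 4 * \<delta>"
      using sol_drift(2)[OF Y(1) that(1), of a] by (simp add: Y)
  qed
  have \<gamma>\<delta>: "0 < \<gamma> * \<delta>" "\<gamma> * \<delta> \<le> \<delta> / 4" using \<gamma> \<delta> mult_right_mono[OF \<gamma>(2), of \<delta>] by auto
  have inbox: "box \<gamma> \<delta> (fst (snd (Y a t))) (snd (snd (Y a t)))"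
    if "0 \<le> t" "t \<le> \<tau>" "2 * \<gamma> * \<delta> \<le> a" "a \<le> \<delta>" for a t
  proof -
    have "- (\<gamma> / 4) \<le> fst (snd (Y a t)) - 1 / 2" "fst (snd (Y a t)) - 1 / 2 \<le> \<gamma> / 4"
      using drift_e[OF that(1,2), of a] by linarith+
    moreover have "- (\<gamma> / 4 * \<delta>) \<le> snd (snd (Y a t)) - a" "snd (snd (Y a t)) - a \<le> \<gamma> / 4 * \<delta>"
      using drift_G[OF that(1,2), of a] by linarith+
    ultimately show ?thesis using that(3,4) \<gamma> \<gamma>\<delta> unfolding box_def by auto
  qed
  define \<Gamma> where "\<Gamma> a = - s * fst (Y a \<tau>)" for a
  obtain L where L: "\<And>y z. sol y \<Longrightarrow> sol z \<Longrightarrow> norm (y \<tau> - z \<tau>) \<le> norm (y 0 - z 0) * exp (L * \<bar>\<tau> - 0\<bar>)"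
    using sol_gronwall[of 0] by blast
  \<comment> \<open>Gronwall's bound at the fixed end point \<tau>; with time as independent
    variable the end point would itself depend on \<open>a\<close>.\<close>
  have "(exp (L * \<bar>\<tau>\<bar>))-lipschitz_on {2 * \<gamma> * \<delta>..\<delta>} \<Gamma>"
  proof (rule lipschitz_onI)
    fix a b
    have "dist (\<Gamma> a) (\<Gamma> b) = \<bar>fst (Y a \<tau> - Y b \<tau>)\<bar>"
      using s by (auto simp: \<Gamma>_def dist_real_def)
    also have "\<dots> \<le> norm (Y a \<tau> - Y b \<tau>)" using norm_fst_le[of "fst (Y a \<tau> - Y b \<tau>)" "snd (Y a \<tau> - Y b \<tau>)"]
      by (simp only: prod.collapse real_norm_def)
    also have "\<dots> \<le> norm (Y a 0 - Y b 0) * exp (L * \<bar>\<tau>\<bar>)" using L[OF Y(1) Y(1), of a b] by simp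
    also have "norm (Y a 0 - Y b 0) = dist a b" by (simp add: Y norm_Pair dist_real_def)
    finally show "dist (\<Gamma> a) (\<Gamma> b) \<le> exp (L * \<bar>\<tau>\<bar>) * dist a b" by (simp add: mult.commute)
  qed simp
  then have "continuous_on {2 * \<gamma> * \<delta>..\<delta>} \<Gamma>" by (rule lipschitz_on_continuous_on)
  moreover have "\<Gamma> (2 * \<gamma> * \<delta>) \<le> z"
  proof -
    have "\<Gamma> (2 * \<gamma> * \<delta>) \<le> \<kappa>2 * (3 * \<gamma> * \<delta>) ^ 4 * \<tau>"
      unfolding \<Gamma>_def
    proof (rule sol_precession(2)[OF Y(1) _ \<tau>])
      fix u assume u: "0 \<le> u" "u \<le> \<tau>"
      have "snd (snd (Y (2 * \<gamma> * \<delta>) u)) \<le> 3 * \<gamma> * \<delta>"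
        using drift_G[OF u, of "2 * \<gamma> * \<delta>"] \<gamma>\<delta> by linarith
      moreover have "\<gamma> * \<delta> \<le> 3 * \<gamma> * \<delta>" using \<gamma>\<delta> by linarith
      moreover have "0 \<le> \<gamma> * \<delta>" using \<gamma>\<delta> by linarith
      ultimately show "0 \<le> cG (snd (snd (Y (2 * \<gamma> * \<delta>) u))) \<and> cG (snd (snd (Y (2 * \<gamma> * \<delta>) u))) \<le> 3 * \<gamma> * \<delta>"
        unfolding cG_def by (intro conjI max.boundedI min.coboundedI2 max.coboundedI1)
    qed (auto simp: Y)
    then show ?thesis using lo by linarith
  qed
  moreover have "z \<le> \<Gamma> \<delta>"
  proof -
    have "\<kappa>1 * (\<delta> / 2) ^ 4 * \<tau> \<le> \<Gamma> \<delta>"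
      unfolding \<Gamma>_def
    proof (rule sol_precession(1)[OF Y(1) _ \<tau>])
      fix u assume u: "0 \<le> u" "u \<le> \<tau>"
      show "\<delta> / 2 \<le> cG (snd (snd (Y \<delta> u))) \<and> cG (snd (snd (Y \<delta> u))) \<le> 2 * \<delta>"
      proof -
        have "\<delta> / 2 \<le> snd (snd (Y \<delta> u))" using drift_G[OF u, of \<delta>] \<gamma>\<delta> by linarith
        moreover have "\<gamma> * \<delta> \<le> 2 * \<delta>" "\<delta> / 2 \<le> 2 * \<delta>" using \<gamma>\<delta> \<delta> by linarith+
        ultimately show ?thesis
          unfolding cG_def by (intro conjI max.boundedI min.coboundedI1 order.refl max.coboundedI2 min.boundedI)
      qed
    qed (use \<delta> in \<open>auto simp: Y\<close>)
    then show ?thesis using up by linarith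
  qed
  moreover have "2 * \<gamma> * \<delta> \<le> \<delta>" using \<gamma>\<delta> by linarith
  ultimately obtain a where a: "2 * \<gamma> * \<delta> \<le> a" "a \<le> \<delta>" "\<Gamma> a = z"
    using IVT'[of \<Gamma> "2 * \<gamma> * \<delta>" z \<delta>] by blast
  show ?thesis
    by (rule that[OF Y(1) Y(2)[of a]]) (use a inbox in \<open>auto simp: \<Gamma>_def\<close>)
qed

text \<open>
  The reflections at \<open>f = 0\<close> and \<open>f = \<pi> m\<close> preserve the solution; their composition is the
  translation by a period.
\<close>

lemma periodic_elements:
  fixes m :: nat and j :: int
  assumes y: "sol y" and m: "m > 0" and 0: "fst (y 0) = 0" and \<tau>: "fst (y (pi * real m)) = pi * of_int j"
    and b: "\<And>t. 0 \<le> t \<Longrightarrow> t \<le> pi * real m \<Longrightarrow> box \<gamma> \<delta> (fst (snd (y t))) (snd (snd (y t)))"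
  shows "fst (y (t + 2 * pi * real m)) = fst (y t) + 2 * pi * of_int j"
    "snd (y (t + 2 * pi * real m)) = snd (y t)"
    "box \<gamma> \<delta> (fst (snd (y t))) (snd (snd (y t)))"
proof -
  \<comment> \<open>Each reflected solution agrees with \<open>y\<close> at the centre of the
    reflection, by the hypotheses on \<open>g\<close> at 0 and at \<open>pi * m\<close>, and
    therefore everywhere.\<close>
  have r0: "y t = (- fst (y (- t)), snd (y (- t)))" for t
    using sol_unique[OF y sol_reflect[OF y, of 0 0], of 0 t] 0 by (simp add: prod_eq_iff)
  have rm: "y t = (2 * pi * of_int j - fst (y (2 * pi * real m - t)), snd (y (2 * pi * real m - t)))" for t
    using sol_unique[OF y sol_reflect[OF y, where i = "int m" and j = j], of "pi * real m" t] \<tau> by (simp add: prod_eq_iff)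
  show per: "fst (y (t + 2 * pi * real m)) = fst (y t) + 2 * pi * of_int j"
    "snd (y (t + 2 * pi * real m)) = snd (y t)" for t
    using rm[of "t + 2 * pi * real m"] r0[of "- t"] by (auto simp: prod_eq_iff)
  interpret P: periodic_fun_simple "\<lambda>t. snd (y t)" "2 * pi * real m"
    by unfold_locales (rule per)
  define Q where "Q = 2 * pi * real m"
  have Q: "Q > 0" using m by (simp add: Q_def)
  define r where "r = t - of_int \<lfloor>t / Q\<rfloor> * Q"
  have r: "0 \<le> r" "r < Q"
    using floor_divide_lower[OF Q, of t] floor_divide_upper[OF Q, of t] by (auto simp: r_def algebra_simps)
  have "snd (y t) = snd (y r)" unfolding r_def Q_def by (rule P.minus_of_int[symmetric])
  moreover have "box \<gamma> \<delta> (fst (snd (y r))) (snd (snd (y r)))"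
  proof (cases "r \<le> pi * real m")
    case True then show ?thesis using b r by simp
  next
    \<comment> \<open>The second half of the period is the mirror image of the first about
      \<open>pi * m\<close>.\<close>
    case False
    then show ?thesis using b[of "Q - r"] r rm[of r] by (simp add: Q_def)
  qed
  ultimately show "box \<gamma> \<delta> (fst (snd (y t))) (snd (snd (y t)))" by simp
qed

text \<open>The conditions concern half a period, in which \<open>f\<close> runs to
  \<open>pi * m\<close> and the pericenter turns by \<open>pi * n\<close>; reflection doubles both.
  It remains to return from true anomaly to time.\<close>

lemma periodic_orbit:
  fixes m n :: nat
  assumes m: "m > 0" and drift: "\<epsilon> * \<delta> ^ 4 * (pi * real m) \<le> \<gamma> / 4"
    and lo: "\<kappa>2 * (3 * \<gamma> * \<delta>) ^ 4 * (pi * real m) \<le> pi * real n"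
    and up: "pi * real n \<le> \<kappa>1 * (\<delta> / 2) ^ 4 * (pi * real m)"
  shows "\<exists>c x T l g.
           reduced_motion s \<rho> m1 m2 c x \<and> has_period x T \<and>
           delaunay_lift s \<rho> M x T l g \<and>
           l T - l 0 = 2 * pi * real m \<and>
           \<bar>g T - g 0\<bar> = 2 * pi * real n"
proof -
  let ?c = "5 * \<delta>\<^sup>2" and ?P = "2 * pi * real m"
  have \<tau>: "0 \<le> pi * real m" by simp
  obtain y G0 where y: "sol y" and y0: "y 0 = (0, 1 / 2, G0)" and yz: "- s * fst (y (pi * real m)) = pi * real n"
    and b: "\<And>t. 0 \<le> t \<Longrightarrow> t \<le> pi * real m \<Longrightarrow> box \<gamma> \<delta> (fst (snd (y t))) (snd (snd (y t)))"
    using shoot[OF \<tau> drift lo up] by metis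
  \<comment> \<open>The signed number of turns: the precession is retrograde on the sphere and
    direct on the hyperbolic plane.\<close>
  obtain j :: int where j: "fst (y (pi * real m)) = pi * of_int j" "\<bar>real_of_int j\<bar> = real n"
  proof (cases "s = 1")
    case True then show ?thesis using yz that[of "- int n"] by simp
  next
    case False then show ?thesis using yz s that[of "int n"] by simp
  qed
  define g e G where "g t = fst (y t)" and "e t = fst (snd (y t))" and "G t = snd (snd (y t))" for t
  have g0: "fst (y 0) = 0" by (simp add: y0)
  note pe = periodic_elements[OF y m g0 j(1) b]
  have per: "g (t + ?P) = g t + 2 * pi * of_int j" "e (t + ?P) = e t" "G (t + ?P) = G t"
    and box: "box \<gamma> \<delta> (e t) (G t)" for t
    using pe[of t] by (auto simp: g_def e_def G_def)
  have con: "conic (e t) (G t)" and cG: "?c - s * (G t)\<^sup>2 > 0" for t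
  proof -
    show "conic (e t) (G t)" by (rule kepler_box[OF box \<gamma>(1) \<delta> small])
    have "0 < \<delta>\<^sup>2" using \<delta> by simp
    also have "\<dots> \<le> ?c - s * (G t)\<^sup>2" by (rule perturbation_bounds[OF box \<gamma>(1) \<delta> small])
    finally show "?c - s * (G t)\<^sup>2 > 0" .
  qed
  have Wt: "W t (y t) = (Vg ?c (g t) (e t) (G t) t, Ve ?c (g t) (e t) (G t) t, VG ?c (g t) (e t) (G t) t)" for t
    unfolding W_def using clamp_id[OF box[of t]] by (simp add: g_def e_def G_def)
  have dg: "(g has_real_derivative Vg ?c (g t) (e t) (G t) t) (at t)"
    and de: "(e has_real_derivative Ve ?c (g t) (e t) (G t) t) (at t)"
    and dG: "(G has_real_derivative VG ?c (g t) (e t) (G t) t) (at t)" for t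
    using sol_components[OF y, of t] unfolding Wt by (simp_all add: g_def[abs_def] e_def[abs_def] G_def[abs_def])
  \<comment> \<open>The rate of \<open>f\<close> as a function of \<open>f\<close> itself. The
    integral \<open>I\<close> of \<open>1 / h\<close> is physical time, and its inverse
    \<open>\<Theta>\<close> is the true anomaly as a function of time.\<close>
  define h where "h t = fdot ?c (g t) (e t) (G t) t" for t
  have h: "h t > 0" for t unfolding h_def using fdot_ge[OF box] k0 by (rule less_le_trans[rotated])
  have cont: "continuous_on A g" "continuous_on A e" "continuous_on A G" for A
    using dg de dG by (auto intro!: continuous_at_imp_continuous_on intro: DERIV_isCont)
  have trig: "cos (t + ?P) = cos t" "sin (t + ?P) = sin t"
    "cos (t + ?P + 2 * pi * of_int i) = cos t" "sin (t + ?P + 2 * pi * of_int i) = sin t" for t and i :: int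
  proof -
    have "cos (t + 2 * pi * of_int i) = cos t" "sin (t + 2 * pi * of_int i) = sin t" for t and i :: int
      by (simp_all add: cos_add sin_add cos_int_2pin sin_int_2pin)
    from this[of t "int m"] this[of "t + ?P" i]
    show "cos (t + ?P) = cos t" "sin (t + ?P) = sin t"
      "cos (t + ?P + 2 * pi * of_int i) = cos t" "sin (t + ?P + 2 * pi * of_int i) = sin t" by simp_all
  qed
  have kper: "kw e' G' (t + ?P) = kw e' G' t" "kp e' G' (t + ?P) = kp e' G' t" "knu e' G' (t + ?P) = knu e' G' t"
    "kphi e' G' (t + ?P) = kphi e' G' t" for e' G' t
    by (simp_all add: kw_def kp_def knu_def kphi_def trig)
  have hper: "h (t + ?P) = h t" for t
  proof -
    have a: "g (t + ?P) + (t + ?P) = (g t + t) + ?P + 2 * pi * of_int j" by (simp add: per)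
    have Xi: "Xi ?c \<phi> (g (t + ?P) + (t + ?P)) G' = Xi ?c \<phi> (g t + t) G'"
      and Psi: "Psi ?c \<phi> (g (t + ?P) + (t + ?P)) G' = Psi ?c \<phi> (g t + t) G'" for \<phi> G'
      unfolding a Xi_def Psi_def trig by simp_all
    show ?thesis
      unfolding h_def fdot_def qq_def xi_def eta_def Xi Psi per(2,3) kper trig by simp
  qed
  have conth: "continuous_on UNIV (\<lambda>t. 1 / h t)"
  proof -
    obtain L where "L-lipschitz_on UNIV (\<lambda>x::real \<times> real \<times> real \<times> real.
      1 / fdot ?c (fst (snd x)) (ce (fst (snd (snd x)))) (cG (snd (snd (snd x)))) (fst x))"
      using bl_clamped(4) by (auto simp: bl_def)
    from continuous_on_compose2[OF lipschitz_on_continuous_on[OF this], of UNIV "\<lambda>t. (t, g t, e t, G t)"]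
    show ?thesis by (simp add: h_def clamp_id[OF box] continuous_intros cont)
  qed
  obtain I where I: "I 0 = 0" "\<And>u. (I has_real_derivative 1 / h u) (at u)"
    using continuous_has_antiderivative[OF conth] by (auto simp: has_real_derivative_iff_has_vector_derivative)
  have P: "?P > 0" using m by simp
  obtain \<Theta> where \<Theta>: "\<And>u. \<Theta> (I u) = u" "\<And>t. I (\<Theta> t) = t"
    "\<And>t. (\<Theta> has_real_derivative h (\<Theta> t)) (at t)" "I ?P > 0" "\<And>u. I (u + ?P) = I u + I ?P" "strict_mono I"
    by (rule clock_inverse[OF I h P hper]) blast
  have \<Theta>0: "\<Theta> 0 = 0" using \<Theta>(1)[of 0] I by simp
  have \<Theta>P: "\<Theta> (t + I ?P) = \<Theta> t + ?P" for t using \<Theta>(1)[of "\<Theta> t + ?P"] \<Theta>(2,5) by simp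
  have \<Theta>IP: "\<Theta> (I ?P) = ?P" by (rule \<Theta>)
  define x where "x t = (kphi (e (\<Theta> t)) (G (\<Theta> t)) (\<Theta> t), kp (e (\<Theta> t)) (G (\<Theta> t)) (\<Theta> t), g (\<Theta> t) + \<Theta> t, G (\<Theta> t))" for t
  have "reduced_motion s \<rho> m1 m2 ?c x"
    unfolding reduced_motion_def hamiltonian_motion_def
  proof (intro allI conjI)
    fix t
    show "x t \<in> {z \<in> polar_domain s. s * (p_theta z)\<^sup>2 < ?c}"
      using kphi_facts[OF con[of "\<Theta> t"], of "\<Theta> t"] cG[of "\<Theta> t"] by (auto simp: polar_domain_def x_def)
    have h0: "h (\<Theta> t) \<noteq> 0" using h[of "\<Theta> t"] by simp
    note d = DERIV_chain2[OF _ \<Theta>(3)[of t]]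
    show "(x has_vector_derivative hamiltonian_field (F_red s \<rho> m1 m2 ?c) (x t)) (at t)"
      unfolding x_def
    proof (rule osculating_motion[of "\<lambda>t. e (\<Theta> t)" t "\<lambda>t. G (\<Theta> t)" ?c \<Theta> "\<lambda>t. g (\<Theta> t)", OF con cG])
      show "(\<Theta> has_real_derivative fdot ?c (g (\<Theta> t)) (e (\<Theta> t)) (G (\<Theta> t)) (\<Theta> t)) (at t)"
        using \<Theta>(3)[of t] by (simp add: h_def)
      show "((\<lambda>t. g (\<Theta> t)) has_real_derivative La ?c (kphi (e (\<Theta> t)) (G (\<Theta> t)) (\<Theta> t)) (g (\<Theta> t) + \<Theta> t) (G (\<Theta> t))
          - qq ?c (g (\<Theta> t)) (e (\<Theta> t)) (G (\<Theta> t)) (\<Theta> t)) (at t)"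
        using d[OF dg] h0 by (simp add: Vg_def flip: h_def)
      show "((\<lambda>t. e (\<Theta> t)) has_real_derivative
          xi ?c (g (\<Theta> t)) (e (\<Theta> t)) (G (\<Theta> t)) (\<Theta> t) * cos (\<Theta> t)
          + eta ?c (g (\<Theta> t)) (e (\<Theta> t)) (G (\<Theta> t)) (\<Theta> t) * sin (\<Theta> t)) (at t)"
        using d[OF de] h0 by (simp add: Ve_def flip: h_def)
      show "((\<lambda>t. G (\<Theta> t)) has_real_derivative
          Xi ?c (kphi (e (\<Theta> t)) (G (\<Theta> t)) (\<Theta> t)) (g (\<Theta> t) + \<Theta> t) (G (\<Theta> t))) (at t)"
        using d[OF dG] h0 by (simp add: VG_def flip: h_def)
    qed
  qed
  moreover have "has_period x (I ?P)"
    unfolding has_period_def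
  proof (intro conjI allI \<Theta>(4))
    fix t
    \<comment> \<open>The polar angle gains the \<open>m\<close> turns on the conic and the
      \<open>j\<close> turns of the conic.\<close>
    have "g (\<Theta> t + ?P) + (\<Theta> t + ?P) = g (\<Theta> t) + \<Theta> t + 2 * pi * of_int (j + int m)"
      unfolding per(1) by (simp add: algebra_simps)
    then show "same_state (x (t + I ?P)) (x t)"
      unfolding x_def \<Theta>P same_state.simps per(2,3) kper by blast
  qed
  \<comment> \<open>The mean anomaly is read off the clock of the instantaneous conic at the
    unreduced true anomaly, so it is continuous across pericenter passages.\<close>
  moreover have "delaunay_lift s \<rho> M x (I ?P)
      (\<lambda>t. 2 * pi * (clock (e (\<Theta> t)) (G (\<Theta> t)) (\<Theta> t) / clock (e (\<Theta> t)) (G (\<Theta> t)) (2 * pi))) (\<lambda>t. g (\<Theta> t))"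
    unfolding delaunay_lift_def
  proof (intro conjI ballI)
    have c\<Theta>: "continuous_on A \<Theta>" for A
      using \<Theta>(3) by (auto intro!: continuous_at_imp_continuous_on intro: DERIV_isCont)
    have c: "continuous_on A (\<lambda>t. g (\<Theta> t))" "continuous_on A (\<lambda>t. e (\<Theta> t))" "continuous_on A (\<lambda>t. G (\<Theta> t))" for A
      by (auto intro!: continuous_on_compose2[OF cont(1)[of UNIV] c\<Theta>] continuous_on_compose2[OF cont(2)[of UNIV] c\<Theta>]
          continuous_on_compose2[OF cont(3)[of UNIV] c\<Theta>])
    show "continuous_on {0..I ?P} (\<lambda>t. g (\<Theta> t))" by (rule c)
    have "clock (e (\<Theta> t)) (G (\<Theta> t)) (2 * pi) \<noteq> 0" for t
      using clock_add_period(1)[OF con[of "\<Theta> t"]] by simp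
    then show "continuous_on {0..I ?P}
      (\<lambda>t. 2 * pi * (clock (e (\<Theta> t)) (G (\<Theta> t)) (\<Theta> t) / clock (e (\<Theta> t)) (G (\<Theta> t)) (2 * pi)))"
      by (intro continuous_on_mult continuous_on_divide continuous_on_const continuous_on_clock c c\<Theta> con ballI)
    show "\<exists>L G'. delaunay s \<rho> M (x t) L
      (2 * pi * (clock (e (\<Theta> t)) (G (\<Theta> t)) (\<Theta> t) / clock (e (\<Theta> t)) (G (\<Theta> t)) (2 * pi))) G' (g (\<Theta> t))" for t
      using delaunay_conic[OF con[of "\<Theta> t"], of "\<Theta> t" "g (\<Theta> t)"] unfolding x_def by blast
  qed
  moreover have "clock (e ?P) (G ?P) ?P = real m * clock (e ?P) (G ?P) (2 * pi)"
    using clock_add_period(2)[OF con[of ?P], of 0 m] by simp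
  then have "2 * pi * (clock (e (\<Theta> (I ?P))) (G (\<Theta> (I ?P))) (\<Theta> (I ?P)) / clock (e (\<Theta> (I ?P))) (G (\<Theta> (I ?P))) (2 * pi))
      - 2 * pi * (clock (e (\<Theta> 0)) (G (\<Theta> 0)) (\<Theta> 0) / clock (e (\<Theta> 0)) (G (\<Theta> 0)) (2 * pi)) = 2 * pi * real m"
    using clock_add_period(1)[OF con[of ?P]] unfolding \<Theta>0 \<Theta>IP by simp
  moreover have "\<bar>g (\<Theta> (I ?P)) - g (\<Theta> 0)\<bar> = 2 * pi * real n"
    unfolding \<Theta>0 \<Theta>IP using per(1)[of 0] j(2) by (simp add: abs_mult)
  ultimately show ?thesis by blast
qed

end

section \<open>Choice of the constants\<close>

theorem theorem2:
  fixes s \<rho> m1 m2 :: real and n :: nat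
  assumes "s \<in> {1, -1}" and "\<rho> > 0"
    and "m1 > 0" and "m2 > 0" and "m1 + m2 = 1"
    and "n \<ge> 1"
  shows "\<exists>m0::nat. \<forall>m\<ge>m0. \<exists>c x T l g.
           reduced_motion s \<rho> m1 m2 c x \<and> has_period x T \<and>
           delaunay_lift s \<rho> (m1 * m2) x T l g \<and>
           l T - l 0 = 2 * pi * real m \<and>
           \<bar>g T - g 0\<bar> = 2 * pi * real n"
proof -
  interpret two_body s \<rho> "m1 * m2" m1 m2
    using assms by unfold_locales auto
  have k: "\<kappa>1 > 0" "\<kappa>2 > 0" "\<kappa>2 = 2688 * \<kappa>1"
    using assms by (auto simp: \<kappa>1_def \<kappa>2_def)
  \<comment> \<open>\<open>A\<close> is the value to be given to
    \<open>\<delta> ^ 4 * (pi * real m)\<close>; with it the upper shooting condition, for the start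
    at \<delta>, holds with equality.\<close>
  define A where "A = 16 * pi * real n / \<kappa>1"
  have A: "A > 0" using k assms by (simp add: A_def)
  \<comment> \<open>Then \<open>3 * \<gamma> = 1 / 16\<close>, and the lower shooting condition
    becomes \<open>2688 * 16 \<le> 16 ^ 4\<close>.\<close>
  define \<gamma> where "\<gamma> = (1 / 48 :: real)"
  \<comment> \<open>Makes the drift over \<open>f = pi * m\<close> equal to the allowed
    \<open>\<gamma> / 4\<close>.\<close>
  define \<epsilon> where "\<epsilon> = \<gamma> / (4 * A)"
  have \<gamma>: "0 < \<gamma>" "\<gamma> \<le> 1 / 4" and \<epsilon>: "\<epsilon> > 0" using A by (auto simp: \<gamma>_def \<epsilon>_def)
  from field_bounds[OF \<gamma>(1) \<epsilon>] obtain d where d: "d > 0" and fb: "\<And>\<delta>. 0 < \<delta> \<Longrightarrow> \<delta> < d \<Longrightarrow>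
    \<delta> > 0 \<and> 32 * \<delta>\<^sup>2 \<le> (m1 * m2)\<^sup>2 * \<rho> \<and> (\<forall>e G g f. box \<gamma> \<delta> e G \<longrightarrow>
    \<gamma> * ((m1 * m2)\<^sup>2 * \<rho>)\<^sup>2 / (1024 * (m1 * m2) * \<rho>\<^sup>2 * \<delta> ^ 3) \<le> fdot (5 * \<delta>\<^sup>2) g e G f \<and>
    \<bar>Ve (5 * \<delta>\<^sup>2) g e G f\<bar> \<le> \<epsilon> * \<delta> ^ 4 \<and> \<bar>VG (5 * \<delta>\<^sup>2) g e G f\<bar> \<le> \<epsilon> * \<delta> ^ 5 \<and>
    \<kappa>1 * G ^ 4 \<le> - s * Vg (5 * \<delta>\<^sup>2) g e G f \<and> - s * Vg (5 * \<delta>\<^sup>2) g e G f \<le> \<kappa>2 * G ^ 4)"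
    unfolding eventually_at_right_field by blast
  obtain m0 :: nat where m0: "A / (pi * d ^ 4) < real m0" using reals_Archimedean2 by blast
  show ?thesis
  proof (intro exI[of _ "Suc m0"] allI impI)
    fix m :: nat assume m: "Suc m0 \<le> m"
    then have m': "m > 0" "real m0 < real m" by auto
    \<comment> \<open>The scale is tied to \<open>m\<close>: many revolutions mean a small orbit,
      and \<open>m > m0\<close> puts \<delta> below the threshold \<open>d\<close> of the
      estimates.\<close>
    define \<delta> where "\<delta> = root 4 (A / (pi * real m))"
    have q: "A / (pi * real m) > 0" using A m' by simp
    have dlt: "\<delta> > 0" "\<delta> ^ 4 = A / (pi * real m)" using q by (auto simp: \<delta>_def)
    have "A / (pi * d ^ 4) < real m" using m0 m' by linarith
    then have "\<delta> ^ 4 < d ^ 4" unfolding dlt(2) using d m' by (simp add: field_simps)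
    then have "\<delta> < d" by (rule power_less_imp_less_base) (use d in simp)
    note fb = fb[OF dlt(1) this]
    let ?k0 = "\<gamma> * ((m1 * m2)\<^sup>2 * \<rho>)\<^sup>2 / (1024 * (m1 * m2) * \<rho>\<^sup>2 * \<delta> ^ 3)"
    interpret shooting s \<rho> "m1 * m2" m1 m2 \<gamma> \<delta> \<epsilon> ?k0
      using fb \<gamma> dlt(1) assms by unfold_locales auto
    have dm: "\<delta> ^ 4 * (pi * real m) = A" unfolding dlt(2) using m' by simp
    show "\<exists>c x T l g.
           reduced_motion s \<rho> m1 m2 c x \<and> has_period x T \<and>
           delaunay_lift s \<rho> (m1 * m2) x T l g \<and>
           l T - l 0 = 2 * pi * real m \<and>
           \<bar>g T - g 0\<bar> = 2 * pi * real n"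
    proof (rule periodic_orbit[OF m'(1)])
      have "\<epsilon> * \<delta> ^ 4 * (pi * real m) = \<epsilon> * A" using dm by (simp add: mult.assoc)
      then show "\<epsilon> * \<delta> ^ 4 * (pi * real m) \<le> \<gamma> / 4" using A by (simp add: \<epsilon>_def)
      have "\<kappa>2 * (3 * \<gamma> * \<delta>) ^ 4 * (pi * real m) = \<kappa>2 * (3 * \<gamma>) ^ 4 * A"
        using dm by (simp add: power_mult_distrib mult.assoc)
      also have "\<dots> \<le> pi * real n"
        using k(1) unfolding k(3) A_def \<gamma>_def by (simp add: power_divide field_simps)
      finally show "\<kappa>2 * (3 * \<gamma> * \<delta>) ^ 4 * (pi * real m) \<le> pi * real n" .
      have "\<kappa>1 * (\<delta> / 2) ^ 4 * (pi * real m) = \<kappa>1 / 16 * A"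
        using dm by (simp add: power_divide mult.assoc)
      also have "\<dots> = pi * real n" using k(1) by (simp add: A_def)
      finally show "pi * real n \<le> \<kappa>1 * (\<delta> / 2) ^ 4 * (pi * real m)" by simp
    qed
  qed
qed

end
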